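(* For $m=1$, $\lim_{n\to\infty}(a_n^{(1)})^{1/n}=1$. For every $m\ge2$, the limit $\lim_{n\to\infty}(a_n^{(m)})^{1/n}$ exists and equals \[ \alpha_m=\max\{\lambda_U(m),\lambda_V(m)\}. \] Equivalently, with $\rho_m=\min\{r_{U_m},r_{V_m}\}$, the radius of convergence of $A^{(m)}(x)$ is $\rho_m$ and $\alpha_m=\rho_m^{-1}$. Moreover, $x=\rho_m$ is the unique pole of $A^{(m)}(x)$ of modulus $\rho_m$ (the unique dominant pole).
   Context: A permutation $\pi\in S_n$ avoids $132$ if there are no $i<j<k$ with $\pi_i<\pi_k<\pi_j$; $\operatorname{Av}_n(132)$ is the set of such permutations. For fixed $m\ge1$, $a_n^{(m)}$ is the number of $\pi\in\operatorname{Av}_n(132)$ with $|\pi_{i+1}-\pi_i|\le m$ for all $1\le i<n$ ($a_0^{(m)}=1$) and $A^{(m)}(x)=\sum_{n\ge0}a_n^{(m)}x^n$ (a rational function). Let $B_m=\{0,1,\ldots,m-1,\infty\}$, $\infty-r=\infty$. Set $c_{1,p}=1$ and, for $2\le k\le m$, $c_{k,p}=|\{\sigma\in\operatorname{Av}_{k-1}(132):k-\sigma_1\le p\}|$ (no condition if $p=\infty$). $W_m(x)$ is the matrix indexed by $B_m^2$ with $W_{(p,q),(r,s)}(x)=\sum_{k=1}^m c_{k,p}x^k\chi_{(r,s)=(m-k,q-k)}+x\chi_{(r,s)=(p-1,m-1)}$, indicators $0$ when the pair has a negative coordinate; $W_S(x)$ is its principal submatrix indexed by $S\subseteq B_m^2$.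 Let $U_m=\{(p,\infty):0\le p\le m-1\}$ and $V_m=\{(p,q):0\le p,q\le m-1,\ q<p\}\cup\{(p,m-1):0\le p\le m-2\}$. For $C\in\{U_m,V_m\}$, $r_C$ is the unique real $r\in(0,1]$ with $\operatorname{spr}(W_C(r))=1$ (spectral radius; exists and is unique), and $\lambda_U(m)=r_{U_m}^{-1}$, $\lambda_V(m)=r_{V_m}^{-1}$. *)

theory Defs
  imports
    "HOL-Complex_Analysis.Complex_Analysis"
    "HOL-Combinatorics.Multiset_Permutations"
    "HOL-Library.Extended_Nat"
    "Jordan_Normal_Form.Spectral_Radius"
begin

text \<open>
  Permutations are written in one-line notation, as lists enumerating \<open>{1..n}\<close>;
  list positions start at \<open>0\<close>, so \<open>\<pi>\<^sub>1\<close> is \<open>hd \<pi>\<close>.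
\<close>

definition avoids_132 :: "nat list \<Rightarrow> bool" where
  "avoids_132 \<pi> \<longleftrightarrow>
     \<not> (\<exists>i j k. i < j \<and> j < k \<and> k < length \<pi> \<and> \<pi> ! i < \<pi> ! k \<and> \<pi> ! k < \<pi> ! j)"

definition Av132 :: "nat \<Rightarrow> nat list set" where
  "Av132 n = {\<pi> \<in> permutations_of_set {1..n}. avoids_132 \<pi>}"

definition bounded_steps :: "nat \<Rightarrow> nat list \<Rightarrow> bool" where
  "bounded_steps m \<pi> \<longleftrightarrow>
     (\<forall>i. Suc i < length \<pi> \<longrightarrow> \<bar>int (\<pi> ! Suc i) - int (\<pi> ! i)\<bar> \<le> int m)"

definition count132 :: "nat \<Rightarrow> nat \<Rightarrow> nat" where
  "count132 m n = card {\<pi> \<in> Av132 n. bounded_steps m \<pi>}"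

definition gf132 :: "nat \<Rightarrow> complex fps" where
  "gf132 m = Abs_fps (\<lambda>n. of_nat (count132 m n))"

text \<open>
  A power series that is the expansion at \<open>0\<close> of a rational function \<open>P / Q\<close> has as its
  poles the poles of \<open>P / Q\<close>. The function \<open>P / Q\<close> is determined by \<open>F\<close> up to its values at
  finitely many points, which do not affect \<^const>\<open>is_pole\<close>. A series that is not rational has
  no pole in this sense.
\<close>

definition rational_fps_pole :: "complex fps \<Rightarrow> complex \<Rightarrow> bool" where
  "rational_fps_pole F z \<longleftrightarrow>
     (\<exists>P Q. Q \<noteq> 0 \<and> F * fps_of_poly Q = fps_of_poly P \<and> is_pole (\<lambda>w. poly P w / poly Q w) z)"

text \<open>
  The index set \<open>B\<^sub>m = {0, \<dots>, m - 1, \<infinity>}\<close> consists of extended natural numbers, where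
  \<open>\<infinity> - r = \<infinity>\<close> for finite \<open>r\<close>. As \<^typ>\<open>enat\<close> has truncated subtraction, non-negativity of a
  coordinate \<open>q - k\<close> is expressed by \<open>k \<le> q\<close>.
\<close>

definition Bset :: "nat \<Rightarrow> enat set" where
  "Bset m = enat ` {..<m} \<union> {\<infinity>}"

definition cnum :: "nat \<Rightarrow> enat \<Rightarrow> nat" where
  "cnum k p = (if k = 1 then 1 else card {\<sigma> \<in> Av132 (k - 1). enat (k - hd \<sigma>) \<le> p})"

definition Wentry :: "nat \<Rightarrow> complex \<Rightarrow> enat \<times> enat \<Rightarrow> enat \<times> enat \<Rightarrow> complex" where
  "Wentry m x = (\<lambda>(p, q) (r, s).
     (\<Sum>k=1..m. of_nat (cnum k p) * x ^ k *
        of_bool (enat k \<le> q \<and> (r, s) = (enat (m - k), q - enat k)))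
     + x * of_bool (1 \<le> p \<and> (r, s) = (p - 1, enat (m - 1))))"

text \<open>
  The matrix with entries \<open>f s t\<close> for \<open>s\<close> and \<open>t\<close> in a finite index set \<open>S\<close>, with respect to an
  arbitrary enumeration of \<open>S\<close>. Its eigenvalues do not depend on the enumeration, as shown below.
\<close>

definition index_list :: "'i set \<Rightarrow> 'i list" where
  "index_list S = (SOME xs. set xs = S \<and> distinct xs)"

definition indexed_mat :: "'i set \<Rightarrow> ('i \<Rightarrow> 'i \<Rightarrow> 'a) \<Rightarrow> 'a mat" where
  "indexed_mat S f =
     Matrix.mat (card S) (card S) (\<lambda>(i, j). f (index_list S ! i) (index_list S ! j))"

text \<open>
  The principal submatrix of \<open>W\<^sub>m(x)\<close> for the rows and columns in \<open>S \<subseteq> B\<^sub>m \<times> B\<^sub>m\<close>;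
  \<open>Wmat m (Bset m \<times> Bset m) x\<close> is \<open>W\<^sub>m(x)\<close> itself.
\<close>

definition Wmat :: "nat \<Rightarrow> (enat \<times> enat) set \<Rightarrow> complex \<Rightarrow> complex mat" where
  "Wmat m S x = indexed_mat S (Wentry m x)"

definition Uset :: "nat \<Rightarrow> (enat \<times> enat) set" where
  "Uset m = {(enat p, \<infinity>) | p. p < m}"

definition Vset :: "nat \<Rightarrow> (enat \<times> enat) set" where
  "Vset m = {(enat p, enat q) | p q. p < m \<and> q < m \<and> q < p}
          \<union> {(enat p, enat (m - 1)) | p. p + 2 \<le> m}"

definition r_crit :: "nat \<Rightarrow> (enat \<times> enat) set \<Rightarrow> real" where
  "r_crit m C = (THE r. 0 < r \<and> r \<le> 1 \<and> spectral_radius (Wmat m C (of_real r)) = 1)"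

definition lambda_U :: "nat \<Rightarrow> real" where
  "lambda_U m = inverse (r_crit m (Uset m))"

definition lambda_V :: "nat \<Rightarrow> real" where
  "lambda_V m = inverse (r_crit m (Vset m))"

definition alpha :: "nat \<Rightarrow> real" where
  "alpha m = max (lambda_U m) (lambda_V m)"

definition rho :: "nat \<Rightarrow> real" where
  "rho m = min (r_crit m (Uset m)) (r_crit m (Vset m))"


lemma count132_0: "count132 m 0 = 1"
proof -
  have "{\<pi> \<in> Av132 0. bounded_steps m \<pi>} = {[]}"
    by (auto simp: Av132_def avoids_132_def bounded_steps_def)
  thus ?thesis by (simp add: count132_def)
qed

lemma Uset_subset: "Uset m \<subseteq> Bset m \<times> Bset m"
  by (auto simp: Uset_def Bset_def)

lemma Vset_subset: "Vset m \<subseteq> Bset m \<times> Bset m"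
  by (auto simp: Vset_def Bset_def)

lemma index_list:
  assumes "finite S"
  shows "set (index_list S) = S" "distinct (index_list S)" "length (index_list S) = card S"
proof -
  have *: "set (index_list S) = S \<and> distinct (index_list S)"
    unfolding index_list_def by (rule someI_ex) (rule finite_distinct_list[OF assms])
  thus "set (index_list S) = S" "distinct (index_list S)" by auto
  with distinct_card show "length (index_list S) = card S" by metis
qed

lemma eigenvalue_indexed_mat_iff:
  fixes f :: "'i \<Rightarrow> 'i \<Rightarrow> 'a :: comm_ring_1"
  assumes fin: "finite S"
  shows "eigenvalue (indexed_mat S f) \<mu> \<longleftrightarrow>
    (\<exists>v. (\<exists>s\<in>S. v s \<noteq> 0) \<and> (\<forall>s\<in>S. (\<Sum>t\<in>S. f s t * v t) = \<mu> * v s))"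
proof -
  let ?n = "card S" and ?xs = "index_list S"
  let ?M = "indexed_mat S f"
  note il = index_list[OF fin]
  have bij: "bij_betw ((!) ?xs) {0..<?n} S"
    using bij_betw_nth[OF il(2) _ il(1)[symmetric], of "{..<?n}"] il(3)
    by (simp add: atLeast0LessThan)
  have all: "(\<forall>s\<in>S. P s) \<longleftrightarrow> (\<forall>i<?n. P (?xs ! i))" for P
    using il(1,3) by (metis in_set_conv_nth)
  have ex: "(\<exists>s\<in>S. P s) \<longleftrightarrow> (\<exists>i<?n. P (?xs ! i))" for P
    using il(1,3) by (metis in_set_conv_nth)
  have dim: "dim_row ?M = ?n" by (simp add: indexed_mat_def)
  have row: "vec_index (?M *\<^sub>v w) i = (\<Sum>j\<in>{0..<?n}. f (?xs ! i) (?xs ! j) * vec_index w j)"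
    if "i < ?n" "w \<in> carrier_vec ?n" for i w
    using that by (auto simp: indexed_mat_def scalar_prod_def)
  have key: "eigenvector ?M w \<mu> \<longleftrightarrow>
      (\<exists>s\<in>S. v s \<noteq> 0) \<and> (\<forall>s\<in>S. (\<Sum>t\<in>S. f s t * v t) = \<mu> * v s)"
    if w: "w \<in> carrier_vec ?n" and vw: "\<And>i. i < ?n \<Longrightarrow> v (?xs ! i) = vec_index w i" for v w
  proof -
    have sum: "(\<Sum>t\<in>S. f s t * v t) = (\<Sum>j\<in>{0..<?n}. f s (?xs ! j) * vec_index w j)" for s
      unfolding sum.reindex_bij_betw[OF bij, symmetric] by (intro sum.cong) (auto simp: vw)
    have "w \<noteq> 0\<^sub>v ?n \<longleftrightarrow> (\<exists>s\<in>S. v s \<noteq> 0)"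
      unfolding ex using w by (auto simp: vw Matrix.vec_eq_iff)
    moreover have "?M *\<^sub>v w = \<mu> \<cdot>\<^sub>v w \<longleftrightarrow> (\<forall>s\<in>S. (\<Sum>t\<in>S. f s t * v t) = \<mu> * v s)"
      unfolding all sum using w row[OF _ w] by (auto simp: vw Matrix.vec_eq_iff dim)
    ultimately show ?thesis using w by (simp add: eigenvector_def dim)
  qed
  show ?thesis
  proof
    assume "eigenvalue ?M \<mu>"
    then obtain w where ev: "eigenvector ?M w \<mu>" by (auto simp: eigenvalue_def)
    hence w: "w \<in> carrier_vec ?n" by (simp add: eigenvector_def dim)
    define v where "v s = vec_index w (the_inv_into {0..<?n} ((!) ?xs) s)" for s
    have "v (?xs ! i) = vec_index w i" if "i < ?n" for i
      using bij that by (simp add: v_def the_inv_into_f_f bij_betw_def)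
    from key[OF w this] ev show "\<exists>v. (\<exists>s\<in>S. v s \<noteq> 0) \<and>
        (\<forall>s\<in>S. (\<Sum>t\<in>S. f s t * v t) = \<mu> * v s)" by blast
  next
    assume "\<exists>v. (\<exists>s\<in>S. v s \<noteq> 0) \<and> (\<forall>s\<in>S. (\<Sum>t\<in>S. f s t * v t) = \<mu> * v s)"
    then obtain v where v: "(\<exists>s\<in>S. v s \<noteq> 0) \<and>
        (\<forall>s\<in>S. (\<Sum>t\<in>S. f s t * v t) = \<mu> * v s)" by blast
    have "eigenvector ?M (Matrix.vec ?n (\<lambda>i. v (?xs ! i))) \<mu>"
      by (subst key[where v = v]) (use v in auto)
    thus "eigenvalue ?M \<mu>" by (auto simp: eigenvalue_def)
  qed
qed

end

theory Submission
  imports Defs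
begin

text \<open>
  Splitting a permutation at its maximum shows that the numbers of 132-avoiding permutations with
  steps bounded by \<open>m\<close>, refined by upper bounds \<open>(p, q)\<close> on the distances of the first and the last
  entry to the maximum, satisfy the linear system \<open>F = x + W\<^sub>m F\<close>. From \<open>(\<infinity>, \<infinity>)\<close> one reaches \<open>(\<infinity>, m - 1)\<close>,
  the irreducible class \<open>U\<^sub>m\<close> and, from these, the closed irreducible class \<open>V\<^sub>m\<close>.
  Perron vectors of \<open>W\<^sub>C\<close> at the critical radii are geometric sub- and supersolutions of the
  recursion, which pins down the growth up to a polynomial factor and makes \<open>\<rho>\<^sub>m\<close> a singularity.
  At any other \<open>z\<close> with \<open>\<bar>z\<bar> = \<rho>\<^sub>m\<close>, a fixed vector of \<open>W\<^sub>C(z)\<close> would have phases that are consistent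
  along all edges, which is impossible by aperiodicity; hence \<open>1 - W\<^sub>C(z)\<close> is invertible and
  Cramer's rule yields a denominator that does not vanish at \<open>z\<close>.
\<close>

section \<open>Perron--Frobenius theory of irreducible matrices\<close>

text \<open>What makes the system finite is that a nonempty block after the maximum limits the block
  before it: by 132-avoidance the left block lies entirely above the right one, so with
  \<open>k - 1\<close> entries on the left the step down from the maximum is at least
  \<open>k\<close>, whence \<open>k \<le> m\<close>. So short a left block satisfies all step bounds
  automatically, and only the distance of its first entry matters; this is the origin of
  \<open>cnum\<close> and of the degree bound \<open>m\<close> of the weights.

  The obstacle is that for general \<open>m\<close> the two critical radii are not compared. If they
  coincide, the pole may be multiple, hence the polynomial factor in the upper bound, which the n-th
  root does not see. That \<open>rho m\<close> is a singularity cannot be read off from a vanishing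
  determinant, which numerators might cancel; it comes from nonnegative coefficients and the lower
  bound. Determinants serve only the opposite direction, regularity elsewhere on the circle.
  Aperiodicity fails for \<open>Vset 2\<close>, a cycle of length two, so there the radii do have to
  be compared.\<close>

definition irreducible_on :: "'i set \<Rightarrow> ('i \<Rightarrow> 'i \<Rightarrow> bool) \<Rightarrow> bool" where
  "irreducible_on S E \<longleftrightarrow>
     (\<forall>T\<subseteq>S. T \<noteq> {} \<longrightarrow> (\<forall>s\<in>T. \<forall>t\<in>S. E s t \<longrightarrow> t \<in> T) \<longrightarrow> T = S)"

lemma irreducible_onD:
  assumes "irreducible_on S E" "T \<subseteq> S" "T \<noteq> {}" "\<And>s t. s \<in> T \<Longrightarrow> t \<in> S \<Longrightarrow> E s t \<Longrightarrow> t \<in> T"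
  shows "T = S"
  using assms unfolding irreducible_on_def by blast

lemma irreducible_on_cong:
  assumes "irreducible_on S E" "\<And>s t. s \<in> S \<Longrightarrow> t \<in> S \<Longrightarrow> E s t \<longleftrightarrow> E' s t"
  shows "irreducible_on S E'"
  unfolding irreducible_on_def
proof (intro allI impI)
  fix T assume "T \<subseteq> S" "T \<noteq> {}" "\<forall>s\<in>T. \<forall>t\<in>S. E' s t \<longrightarrow> t \<in> T"
  thus "T = S" by (intro irreducible_onD[OF assms(1)]) (use assms(2) in blast)+
qed

text \<open>The vectors are functions on the whole type, so compactness is Tychonoff's theorem for a
  power of the unit interval, cut by a closed hyperplane; entries outside \<open>S\<close> range
  freely over the interval.\<close>

lemma compact_unit_simplex:
  assumes "finite S"
  shows "compact {v :: 'i \<Rightarrow> real. (\<forall>s. v s \<in> {0..1}) \<and> (\<Sum>s\<in>S. v s) = 1}"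
proof -
  have "compactin (product_topology (\<lambda>_::'i. euclidean) UNIV) (PiE UNIV (\<lambda>_. {0..1::real}))"
    by (subst compactin_PiE) (auto simp: compactin_euclidean_iff)
  hence c: "compact (PiE (UNIV :: 'i set) (\<lambda>_. {0..1::real}))"
    by (simp add: euclidean_product_topology compactin_euclidean_iff)
  have "closed {v :: 'i \<Rightarrow> real. (\<Sum>s\<in>S. v s) = 1}"
    by (intro closed_Collect_eq continuous_intros) auto
  from compact_Int_closed[OF c this] show ?thesis
    by (rule back_subst[of compact]) (auto simp: PiE_def Pi_def)
qed

text \<open>If \<open>v s = 0\<close>, the inequality at \<open>s\<close> forces
  \<open>v t = 0\<close> for every successor \<open>t\<close>, so the zero set is closed under
  successors. Arguments of this kind are why irreducibility is encoded by closed subsets rather than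
  by paths.\<close>

lemma subinvariant_vector_pos:
  fixes A :: "'i \<Rightarrow> 'i \<Rightarrow> real"
  assumes irr: "irreducible_on S (\<lambda>s t. A s t \<noteq> 0)" and fin: "finite S"
    and nn: "\<And>s t. s \<in> S \<Longrightarrow> t \<in> S \<Longrightarrow> A s t \<ge> 0"
    and v: "\<And>s. s \<in> S \<Longrightarrow> v s \<ge> 0" "\<exists>s\<in>S. v s \<noteq> 0"
    and sub: "\<And>s. s \<in> S \<Longrightarrow> (\<Sum>t\<in>S. A s t * v t) \<le> l * v s"
    and s: "s \<in> S"
  shows "v s > 0"
proof (rule ccontr)
  assume ns: "\<not> v s > 0"
  have "{s\<in>S. v s = 0} = S"
  proof (rule irreducible_onD[OF irr])
    from ns v(1)[OF s] s show "{s\<in>S. v s = 0} \<noteq> {}" by force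
    fix s t assume st: "s \<in> {s\<in>S. v s = 0}" "t \<in> S" "A s t \<noteq> 0"
    hence "(\<Sum>t\<in>S. A s t * v t) \<le> 0" using sub[of s] by auto
    moreover have "\<And>t. t \<in> S \<Longrightarrow> 0 \<le> A s t * v t" using st nn v by auto
    ultimately have "\<forall>t\<in>S. A s t * v t = 0"
      using sum_nonneg_eq_0_iff[OF fin] by (metis (no_types, lifting) order_antisym sum_nonneg)
    thus "t \<in> {s\<in>S. v s = 0}" using st by auto
  qed auto
  with v(2) show False by auto
qed

text \<open>
  The eigenvalue is the least \<open>l\<close> admitting a vector \<open>v\<close> in the simplex with \<open>A v \<le> l v\<close>.
  If \<open>v\<close> has the most strict inequalities and some, but not all, inequalities are strict, lowering a
  strict coordinate makes a tight predecessor strict; if all are strict, \<open>l\<close> can be lowered.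
\<close>

lemma perron_frobenius_irreducible:
  fixes A :: "'i \<Rightarrow> 'i \<Rightarrow> real"
  assumes irr: "irreducible_on S (\<lambda>s t. A s t \<noteq> 0)" and fin: "finite S" and ne: "S \<noteq> {}"
    and nn: "\<And>s t. s \<in> S \<Longrightarrow> t \<in> S \<Longrightarrow> A s t \<ge> 0"
  obtains l v where "l \<ge> 0" "\<And>s. s \<in> S \<Longrightarrow> v s > 0"
    "\<And>s. s \<in> S \<Longrightarrow> (\<Sum>t\<in>S. A s t * v t) = l * v s"
proof -
  define K where "K = {v :: 'i \<Rightarrow> real. (\<forall>s. v s \<in> {0..1}) \<and> (\<Sum>s\<in>S. v s) = 1}"
  \<comment> \<open>The uniform vector satisfies the inequalities with \<open>l = L\<close>, so
    restricting \<open>l\<close> to \<open>{0..L}\<close> keeps the search region nonempty and makes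
    it compact.\<close>
  define L where "L = (\<Sum>s\<in>S. \<Sum>t\<in>S. A s t)"
  have L0: "L \<ge> 0" unfolding L_def by (intro sum_nonneg nn)
  have K0: "(\<lambda>s. if s \<in> S then 1 / real (card S) else 0) \<in> K"
    using fin ne by (auto simp: K_def card_gt_0_iff Suc_le_eq)
  define Z where "Z = ({0..L} \<times> K) \<inter> {x. \<forall>s\<in>S. (\<Sum>t\<in>S. A s t * snd x t) \<le> fst x * snd x s}"
  have "closed {x. \<forall>s\<in>S. (\<Sum>t\<in>S. A s t * snd x t) \<le> fst x * snd x s}"
    (is "closed ?X")
  proof -
    have "?X = (\<Inter>s\<in>S. {x. (\<Sum>t\<in>S. A s t * snd x t) \<le> fst x * snd x s})" by auto
    moreover have "closed \<dots>"
    proof (intro closed_INT ballI closed_Collect_le)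
      have *: "continuous_on UNIV (\<lambda>x :: real \<times> ('i \<Rightarrow> real). snd x s)" for s
        by (rule continuous_on_compose2[OF continuous_on_product_coordinates, of UNIV snd])
          (auto intro: continuous_intros)
      show "continuous_on UNIV (\<lambda>x :: real \<times> ('i \<Rightarrow> real). \<Sum>t\<in>S. A s t * snd x t)" for s
        by (intro continuous_intros *)
      show "continuous_on UNIV (\<lambda>x :: real \<times> ('i \<Rightarrow> real). fst x * snd x s)" for s
        by (intro continuous_intros *)
    qed
    ultimately show ?thesis by simp
  qed
  moreover have "compact ({0..L} \<times> K)"
    unfolding K_def by (intro compact_Times compact_unit_simplex fin) auto
  ultimately have Zc: "compact Z" unfolding Z_def by (intro compact_Int_closed)
  have "(L, \<lambda>s. if s \<in> S then 1 / real (card S) else 0) \<in> Z"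
  proof -
    have "(\<Sum>t\<in>S. A s t) \<le> L" if "s \<in> S" for s
      unfolding L_def using that by (intro member_le_sum fin sum_nonneg nn) auto
    thus ?thesis using K0 L0 fin ne
      by (auto simp: Z_def sum_divide_distrib[symmetric] card_gt_0_iff divide_simps)
  qed
  hence "Z \<noteq> {}" by auto
  from continuous_attains_inf[OF Zc this, of fst]
  obtain z where z: "z \<in> Z" "\<And>y. y \<in> Z \<Longrightarrow> fst z \<le> fst y"
    using continuous_on_fst[OF continuous_on_id] by blast
  define l where "l = fst z"
  have l: "0 \<le> l" "l \<le> L" using z by (auto simp: Z_def l_def)
  define good where "good v \<longleftrightarrow> (\<forall>s\<in>S. v s > 0) \<and> (\<forall>s\<in>S. (\<Sum>t\<in>S. A s t * v t) \<le> l * v s)" for v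
  have min: "\<not> (\<forall>s\<in>S. (\<Sum>t\<in>S. A s t * v t) < l * v s)" if pos: "\<forall>s\<in>S. v s > 0" for v
  proof
    assume *: "\<forall>s\<in>S. (\<Sum>t\<in>S. A s t * v t) < l * v s"
    define l' where "l' = Max ((\<lambda>s. (\<Sum>t\<in>S. A s t * v t) / v s) ` S)"
    have 1: "l' < l" unfolding l'_def using * pos fin ne by (subst Max_less_iff) (auto simp: field_simps)
    have ge: "(\<Sum>t\<in>S. A s t * v t) / v s \<le> l'" if "s \<in> S" for s
      unfolding l'_def using fin that by (intro Max_ge) auto
    obtain s0 where s0: "s0 \<in> S" using ne by auto
    have "0 \<le> (\<Sum>t\<in>S. A s0 t * v t) / v s0"
      using pos s0 nn by (intro divide_nonneg_pos sum_nonneg mult_nonneg_nonneg) (auto intro: less_imp_le)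
    hence 2: "l' \<ge> 0" using ge[OF s0] by linarith
    define T where "T = (\<Sum>s\<in>S. v s)"
    have T: "T > 0" unfolding T_def using pos fin ne by (intro sum_pos) auto
    define w where "w s = (if s \<in> S then v s / T else 0)" for s
    have "v s \<le> T" if "s \<in> S" for s
      unfolding T_def using that pos fin by (intro member_le_sum) (auto intro: less_imp_le)
    hence "w \<in> K" using T pos by (auto simp: K_def w_def sum_divide_distrib[symmetric] T_def[symmetric] less_imp_le)
    moreover have "(\<Sum>t\<in>S. A s t * w t) \<le> l' * w s" if "s \<in> S" for s
    proof -
      have "(\<Sum>t\<in>S. A s t * w t) = (\<Sum>t\<in>S. A s t * v t) / T"
        by (simp add: w_def sum_divide_distrib)
      thus ?thesis using ge[OF that] pos that T by (simp add: w_def field_simps)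
    qed
    ultimately have "(l', w) \<in> Z" using 1 2 l by (auto simp: Z_def)
    from z(2)[OF this] 1 show False by (simp add: l_def)
  qed
  have "good (snd z)"
    unfolding good_def
  proof (intro conjI ballI)
    show sub: "(\<Sum>t\<in>S. A s t * snd z t) \<le> l * snd z s" if "s \<in> S" for s
      using z that by (auto simp: Z_def l_def)
    have "(\<Sum>s\<in>S. snd z s) = 1" "\<And>s. snd z s \<ge> 0" using z by (auto simp: Z_def K_def)
    thus "snd z s > 0" if "s \<in> S" for s
      by (intro subinvariant_vector_pos[OF irr fin nn _ _ sub that]) (auto intro: ccontr)
  qed
  define strict where "strict v = {s\<in>S. (\<Sum>t\<in>S. A s t * v t) < l * v s}" for v
  have "\<exists>v. good v \<and> (\<forall>w. good w \<longrightarrow> card (strict w) \<le> card (strict v))"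
    by (rule ex_has_greatest_nat[of good _ _ "Suc (card S)"])
      (use \<open>good (snd z)\<close> fin in \<open>auto simp: strict_def less_Suc_eq_le intro!: card_mono\<close>)
  then obtain v where v: "good v" "\<And>w. good w \<Longrightarrow> card (strict w) \<le> card (strict v)" by auto
  have "strict v = {}"
  proof (rule ccontr)
    assume nem: "strict v \<noteq> {}"
    have "S - strict v \<noteq> {}" using min[of v] v(1) by (auto simp: strict_def good_def)
    moreover have "S - strict v \<noteq> S" using nem by (auto simp: strict_def)
    ultimately obtain s t where st: "s \<in> S - strict v" "t \<in> S" "A s t \<noteq> 0" "t \<in> strict v"
      using irreducible_onD[OF irr, of "S - strict v"] by blast
    \<comment> \<open>The first bound keeps \<open>v t - e\<close> positive, the second keeps
      \<open>t\<close> strict; the divisor \<open>l + 1\<close> instead of \<open>l\<close> covers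
      \<open>l = 0\<close>.\<close>
    define e where "e = min (v t / 2) ((l * v t - (\<Sum>u\<in>S. A t u * v u)) / (l + 1) / 2)"
    have vt: "v t > 0" using st v(1) by (auto simp: good_def)
    have slack: "l * v t - (\<Sum>u\<in>S. A t u * v u) > 0" using st by (auto simp: strict_def)
    have e: "e > 0" "e < v t" "l * e < l * v t - (\<Sum>u\<in>S. A t u * v u)"
    proof -
      show "e > 0" "e < v t" using vt slack l by (auto simp: e_def)
      have "l * e \<le> l * ((l * v t - (\<Sum>u\<in>S. A t u * v u)) / (l + 1) / 2)"
        unfolding e_def using l by (intro mult_left_mono) auto
      also have "\<dots> = (l * v t - (\<Sum>u\<in>S. A t u * v u)) * (l / (l + 1) / 2)" by (simp add: field_simps)
      also have "\<dots> < (l * v t - (\<Sum>u\<in>S. A t u * v u)) * 1"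
        using slack l by (intro mult_strict_left_mono) (auto simp: field_simps)
      finally show "l * e < l * v t - (\<Sum>u\<in>S. A t u * v u)" by simp
    qed
    define w where "w = v(t := v t - e)"
    have sw: "(\<Sum>u\<in>S. A x u * w u) = (\<Sum>u\<in>S. A x u * v u) - A x t * e" for x
    proof -
      have "(\<Sum>u\<in>S. A x u * w u) = (\<Sum>u\<in>S. A x u * v u - (if u = t then A x t * e else 0))"
        by (intro sum.cong) (auto simp: w_def algebra_simps)
      thus ?thesis using fin st by (simp add: sum_subtractf)
    qed
    have wt: "w t = v t - e" and wx: "x \<noteq> t \<Longrightarrow> w x = v x" for x by (simp_all add: w_def)
    have Anx: "A x t * e \<ge> 0" if "x \<in> S" for x using nn[OF that st(2)] e by simp
    have tt: "(\<Sum>u\<in>S. A t u * w u) < l * w t"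
      unfolding sw wt using Anx[OF st(2)] e(3) by (simp add: algebra_simps)
    have "good w" unfolding good_def
    proof (intro conjI ballI)
      fix x assume x: "x \<in> S"
      show "w x > 0" using v(1) x e by (cases "x = t") (auto simp: wt wx good_def)
      have "(\<Sum>u\<in>S. A x u * v u) \<le> l * v x" using v(1) x by (simp add: good_def)
      thus "(\<Sum>u\<in>S. A x u * w u) \<le> l * w x"
        by (cases "x = t") (use tt Anx[OF x] in \<open>auto simp: sw wx\<close>)
    qed
    moreover have "insert s (strict v) \<subseteq> strict w"
    proof -
      have "A s t * e > 0" using nn[of s t] st e by (simp add: less_le)
      moreover have "w s = v s" using st by (intro wx) auto
      moreover have "(\<Sum>u\<in>S. A s u * v u) \<le> l * v s" using v(1) st by (simp add: good_def)
      ultimately have "s \<in> strict w" using st by (auto simp: strict_def sw)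
      moreover have "x \<in> strict w" if "x \<in> strict v" for x
      proof (cases "x = t")
        case True thus ?thesis using tt st by (simp add: strict_def)
      next
        case False
        have "x \<in> S" "(\<Sum>u\<in>S. A x u * v u) < l * v x" using that by (auto simp: strict_def)
        thus ?thesis using Anx[of x] wx[OF False] unfolding strict_def sw by simp
      qed
      ultimately show ?thesis by auto
    qed
    hence "card (insert s (strict v)) \<le> card (strict w)"
      using fin by (intro card_mono) (auto simp: strict_def)
    moreover have "card (insert s (strict v)) = Suc (card (strict v))"
      using st fin by (subst card_insert_disjoint) (auto simp: strict_def)
    ultimately show False using v(2)[of w] by simp
  qed
  show ?thesis
  proof (rule that[of l v])
    show "l \<ge> 0" by (rule l)
    show "v s > 0" if "s \<in> S" for s using v(1) that by (auto simp: good_def)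
    show "(\<Sum>t\<in>S. A s t * v t) = l * v s" if "s \<in> S" for s
      using v(1) that \<open>strict v = {}\<close> by (force simp: good_def strict_def)
  qed
qed

text \<open>At a coordinate with maximal ratio of \<open>cmod (w s)\<close> to \<open>v s\<close>,
  the eigenvalue equation of \<open>w\<close> can be compared with the inequality for
  \<open>v\<close>; both comparison arguments below start there.\<close>

lemma max_norm_ratio:
  fixes w :: "'i \<Rightarrow> complex"
  assumes fin: "finite S" and v: "\<And>s. s \<in> S \<Longrightarrow> v s > 0" and w: "\<exists>s\<in>S. w s \<noteq> 0"
  obtains M s where "M > 0" "\<And>s. s \<in> S \<Longrightarrow> cmod (w s) \<le> M * v s" "s \<in> S" "cmod (w s) = M * v s"
proof -
  from w have ne: "S \<noteq> {}" by auto
  define M where "M = Max ((\<lambda>s. cmod (w s) / v s) ` S)"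
  have le: "cmod (w s) \<le> M * v s" if "s \<in> S" for s
  proof -
    have "cmod (w s) / v s \<le> M" unfolding M_def using fin that by (intro Max_ge) auto
    thus ?thesis using v[OF that] by (simp add: field_simps)
  qed
  have "M \<in> (\<lambda>s. cmod (w s) / v s) ` S" unfolding M_def using fin ne by (intro Max_in) auto
  then obtain s where s: "s \<in> S" "cmod (w s) = M * v s" using v by (force simp: field_simps)
  obtain x where x: "x \<in> S" "w x \<noteq> 0" using w by auto
  hence "0 < cmod (w x)" by simp
  also have "\<dots> \<le> M * v x" by (rule le[OF x(1)])
  finally have "M > 0" using v[OF x(1)] by (simp add: zero_less_mult_iff)
  from that[OF this le s] show ?thesis .
qed

text \<open>Take norms in the eigenvalue equation at a coordinate of maximal ratio. Admitting a
  complex \<open>B\<close> dominated by a real \<open>A\<close> covers the matrices at non-real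
  points.\<close>

lemma subinvariant_vector_bounds_eigenvalue:
  fixes B :: "'i \<Rightarrow> 'i \<Rightarrow> complex"
  assumes fin: "finite S"
    and dom: "\<And>s t. s \<in> S \<Longrightarrow> t \<in> S \<Longrightarrow> cmod (B s t) \<le> A s t"
    and v: "\<And>s. s \<in> S \<Longrightarrow> v s > 0"
    and sub: "\<And>s. s \<in> S \<Longrightarrow> (\<Sum>t\<in>S. A s t * v t) \<le> l * v s"
    and ev: "\<And>s. s \<in> S \<Longrightarrow> (\<Sum>t\<in>S. B s t * w t) = \<mu> * w s" "\<exists>s\<in>S. w s \<noteq> 0"
  shows "cmod \<mu> \<le> l"
proof -
  obtain M s where M: "M > 0" and le: "\<And>s. s \<in> S \<Longrightarrow> cmod (w s) \<le> M * v s"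
    and s: "s \<in> S" "cmod (w s) = M * v s"
    by (rule max_norm_ratio[of S v w]) (use fin v ev(2) in auto)
  have "cmod \<mu> * (M * v s) = cmod (\<Sum>t\<in>S. B s t * w t)"
    using ev(1)[OF s(1)] s(2) by (simp add: norm_mult)
  also have "\<dots> \<le> (\<Sum>t\<in>S. cmod (B s t) * cmod (w t))"
    by (rule order_trans[OF norm_sum]) (simp add: norm_mult)
  also have "\<dots> \<le> (\<Sum>t\<in>S. A s t * (M * v t))"
    using dom s le by (intro sum_mono mult_mono) (auto intro: order_trans[OF norm_ge_zero])
  also have "\<dots> = M * (\<Sum>t\<in>S. A s t * v t)" by (simp add: sum_distrib_left mult_ac)
  also have "\<dots> \<le> M * (l * v s)" using M sub[OF s(1)] by (intro mult_left_mono) auto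
  finally show ?thesis using M v[OF s(1)] by simp
qed

text \<open>The positive eigenvector is used twice: it puts \<open>l\<close> into the spectrum, and
  as a subinvariant vector it bounds every other eigenvalue.\<close>

lemma spectral_radius_indexed_mat:
  fixes A :: "'i \<Rightarrow> 'i \<Rightarrow> real"
  assumes fin: "finite S" and ne: "S \<noteq> {}"
    and nn: "\<And>s t. s \<in> S \<Longrightarrow> t \<in> S \<Longrightarrow> A s t \<ge> 0"
    and v: "\<And>s. s \<in> S \<Longrightarrow> v s > 0"
    and ev: "\<And>s. s \<in> S \<Longrightarrow> (\<Sum>t\<in>S. A s t * v t) = l * v s" and l: "l \<ge> 0"
  shows "spectral_radius (indexed_mat S (\<lambda>s t. complex_of_real (A s t))) = l"
proof -
  let ?M = "indexed_mat S (\<lambda>s t. complex_of_real (A s t))"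
  have car: "?M \<in> carrier_mat (card S) (card S)" by (simp add: indexed_mat_def)
  have "eigenvalue ?M (complex_of_real l)"
    unfolding eigenvalue_indexed_mat_iff[OF fin]
  proof (intro exI[of _ "\<lambda>s. complex_of_real (v s)"] conjI ballI)
    show "\<exists>s\<in>S. complex_of_real (v s) \<noteq> 0" using ne v by force
    show "(\<Sum>t\<in>S. complex_of_real (A s t) * complex_of_real (v t)) =
        complex_of_real l * complex_of_real (v s)" if "s \<in> S" for s
      using arg_cong[OF ev[OF that], of complex_of_real] by simp
  qed
  hence mem: "l \<in> cmod ` spectrum ?M"
    using l unfolding spectrum_def by (intro image_eqI[of _ _ "complex_of_real l"]) auto
  show ?thesis unfolding spectral_radius_def
  proof (rule Max_eqI[OF _ _ mem])
    show "finite (cmod ` spectrum ?M)" using card_finite_spectrum[OF car] by auto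
    fix y assume "y \<in> cmod ` spectrum ?M"
    then obtain \<mu> where \<mu>: "eigenvalue ?M \<mu>" "y = cmod \<mu>" by (auto simp: spectrum_def)
    from \<mu>(1) obtain w where w: "\<exists>s\<in>S. w s \<noteq> 0"
      "\<And>s. s \<in> S \<Longrightarrow> (\<Sum>t\<in>S. complex_of_real (A s t) * w t) = \<mu> * w s"
      unfolding eigenvalue_indexed_mat_iff[OF fin] by auto
    show "y \<le> l" unfolding \<mu>(2)
      by (rule subinvariant_vector_bounds_eigenvalue[OF fin _ v eq_refl[OF ev] w(2,1)])
        (use nn in auto)
  qed
qed

text \<open>
  All triangle inequalities involved are equalities, which fixes the phases of \<open>w\<close> along every edge.
\<close>

lemma eigenvector_on_spectral_circle:
  fixes B :: "'i \<Rightarrow> 'i \<Rightarrow> complex"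
  assumes irr: "irreducible_on S (\<lambda>s t. A s t \<noteq> 0)" and fin: "finite S"
    and dom: "\<And>s t. s \<in> S \<Longrightarrow> t \<in> S \<Longrightarrow> cmod (B s t) \<le> A s t"
    and v: "\<And>s. s \<in> S \<Longrightarrow> v s > 0"
    and sub: "\<And>s. s \<in> S \<Longrightarrow> (\<Sum>t\<in>S. A s t * v t) \<le> v s"
    and ev: "\<And>s. s \<in> S \<Longrightarrow> (\<Sum>t\<in>S. B s t * w t) = w s" "\<exists>s\<in>S. w s \<noteq> 0"
  obtains u where "\<And>s. s \<in> S \<Longrightarrow> u s \<noteq> 0"
    "\<And>s t. s \<in> S \<Longrightarrow> t \<in> S \<Longrightarrow> B s t * u t = of_real (A s t) * u s"
proof -
  obtain M s0 where M: "M > 0" and le: "\<And>s. s \<in> S \<Longrightarrow> cmod (w s) \<le> M * v s"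
    and s0: "s0 \<in> S" "cmod (w s0) = M * v s0"
    by (rule max_norm_ratio[of S v w]) (use fin v ev(2) in auto)
  have Ann: "A s t \<ge> 0" if "s \<in> S" "t \<in> S" for s t
    using dom[OF that] norm_ge_zero[of "B s t"] by linarith
  \<comment> \<open>\<open>c s\<close> rotates \<open>w s\<close> onto the positive real axis. At a
    coordinate of maximal ratio the real parts of the rotated summands reach the sum of their upper
    bounds, so each reaches its own.\<close>
  define c where "c s = cnj (w s) / of_real (cmod (w s))" for s
  have tight: "A s t * (M * v t) = Re (c s * (B s t * w t))"
    if s: "s \<in> S" "cmod (w s) = M * v s" and t: "t \<in> S" for s t
  proof -
    have ws: "cmod (w s) > 0" using M v[OF s(1)] s(2) by simp
    have cn: "cmod (c s) = 1" using ws by (simp add: c_def norm_divide)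
    have ineq: "Re (c s * (B s t * w t)) \<le> A s t * (M * v t)" if "t \<in> S" for t
    proof -
      have "Re (c s * (B s t * w t)) \<le> cmod (c s * (B s t * w t))" by (rule complex_Re_le_cmod)
      also have "\<dots> = cmod (B s t) * cmod (w t)" by (simp add: norm_mult cn)
      also have "\<dots> \<le> A s t * (M * v t)"
        using dom[OF s(1) that] le[OF that] Ann[OF s(1) that] by (intro mult_mono) auto
      finally show ?thesis .
    qed
    have "(\<Sum>t\<in>S. Re (c s * (B s t * w t))) = Re (c s * (\<Sum>t\<in>S. B s t * w t))"
      by (simp add: sum_distrib_left)
    also have "\<dots> = Re (c s * w s)" by (simp add: ev(1)[OF s(1)])
    also have "c s * w s = of_real (cmod (w s))"
      using ws complex_norm_square[of "w s"]
      by (simp add: c_def field_simps power2_eq_square)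
    finally have 1: "(\<Sum>t\<in>S. Re (c s * (B s t * w t))) = M * v s" using s(2) by simp
    have "(\<Sum>t\<in>S. A s t * (M * v t)) = M * (\<Sum>t\<in>S. A s t * v t)"
      by (simp add: sum_distrib_left mult_ac)
    also have "\<dots> \<le> M * v s" using M sub[OF s(1)] by (intro mult_left_mono) auto
    finally have "(\<Sum>t\<in>S. A s t * (M * v t) - Re (c s * (B s t * w t))) \<le> 0"
      using 1 by (simp add: sum_subtractf)
    moreover have "\<And>t. t \<in> S \<Longrightarrow> A s t * (M * v t) - Re (c s * (B s t * w t)) \<ge> 0"
      using ineq by simp
    ultimately have "\<forall>t\<in>S. A s t * (M * v t) - Re (c s * (B s t * w t)) = 0"
      using sum_nonneg_eq_0_iff[OF fin] by (metis (no_types, lifting) order_antisym sum_nonneg)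
    thus ?thesis using t by simp
  qed
  have "{s\<in>S. cmod (w s) = M * v s} = S"
  proof (rule irreducible_onD[OF irr])
    show "{s\<in>S. cmod (w s) = M * v s} \<noteq> {}" using s0 by auto
    fix s t assume st: "s \<in> {s\<in>S. cmod (w s) = M * v s}" "t \<in> S" "A s t \<noteq> 0"
    have "cmod (w s) > 0" using st M v[of s] by auto
    hence cn: "cmod (c s) = 1" by (simp add: c_def norm_divide)
    have "A s t * (M * v t) = Re (c s * (B s t * w t))" using st by (intro tight) auto
    also have "\<dots> \<le> cmod (c s * (B s t * w t))" by (rule complex_Re_le_cmod)
    also have "\<dots> = cmod (B s t) * cmod (w t)" by (simp add: norm_mult cn)
    also have "\<dots> \<le> A s t * cmod (w t)"
      using dom[of s t] st by (intro mult_right_mono) auto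
    finally have "M * v t \<le> cmod (w t)" using st Ann[of s t] by (simp add: mult_le_cancel_left)
    thus "t \<in> {s\<in>S. cmod (w s) = M * v s}" using le[of t] st by auto
  qed auto
  hence all: "cmod (w s) = M * v s" if "s \<in> S" for s using that by auto
  show ?thesis
  \<comment> \<open>As \<open>cmod (w s) = M * v s\<close> throughout \<open>S\<close>, dividing by
    \<open>v\<close> leaves a vector of constant modulus, which records only phases.\<close>
  proof (rule that[of "\<lambda>s. w s / of_real (v s)"])
    show "w s / of_real (v s) \<noteq> 0" if "s \<in> S" for s
      using all[OF that] M v[OF that] by auto
    fix s t assume st: "s \<in> S" "t \<in> S"
    have vs: "v s > 0" "v t > 0" using v st by auto
    have "cmod (w s) > 0" using all[OF st(1)] M vs by simp
    hence ws: "w s \<noteq> 0" by simp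
    have cn: "cmod (c s) = 1" using ws by (simp add: c_def norm_divide)
    define y where "y = c s * (B s t * w t)"
    have 1: "Re y = A s t * (M * v t)" using tight[OF st(1) all[OF st(1)] st(2)] by (simp add: y_def)
    have "cmod y = cmod (B s t) * cmod (w t)" by (simp add: y_def norm_mult cn)
    also have "\<dots> \<le> A s t * (M * v t)"
      using dom[OF st] all[OF st(2)] M vs by (simp add: mult_right_mono)
    finally have "cmod y \<le> Re y" using 1 by simp
    hence "(cmod y)\<^sup>2 \<le> (Re y)\<^sup>2" by (intro power_mono) auto
    hence "Im y = 0" by (simp add: cmod_power2)
    hence "y = of_real (A s t * (M * v t))" using 1 by (simp add: complex_eq_iff)
    hence "w s * y = w s * of_real (A s t * (M * v t))" by simp
    moreover have "w s * c s = of_real (cmod (w s))"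
      using ws complex_norm_square[of "w s"] by (simp add: c_def field_simps power2_eq_square)
    hence "w s * c s = of_real (M * v s)" by (simp only: all[OF st(1)])
    hence "w s * y = of_real (M * v s) * (B s t * w t)" by (simp add: y_def mult.assoc[symmetric])
    ultimately have "of_real (M * v s) * (B s t * w t) = w s * of_real (A s t * (M * v t))" by simp
    hence "of_real M * (of_real (v s) * (B s t * w t)) = of_real M * (w s * of_real (A s t * v t))"
      by (simp only: of_real_mult mult_ac)
    hence "of_real (v s) * (B s t * w t) = w s * of_real (A s t * v t)"
      using M by (simp only: mult_cancel_left) auto
    thus "B s t * (w t / of_real (v t)) = of_real (A s t) * (w s / of_real (v s))"
      using vs by (simp add: field_simps)
  qed
qed

section \<open>Critical radius and growth of irreducible linear recurrences\<close>

text \<open>The semiring is left open because the same weight is taken at real radii, at complex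
  points, at the polynomial \<open>[:0, 1:]\<close> for determinants and at \<open>fps_X\<close> for
  generating functions.\<close>

definition transfer :: "nat \<Rightarrow> (nat \<Rightarrow> 'i \<Rightarrow> 'i \<Rightarrow> nat) \<Rightarrow> 'a::comm_semiring_1 \<Rightarrow> 'i \<Rightarrow> 'i \<Rightarrow> 'a" where
  "transfer m a x s t = (\<Sum>k=1..m. of_nat (a k s t) * x ^ k)"

lemma transfer_nonneg: "x \<ge> 0 \<Longrightarrow> transfer m a (x :: real) s t \<ge> 0"
  by (auto simp: transfer_def intro!: sum_nonneg)

lemma of_real_transfer: "transfer m a (complex_of_real x) s t = of_real (transfer m a x s t)"
  by (simp add: transfer_def)

lemma norm_transfer_le: "cmod (transfer m a z s t) \<le> transfer m a (cmod z) s t"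
  unfolding transfer_def by (rule sum_norm_le) (simp add: norm_mult norm_power)

lemma transfer_mono: "0 \<le> x \<Longrightarrow> x \<le> y \<Longrightarrow> transfer m a (x :: real) s t \<le> transfer m a y s t"
  by (auto simp: transfer_def intro!: sum_mono mult_left_mono power_mono)

text \<open>There is no constant term, so every summand shrinks at least by the factor
  \<open>x / y\<close>. This is what later makes the critical radius unique.\<close>

lemma transfer_scale_le:
  assumes "0 \<le> x" "x \<le> y" "0 < (y :: real)"
  shows "transfer m a x s t \<le> x / y * transfer m a y s t"
  unfolding transfer_def sum_distrib_left
proof (rule sum_mono)
  fix k assume k: "k \<in> {1..m}"
  have "(x / y) ^ k \<le> (x / y) ^ 1" using assms k by (intro power_decreasing) auto
  hence "x ^ k \<le> x / y * y ^ k" using assms by (simp add: power_divide field_simps)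
  thus "real (a k s t) * x ^ k \<le> x / y * (real (a k s t) * y ^ k)"
    using mult_left_mono[of "x ^ k" "x / y * y ^ k" "real (a k s t)"] by (simp add: mult_ac)
qed

text \<open>The degree is at most \<open>m\<close>; this converse estimate is needed for
  continuity.\<close>

lemma transfer_scale_ge:
  assumes "0 < x" "x \<le> (y :: real)"
  shows "transfer m a y s t \<le> (y / x) ^ m * transfer m a x s t"
  unfolding transfer_def sum_distrib_left
proof (rule sum_mono)
  fix k assume k: "k \<in> {1..m}"
  have "(y / x) ^ k \<le> (y / x) ^ m" using assms k by (intro power_increasing) auto
  hence "y ^ k \<le> (y / x) ^ m * x ^ k" using assms by (simp add: power_divide field_simps)
  thus "real (a k s t) * y ^ k \<le> (y / x) ^ m * (real (a k s t) * x ^ k)"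
    using mult_left_mono[of "y ^ k" "(y / x) ^ m * x ^ k" "real (a k s t)"] by (simp add: mult_ac)
qed

lemma transfer_eq_0_iff:
  assumes "x > (0 :: real)"
  shows "transfer m a x s t = 0 \<longleftrightarrow> (\<forall>k\<in>{1..m}. a k s t = 0)"
  unfolding transfer_def using assms by (subst sum_nonneg_eq_0_iff) auto

text \<open>A single state without a loop counts as irreducible, so \<open>row_nonzero\<close> is a
  condition of its own; it ensures \<open>spr 1 \<ge> 1\<close>.\<close>

locale irreducible_system =
  fixes m :: nat and a :: "nat \<Rightarrow> 'i \<Rightarrow> 'i \<Rightarrow> nat" and S :: "'i set"
  assumes finite_S: "finite S" and nonempty: "S \<noteq> {}" and m_pos: "m \<ge> 1"
    and irreducible: "irreducible_on S (\<lambda>s t. \<exists>k\<in>{1..m}. a k s t \<noteq> 0)"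
    and row_nonzero: "s \<in> S \<Longrightarrow> \<exists>t\<in>S. \<exists>k\<in>{1..m}. a k s t \<noteq> 0"
begin

lemma irreducible_transfer:
  "x > (0 :: real) \<Longrightarrow> irreducible_on S (\<lambda>s t. transfer m a x s t \<noteq> 0)"
  by (rule irreducible_on_cong[OF irreducible]) (simp add: transfer_eq_0_iff)

definition spr :: "real \<Rightarrow> real" where
  "spr x = spectral_radius (indexed_mat S (transfer m a (complex_of_real x)))"

lemma perron_vector:
  assumes x: "x > 0"
  obtains v where "\<And>s. s \<in> S \<Longrightarrow> v s > (0 :: real)"
    "\<And>s. s \<in> S \<Longrightarrow> (\<Sum>t\<in>S. transfer m a x s t * v t) = spr x * v s" "spr x \<ge> 0"
proof -
  have nn: "transfer m a x s t \<ge> 0" for s t using x by (simp add: transfer_nonneg)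
  obtain l v where l: "l \<ge> 0" and v: "\<And>s. s \<in> S \<Longrightarrow> v s > 0"
    and ev: "\<And>s. s \<in> S \<Longrightarrow> (\<Sum>t\<in>S. transfer m a x s t * v t) = l * v s"
    using perron_frobenius_irreducible[OF irreducible_transfer[OF x] finite_S nonempty nn] by blast
  have "spr x = l"
    unfolding spr_def of_real_transfer
    by (rule spectral_radius_indexed_mat[OF finite_S nonempty nn v ev l])
  with that[OF v] ev l show ?thesis by simp
qed

lemma spr_le:
  assumes x: "x > 0" and l: "l \<ge> 0"
    and v: "\<And>s. s \<in> S \<Longrightarrow> v s > 0"
    and sub: "\<And>s. s \<in> S \<Longrightarrow> (\<Sum>t\<in>S. transfer m a x s t * v t) \<le> l * v s"
  shows "spr x \<le> l"
proof -
  obtain w where w: "\<And>s. s \<in> S \<Longrightarrow> w s > 0"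
    "\<And>s. s \<in> S \<Longrightarrow> (\<Sum>t\<in>S. transfer m a x s t * w t) = spr x * w s" "spr x \<ge> 0"
    using perron_vector[OF x] by blast
  have "cmod (of_real (spr x)) \<le> l"
  proof (rule subinvariant_vector_bounds_eigenvalue[OF finite_S _ v sub])
    show "cmod (of_real (transfer m a x s t)) \<le> transfer m a x s t" for s t
      using x by (simp add: transfer_nonneg)
    show "(\<Sum>t\<in>S. complex_of_real (transfer m a x s t) * of_real (w t)) = of_real (spr x) * of_real (w s)"
      if "s \<in> S" for s
      using arg_cong[OF w(2)[OF that], of complex_of_real] by simp
    show "\<exists>s\<in>S. complex_of_real (w s) \<noteq> 0" using nonempty w(1) by force
  qed
  thus ?thesis using w(3) by simp
qed

text \<open>The Perron vector at \<open>y\<close> is a test vector at \<open>x\<close>, where it is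
  subinvariant with the eigenvalue scaled by \<open>x / y\<close>.\<close>

lemma spr_scale_le:
  assumes "0 < x" "x \<le> y"
  shows "spr x \<le> x / y * spr y"
proof -
  have y: "y > 0" using assms by simp
  obtain v where v: "\<And>s. s \<in> S \<Longrightarrow> v s > 0"
    "\<And>s. s \<in> S \<Longrightarrow> (\<Sum>t\<in>S. transfer m a y s t * v t) = spr y * v s" "spr y \<ge> 0"
    using perron_vector[OF y] by blast
  show ?thesis
  proof (rule spr_le[OF assms(1) _ v(1)])
    fix s assume s: "s \<in> S"
    have "(\<Sum>t\<in>S. transfer m a x s t * v t) \<le> (\<Sum>t\<in>S. x / y * transfer m a y s t * v t)"
      using assms y v(1) by (intro sum_mono mult_right_mono transfer_scale_le) (auto intro: less_imp_le)
    also have "\<dots> = x / y * (\<Sum>t\<in>S. transfer m a y s t * v t)" by (simp add: sum_distrib_left mult_ac)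
    finally show "(\<Sum>t\<in>S. transfer m a x s t * v t) \<le> x / y * spr y * v s"
      using v(2)[OF s] by simp
  qed (use assms y v(3) in auto)
qed

lemma spr_scale_ge:
  assumes "0 < x" "x \<le> y"
  shows "spr y \<le> (y / x) ^ m * spr x"
proof -
  have y: "y > 0" using assms by simp
  obtain v where v: "\<And>s. s \<in> S \<Longrightarrow> v s > 0"
    "\<And>s. s \<in> S \<Longrightarrow> (\<Sum>t\<in>S. transfer m a x s t * v t) = spr x * v s" "spr x \<ge> 0"
    using perron_vector[OF assms(1)] by blast
  show ?thesis
  proof (rule spr_le[OF y _ v(1)])
    fix s assume s: "s \<in> S"
    have "(\<Sum>t\<in>S. transfer m a y s t * v t) \<le> (\<Sum>t\<in>S. (y / x) ^ m * transfer m a x s t * v t)"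
      using assms v(1) by (intro sum_mono mult_right_mono transfer_scale_ge) (auto intro: less_imp_le)
    also have "\<dots> = (y / x) ^ m * (\<Sum>t\<in>S. transfer m a x s t * v t)" by (simp add: sum_distrib_left mult_ac)
    finally show "(\<Sum>t\<in>S. transfer m a y s t * v t) \<le> (y / x) ^ m * spr x * v s"
      using v(2)[OF s] by simp
  qed (use assms y v(3) in auto)
qed

text \<open>At a minimal coordinate \<open>s\<close> of the Perron vector, one nonzero coefficient,
  being an integer, already contributes at least \<open>v t \<ge> v s\<close>.\<close>

lemma spr_1_ge: "spr 1 \<ge> 1"
proof -
  obtain v where v: "\<And>s. s \<in> S \<Longrightarrow> v s > 0"
    "\<And>s. s \<in> S \<Longrightarrow> (\<Sum>t\<in>S. transfer m a 1 s t * v t) = spr 1 * v s" "spr 1 \<ge> 0"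
    using perron_vector[of 1] by auto
  have "Min (v ` S) \<in> v ` S" using finite_S nonempty by (intro Min_in) auto
  then obtain s where s: "s \<in> S" "Min (v ` S) = v s" by auto
  hence min: "v s \<le> v t" if "t \<in> S" for t using finite_S that Min_le[of "v ` S" "v t"] by simp
  obtain t k where t: "t \<in> S" "k \<in> {1..m}" "a k s t \<noteq> 0" using row_nonzero[OF s(1)] by auto
  have "1 \<le> real (a k s t) * 1 ^ k" using t(3) by simp
  also have "\<dots> \<le> transfer m a 1 s t"
    unfolding transfer_def by (rule member_le_sum[OF t(2)]) auto
  finally have "1 * v t \<le> transfer m a 1 s t * v t" using v(1)[OF t(1)] by (intro mult_right_mono) auto
  also have "\<dots> \<le> (\<Sum>t\<in>S. transfer m a 1 s t * v t)"
    using finite_S v(1) t(1)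
    by (intro member_le_sum mult_nonneg_nonneg transfer_nonneg) (auto intro: less_imp_le)
  finally have "1 * v s \<le> spr 1 * v s" using min[OF t(1)] v(2)[OF s(1)] by simp
  thus ?thesis using v(1)[OF s(1)] by simp
qed

text \<open>The two scaling inequalities squeeze \<open>spr y / spr x\<close> between the smaller
  and the larger of \<open>y / x\<close> and \<open>(y / x) ^ m\<close>, so no continuity of
  eigenvalues is invoked.\<close>

lemma isCont_spr:
  assumes x: "x > 0"
  shows "isCont spr x"
proof -
  have nn: "spr x \<ge> 0" using perron_vector[OF x] by blast
  let ?lo = "\<lambda>y. min (y / x) ((y / x) ^ m) * spr x" and ?hi = "\<lambda>y. max (y / x) ((y / x) ^ m) * spr x"
  have ev: "eventually (\<lambda>y. y > 0) (at x)"
    using x by (intro eventually_at_in_open'[of "{0<..}", simplified]) auto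
  have lim: "(?lo \<longlongrightarrow> min (x / x) ((x / x) ^ m) * spr x) (at x)"
    "(?hi \<longlongrightarrow> max (x / x) ((x / x) ^ m) * spr x) (at x)"
    by (intro tendsto_intros; use x in simp)+
  have bounds: "?lo y \<le> spr y \<and> spr y \<le> ?hi y" if y: "y > 0" for y
  proof (cases "y \<le> x")
    case True
    have pos: "(y / x) ^ m > 0" using x y by simp
    have "spr x \<le> (x / y) ^ m * spr y" by (rule spr_scale_ge[OF y True])
    hence "(y / x) ^ m * spr x \<le> (y / x) ^ m * ((x / y) ^ m * spr y)"
      using pos by (intro mult_left_mono) auto
    also have "\<dots> = spr y" using x y by (simp add: power_divide)
    finally have "(y / x) ^ m * spr x \<le> spr y" .
    moreover have "?lo y \<le> (y / x) ^ m * spr x" "y / x * spr x \<le> ?hi y"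
      using nn by (intro mult_right_mono; simp)+
    ultimately show ?thesis using spr_scale_le[OF y True] by linarith
  next
    case False
    hence xy: "x \<le> y" by simp
    have "spr x \<le> x / y * spr y" by (rule spr_scale_le[OF x xy])
    hence "y / x * spr x \<le> spr y" using x y by (simp add: field_simps)
    moreover have "?lo y \<le> y / x * spr x" "(y / x) ^ m * spr x \<le> ?hi y"
      using nn by (intro mult_right_mono; simp)+
    ultimately show ?thesis using spr_scale_ge[OF x xy] by linarith
  qed
  have "(spr \<longlongrightarrow> spr x) (at x)"
    by (rule tendsto_sandwich[of ?lo _ _ ?hi])
      (use lim x bounds in \<open>auto intro: eventually_mono[OF ev]\<close>)
  thus ?thesis by (simp add: isCont_def)
qed

definition crit :: real where
  "crit = (THE r. 0 < r \<and> r \<le> 1 \<and> spr r = 1)"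

lemma crit: "0 < crit" "crit \<le> 1" "spr crit = 1"
proof -
  have "\<exists>!r. 0 < r \<and> r \<le> 1 \<and> spr r = 1"
  proof (rule ex_ex1I)
    \<comment> \<open>At \<open>1 / spr 1\<close> the linear scaling bound yields a spectral radius
      of at most 1, which is the left end for the intermediate value theorem.\<close>
    let ?x = "1 / spr 1"
    have x: "0 < ?x" "?x \<le> 1" using spr_1_ge by auto
    have "spr ?x \<le> ?x / 1 * spr 1" by (rule spr_scale_le[OF x])
    hence "spr ?x \<le> 1" using spr_1_ge by simp
    hence "\<exists>r. ?x \<le> r \<and> r \<le> 1 \<and> spr r = 1"
      using x spr_1_ge by (intro IVT) (auto intro!: isCont_spr elim!: less_le_trans[OF x(1)])
    thus "\<exists>r. 0 < r \<and> r \<le> 1 \<and> spr r = 1" using x by (meson less_le_trans)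
  next
    have "\<not> x < y" if "0 < x" "spr x = 1" "spr y = 1" for x y :: real
      using spr_scale_le[of x y] that by auto
    thus "x = y" if "0 < x \<and> x \<le> 1 \<and> spr x = 1" "0 < y \<and> y \<le> 1 \<and> spr y = 1" for x y :: real
      using that by (meson linorder_neqE_linordered_idom)
  qed
  from theI'[OF this] show "0 < crit" "crit \<le> 1" "spr crit = 1" by (auto simp: crit_def)
qed

lemma crit_vector:
  obtains v where "\<And>s. s \<in> S \<Longrightarrow> v s > (0 :: real)"
    "\<And>s. s \<in> S \<Longrightarrow> (\<Sum>t\<in>S. transfer m a crit s t * v t) = v s"
  by (rule perron_vector[OF crit(1)]) (use that crit(3) in auto)

text \<open>\<open>rho m\<close> is a minimum of two critical radii and may lie below the one of the
  class at hand, where only an inequality survives.\<close>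

lemma subinvariant_vector:
  assumes "0 \<le> x" "x \<le> crit"
  obtains v where "\<And>s. s \<in> S \<Longrightarrow> v s > (0 :: real)"
    "\<And>s. s \<in> S \<Longrightarrow> (\<Sum>t\<in>S. transfer m a x s t * v t) \<le> v s"
proof -
  obtain v where v: "\<And>s. s \<in> S \<Longrightarrow> v s > (0 :: real)"
    "\<And>s. s \<in> S \<Longrightarrow> (\<Sum>t\<in>S. transfer m a crit s t * v t) = v s"
    using crit_vector by blast
  have "(\<Sum>t\<in>S. transfer m a x s t * v t) \<le> v s" if "s \<in> S" for s
    unfolding v(2)[OF that, symmetric]
    using assms v(1) by (intro sum_mono mult_right_mono transfer_mono) (auto intro: less_imp_le)
  from that[OF v(1) this] show ?thesis by simp
qed

lemma fixed_vector_phases: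
  assumes z: "cmod z \<le> crit"
    and ev: "\<And>s. s \<in> S \<Longrightarrow> (\<Sum>t\<in>S. transfer m a z s t * w t) = w s" "\<exists>s\<in>S. w s \<noteq> 0"
  obtains u where "\<And>s. s \<in> S \<Longrightarrow> u s \<noteq> 0"
    "\<And>s t. s \<in> S \<Longrightarrow> t \<in> S \<Longrightarrow> transfer m a z s t * u t = of_real (transfer m a crit s t) * u s"
proof -
  obtain v where v: "\<And>s. s \<in> S \<Longrightarrow> v s > (0 :: real)"
    "\<And>s. s \<in> S \<Longrightarrow> (\<Sum>t\<in>S. transfer m a crit s t * v t) = v s"
    using crit_vector by blast
  have dom: "cmod (transfer m a z s t) \<le> transfer m a crit s t" for s t
    using norm_transfer_le[of m a z s t] transfer_mono[of "cmod z" crit m a s t] z by simp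
  show ?thesis
    by (rule eigenvector_on_spectral_circle
        [OF irreducible_transfer[OF crit(1)] finite_S dom v(1) eq_refl[OF v(2)] ev])
      (use that in auto)
qed

text \<open>A fixed vector would be an eigenvector for 1, but the critical vector bounds all
  eigenvalues at \<open>z\<close> by \<open>cmod z / crit < 1\<close>.\<close>

lemma no_fixed_vector_inside:
  assumes z: "cmod z < crit"
    and ev: "\<And>s. s \<in> S \<Longrightarrow> (\<Sum>t\<in>S. transfer m a z s t * w t) = w s"
    and s: "s \<in> S"
  shows "w s = 0"
proof (rule ccontr)
  assume "w s \<noteq> 0"
  with s have nz: "\<exists>s\<in>S. w s \<noteq> 0" by blast
  obtain v where v: "\<And>s. s \<in> S \<Longrightarrow> v s > (0 :: real)"
    "\<And>s. s \<in> S \<Longrightarrow> (\<Sum>t\<in>S. transfer m a crit s t * v t) = v s"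
    using crit_vector by blast
  have "cmod 1 \<le> cmod z / crit"
  proof (rule subinvariant_vector_bounds_eigenvalue[OF finite_S norm_transfer_le v(1)])
    fix s assume s: "s \<in> S"
    have "(\<Sum>t\<in>S. transfer m a (cmod z) s t * v t) \<le> (\<Sum>t\<in>S. cmod z / crit * transfer m a crit s t * v t)"
      using z crit(1) v(1) by (intro sum_mono mult_right_mono transfer_scale_le) (auto intro: less_imp_le)
    also have "\<dots> = cmod z / crit * (\<Sum>t\<in>S. transfer m a crit s t * v t)"
      by (simp add: sum_distrib_left mult_ac)
    finally show "(\<Sum>t\<in>S. transfer m a (cmod z) s t * v t) \<le> cmod z / crit * v s"
      using v(2)[OF s] by simp
    show "(\<Sum>t\<in>S. transfer m a z s t * w t) = 1 * w s" using ev[OF s] by simp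
  qed (use nz in auto)
  thus False using z crit(1) by (simp add: field_simps)
qed

text \<open>Since \<open>v\<close> is fixed at \<open>crit\<close>, the sequences
  \<open>v s / crit ^ n\<close> solve the homogeneous recurrence exactly, and a small multiple of
  them stays below \<open>F\<close> once it does so for \<open>n \<le> m\<close>.\<close>

lemma growth_lower_bound:
  fixes F :: "'i \<Rightarrow> nat \<Rightarrow> real"
  assumes pos: "\<And>s n. s \<in> S \<Longrightarrow> n \<ge> 1 \<Longrightarrow> F s n \<ge> 1"
    and rec: "\<And>s n. s \<in> S \<Longrightarrow> n > m \<Longrightarrow> (\<Sum>k=1..m. \<Sum>t\<in>S. real (a k s t) * F t (n - k)) \<le> F s n"
    and s: "s \<in> S"
  obtains c where "c > 0" "\<And>n. n \<ge> 1 \<Longrightarrow> c / crit ^ n \<le> F s n"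
proof -
  obtain v where v: "\<And>s. s \<in> S \<Longrightarrow> v s > (0 :: real)"
    "\<And>s. s \<in> S \<Longrightarrow> (\<Sum>t\<in>S. transfer m a crit s t * v t) = v s"
    using crit_vector by blast
  define V where "V = (\<Sum>s\<in>S. v s)"
  have V: "v s \<le> V" if "s \<in> S" for s
    unfolding V_def using that v(1) finite_S by (intro member_le_sum) (auto intro: less_imp_le)
  \<comment> \<open>With this constant \<open>c * v s / crit ^ n \<le> 1\<close> for all
    \<open>n \<le> m\<close>, the range in which \<open>F\<close> is only known to be at least
    1.\<close>
  define c where "c = crit ^ m / V"
  have V0: "V > 0" using V[OF s] v(1)[OF s] by linarith
  have c: "c > 0" using V0 crit by (simp add: c_def)
  have "c * v s / crit ^ n \<le> F s n" if "s \<in> S" "n \<ge> 1" for s n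
    using that
  proof (induction n arbitrary: s rule: less_induct)
    case (less n)
    show ?case
    proof (cases "n \<le> m")
      case True
      have "crit ^ m \<le> crit ^ n" using True crit by (intro power_decreasing) auto
      moreover have "v s / V \<le> 1" "v s / V \<ge> 0" using V V0 v(1) less.prems by (auto simp: less_imp_le)
      ultimately have "crit ^ m * (v s / V) \<le> crit ^ n * 1" using crit by (intro mult_mono) auto
      hence "crit ^ m * (v s / V) / crit ^ n \<le> 1"
        using crit(1) by (subst divide_le_eq_1_pos) (simp_all del: times_divide_eq_right)
      hence "c * v s / crit ^ n \<le> 1" by (simp add: c_def)
      also have "1 \<le> F s n" using pos less.prems by auto
      finally show ?thesis .
    next
      case False
      have "c * v s / crit ^ n = c / crit ^ n * (\<Sum>t\<in>S. transfer m a crit s t * v t)"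
        using v(2) less.prems by simp
      also have "\<dots> = (\<Sum>t\<in>S. \<Sum>k=1..m. real (a k s t) * (c * v t * (crit ^ k / crit ^ n)))"
        unfolding transfer_def sum_distrib_left sum_distrib_right
        by (intro sum.cong refl) (simp add: mult_ac)
      also have "\<dots> = (\<Sum>k=1..m. \<Sum>t\<in>S. real (a k s t) * (c * v t * (crit ^ k / crit ^ n)))"
        by (rule sum.swap)
      also have "\<dots> = (\<Sum>k=1..m. \<Sum>t\<in>S. real (a k s t) * (c * v t / crit ^ (n - k)))"
        using False crit by (intro sum.cong refl) (auto simp: power_diff)
      also have "\<dots> \<le> (\<Sum>k=1..m. \<Sum>t\<in>S. real (a k s t) * F t (n - k))"
        using False by (intro sum_mono mult_left_mono less.IH) auto
      also have "\<dots> \<le> F s n" using False less.prems by (intro rec) auto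
      finally show ?thesis .
    qed
  qed
  from that[OF _ this[OF s]] c v(1)[OF s] show ?thesis by simp
qed

end

section \<open>Exponential upper bounds up to a polynomial factor\<close>

definition poly_exp_bounded :: "real \<Rightarrow> (nat \<Rightarrow> real) \<Rightarrow> bool" where
  "poly_exp_bounded x F \<longleftrightarrow> (\<exists>d K. \<forall>n. F n \<le> K * real (Suc n) ^ d / x ^ n)"

text \<open>The exponent may be raised at will and \<open>K\<close> is nonnegative, so that several
  bounds can be brought to a common degree.\<close>

lemma poly_exp_boundedE:
  assumes "poly_exp_bounded x F" "x > 0"
  obtains d K where "K \<ge> 0" "\<And>e n. d \<le> e \<Longrightarrow> F n \<le> K * real (Suc n) ^ e / x ^ n"
proof -
  from assms obtain d K where K: "\<And>n. F n \<le> K * real (Suc n) ^ d / x ^ n"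
    by (auto simp: poly_exp_bounded_def)
  have "F n \<le> \<bar>K\<bar> * real (Suc n) ^ e / x ^ n" if "d \<le> e" for e n
  proof -
    have "K * real (Suc n) ^ d \<le> \<bar>K\<bar> * real (Suc n) ^ e"
      using that by (intro mult_mono power_increasing) auto
    hence "K * real (Suc n) ^ d / x ^ n \<le> \<bar>K\<bar> * real (Suc n) ^ e / x ^ n"
      using assms by (intro divide_right_mono) auto
    with K show ?thesis using order_trans by blast
  qed
  thus ?thesis using that[of "\<bar>K\<bar>"] by auto
qed

lemma poly_exp_bounded_mono:
  "poly_exp_bounded x G \<Longrightarrow> (\<And>n. F n \<le> G n) \<Longrightarrow> poly_exp_bounded x F"
  unfolding poly_exp_bounded_def by (meson order_trans)

lemma poly_exp_bounded_add:
  assumes "poly_exp_bounded x F" "poly_exp_bounded x G" "x > 0"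
  shows "poly_exp_bounded x (\<lambda>n. F n + G n)"
proof -
  obtain d K where 1: "\<And>e n. d \<le> e \<Longrightarrow> F n \<le> K * real (Suc n) ^ e / x ^ n"
    using poly_exp_boundedE[OF assms(1,3)] by metis
  obtain d' K' where 2: "\<And>e n. d' \<le> e \<Longrightarrow> G n \<le> K' * real (Suc n) ^ e / x ^ n"
    using poly_exp_boundedE[OF assms(2,3)] by metis
  have "F n + G n \<le> (K + K') * real (Suc n) ^ (max d d') / x ^ n" for n
    using 1[of "max d d'" n] 2[of "max d d'" n] by (simp add: add_divide_distrib algebra_simps)
  thus ?thesis unfolding poly_exp_bounded_def by blast
qed

lemma poly_exp_bounded_0: "poly_exp_bounded x (\<lambda>n. 0)"
  unfolding poly_exp_bounded_def by (intro exI[of _ 0]) simp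

lemma poly_exp_bounded_sum:
  assumes "\<And>i. i \<in> I \<Longrightarrow> poly_exp_bounded x (F i)" "x > 0"
  shows "poly_exp_bounded x (\<lambda>n. \<Sum>i\<in>I. F i n)"
  using assms(1) by (induction I rule: infinite_finite_induct)
    (auto intro: poly_exp_bounded_0 poly_exp_bounded_add assms(2))

lemma poly_exp_bounded_mult_left:
  assumes "poly_exp_bounded x F" "c \<ge> 0"
  shows "poly_exp_bounded x (\<lambda>n. c * F n)"
proof -
  from assms(1) obtain d K where K: "\<And>n. F n \<le> K * real (Suc n) ^ d / x ^ n"
    by (auto simp: poly_exp_bounded_def)
  have "c * F n \<le> (c * K) * real (Suc n) ^ d / x ^ n" for n
    using mult_left_mono[OF K assms(2)] by (simp add: mult_ac)
  thus ?thesis unfolding poly_exp_bounded_def by blast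
qed

text \<open>For \<open>x \<le> 1\<close> the bound is nondecreasing in \<open>n\<close>, which also
  takes care of truncation when \<open>n < k\<close>.\<close>

lemma poly_exp_bounded_shift:
  assumes "poly_exp_bounded x F" "0 < x" "x \<le> 1"
  shows "poly_exp_bounded x (\<lambda>n. F (n - k))"
proof -
  obtain d K where K: "K \<ge> 0" "\<And>e n. d \<le> e \<Longrightarrow> F n \<le> K * real (Suc n) ^ e / x ^ n"
    using poly_exp_boundedE[OF assms(1,2)] by metis
  have "F (n - k) \<le> K * real (Suc n) ^ d / x ^ n" for n
  proof -
    have "F (n - k) \<le> K * real (Suc (n - k)) ^ d / x ^ (n - k)" by (rule K(2)) simp
    also have "\<dots> \<le> K * real (Suc n) ^ d / x ^ n"
      using K(1) assms by (intro frac_le mult_left_mono power_mono power_decreasing) auto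
    finally show ?thesis .
  qed
  thus ?thesis unfolding poly_exp_bounded_def by blast
qed

lemma poly_exp_bounded_delta: "0 < x \<Longrightarrow> x \<le> 1 \<Longrightarrow> poly_exp_bounded x (\<lambda>n. of_bool (n = 1))"
  unfolding poly_exp_bounded_def by (intro exI[of _ 0] exI[of _ 1]) (auto simp: power_le_one)

text \<open>Multiples of \<open>v s / x ^ n\<close> are supersolutions of the homogeneous part. An
  inhomogeneity of degree \<open>d\<close> is absorbed by one more power of \<open>n\<close>,
  because \<open>(n + 1) ^ d + n ^ (d + 1) \<le> (n + 1) ^ (d + 1)\<close>; this is the cost of each
  layer.\<close>

lemma poly_exp_bounded_system:
  fixes F :: "'i \<Rightarrow> nat \<Rightarrow> real"
  assumes fin: "finite S" and x: "0 < x" "x \<le> 1"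
    and v: "\<And>s. s \<in> S \<Longrightarrow> v s > 0"
      "\<And>s. s \<in> S \<Longrightarrow> (\<Sum>t\<in>S. transfer m a x s t * v t) \<le> v s"
    and F0: "\<And>s. s \<in> S \<Longrightarrow> F s 0 = 0"
    and G: "\<And>s. s \<in> S \<Longrightarrow> poly_exp_bounded x (G s)"
    and rec: "\<And>s n. s \<in> S \<Longrightarrow> n \<ge> 1 \<Longrightarrow> F s n \<le> G s n + (\<Sum>k=1..m. \<Sum>t\<in>S. real (a k s t) * F t (n - k))"
    and s: "s \<in> S"
  shows "poly_exp_bounded x (F s)"
proof -
  \<comment> \<open>One scalar sequence that dominates all \<open>G s\<close>, measured in units of
    \<open>v s\<close>.\<close>
  define H where "H n = (\<Sum>s\<in>S. max 0 (G s n) / v s)" for n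
  have maxG: "poly_exp_bounded x (\<lambda>n. max 0 (G s n))" if s: "s \<in> S" for s
  proof -
    obtain d K where K: "K \<ge> 0" "\<And>e n. d \<le> e \<Longrightarrow> G s n \<le> K * real (Suc n) ^ e / x ^ n"
      using poly_exp_boundedE[OF G[OF s] x(1)] by metis
    have "max 0 (G s n) \<le> K * real (Suc n) ^ d / x ^ n" for n
      using K(1) K(2)[of d n] x by simp
    thus ?thesis unfolding poly_exp_bounded_def by blast
  qed
  have "poly_exp_bounded x (\<lambda>n. \<Sum>s\<in>S. 1 / v s * max 0 (G s n))"
    using v(1) by (intro poly_exp_bounded_sum poly_exp_bounded_mult_left maxG x) (auto intro: less_imp_le)
  hence "poly_exp_bounded x H" by (simp add: H_def[abs_def])
  from poly_exp_boundedE[OF this x(1)] obtain d K where K: "K \<ge> 0"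
    "\<And>n. H n \<le> K * real (Suc n) ^ d / x ^ n" by (metis order_refl)
  have GH: "G s n \<le> v s * H n" if "s \<in> S" for s n
  proof -
    have "max 0 (G s n) / v s \<le> H n" unfolding H_def
      using that fin v(1) by (intro member_le_sum) (auto intro!: divide_nonneg_pos)
    hence "max 0 (G s n) \<le> v s * H n" using v(1)[OF that] by (simp add: field_simps)
    thus ?thesis by simp
  qed
  have main: "F s n \<le> K * v s * real (Suc n) ^ Suc d / x ^ n" if "s \<in> S" for s n
    using that
  proof (induction n arbitrary: s rule: less_induct)
    case (less n)
    show ?case
    proof (cases "n = 0")
      case True thus ?thesis using F0 v(1) K less.prems by (simp add: less_imp_le)
    next
      case False
      \<comment> \<open>As \<open>k \<ge> 1\<close>, the induction hypothesis yields the power of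
        \<open>n\<close> rather than of \<open>Suc n\<close>; this gap absorbs \<open>G\<close>. For
        \<open>k > n\<close> truncation leads to \<open>F t 0 = 0\<close>.\<close>
      have bd: "F t (n - k) \<le> K * real n ^ Suc d / x ^ n * (x ^ k * v t)"
        if "k \<in> {1..m}" "t \<in> S" for k t
      proof (cases "k \<le> n")
        case True
        have "F t (n - k) \<le> K * v t * real (Suc (n - k)) ^ Suc d / x ^ (n - k)"
          using False that by (intro less.IH) auto
        also have "\<dots> = K * v t * real (Suc (n - k)) ^ Suc d * (x ^ k / x ^ n)"
          using True x by (simp add: power_diff)
        also have "\<dots> \<le> K * v t * real n ^ Suc d * (x ^ k / x ^ n)"
          using K(1) v(1)[OF that(2)] x that True
          by (intro mult_right_mono mult_left_mono power_mono) auto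
        finally show ?thesis by (simp add: mult_ac)
      next
        case False
        have "0 \<le> K * real n ^ Suc d / x ^ n * (x ^ k * v t)"
          using K(1) v(1)[OF that(2)] x by (intro mult_nonneg_nonneg divide_nonneg_nonneg) auto
        thus ?thesis using False F0[OF that(2)] by simp
      qed
      have "(\<Sum>k=1..m. \<Sum>t\<in>S. real (a k s t) * F t (n - k)) \<le>
          (\<Sum>k=1..m. \<Sum>t\<in>S. real (a k s t) * (K * real n ^ Suc d / x ^ n * (x ^ k * v t)))"
        by (intro sum_mono mult_left_mono bd) auto
      also have "\<dots> = (\<Sum>t\<in>S. \<Sum>k=1..m. real (a k s t) * (K * real n ^ Suc d / x ^ n * (x ^ k * v t)))"
        by (rule sum.swap)
      also have "\<dots> = K * real n ^ Suc d / x ^ n * (\<Sum>t\<in>S. transfer m a x s t * v t)"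
        unfolding transfer_def sum_distrib_left sum_distrib_right
        by (intro sum.cong refl) (simp add: mult_ac)
      also have "\<dots> \<le> K * real n ^ Suc d / x ^ n * v s"
        using v(2)[OF less.prems] K(1) x by (intro mult_left_mono) auto
      finally have 1: "(\<Sum>k=1..m. \<Sum>t\<in>S. real (a k s t) * F t (n - k)) \<le> K * real n ^ Suc d / x ^ n * v s" .
      have 2: "G s n \<le> v s * (K * real (Suc n) ^ d / x ^ n)"
        using GH[OF less.prems, of n] mult_left_mono[OF K(2)[of n], of "v s"] v(1)[OF less.prems]
        by linarith
      have "F s n \<le> G s n + (\<Sum>k=1..m. \<Sum>t\<in>S. real (a k s t) * F t (n - k))"
        using False less.prems by (intro rec) auto
      also have "\<dots> \<le> v s * (K * real (Suc n) ^ d / x ^ n) + K * real n ^ Suc d / x ^ n * v s"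
        using 1 2 by (rule add_mono[rotated])
      also have "\<dots> = K * v s / x ^ n * (real (Suc n) ^ d + real n ^ d * real n)"
        by (simp add: algebra_simps add_divide_distrib)
      also have "\<dots> \<le> K * v s / x ^ n * (real (Suc n) ^ d + real (Suc n) ^ d * real n)"
        using K(1) x v(1)[OF less.prems]
        by (intro mult_left_mono add_left_mono mult_right_mono power_mono) auto
      also have "\<dots> = K * v s * real (Suc n) ^ Suc d / x ^ n"
        by (simp add: algebra_simps add_divide_distrib)
      finally show ?thesis .
    qed
  qed
  show ?thesis unfolding poly_exp_bounded_def
    using main[OF s] by (intro exI[of _ "Suc d"] exI[of _ "K * v s"] allI)
qed

section \<open>Power series regular at a point\<close>

text \<open>Rationality is included. The product form needs no quotient of power series and lets
  \<open>Q\<close> vanish at 0.\<close>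

definition regular_at :: "complex \<Rightarrow> complex fps \<Rightarrow> bool" where
  "regular_at z F \<longleftrightarrow> (\<exists>P Q. F * fps_of_poly Q = fps_of_poly P \<and> poly Q z \<noteq> 0)"

lemma regular_at_poly: "regular_at z (fps_of_poly P)"
  unfolding regular_at_def by (intro exI[of _ P] exI[of _ 1]) simp

lemma regular_at_fps_X: "regular_at z fps_X"
  using regular_at_poly[of z "[:0, 1:]"] by simp

lemma regular_at_add:
  assumes "regular_at z F" "regular_at z G"
  shows "regular_at z (F + G)"
proof -
  obtain P Q P' Q' where *: "F * fps_of_poly Q = fps_of_poly P" "poly Q z \<noteq> 0"
    "G * fps_of_poly Q' = fps_of_poly P'" "poly Q' z \<noteq> 0"
    using assms unfolding regular_at_def by blast
  have "(F + G) * fps_of_poly (Q * Q') =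
      (F * fps_of_poly Q) * fps_of_poly Q' + (G * fps_of_poly Q') * fps_of_poly Q"
    by (simp add: fps_of_poly_mult algebra_simps)
  also have "\<dots> = fps_of_poly (P * Q' + P' * Q)"
    by (simp add: * fps_of_poly_mult fps_of_poly_add)
  finally show ?thesis using * unfolding regular_at_def
    by (intro exI[of _ "P * Q' + P' * Q"] exI[of _ "Q * Q'"]) simp
qed

lemma regular_at_poly_mult:
  assumes "regular_at z F"
  shows "regular_at z (fps_of_poly P * F)"
proof -
  obtain R Q where *: "F * fps_of_poly Q = fps_of_poly R" "poly Q z \<noteq> 0"
    using assms unfolding regular_at_def by blast
  have "fps_of_poly P * F * fps_of_poly Q = fps_of_poly (P * R)"
    by (simp add: * fps_of_poly_mult mult.assoc)
  thus ?thesis using * unfolding regular_at_def by blast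
qed

lemma regular_at_sum:
  assumes "\<And>i. i \<in> I \<Longrightarrow> regular_at z (F i)"
  shows "regular_at z (\<Sum>i\<in>I. F i)"
  using assms
proof (induction I rule: infinite_finite_induct)
  case (insert i I) thus ?case by (simp add: regular_at_add)
qed (use regular_at_poly[of z 0] in simp_all)

lemma regular_at_cancel:
  assumes "regular_at z (fps_of_poly D * F)" "poly D z \<noteq> 0"
  shows "regular_at z F"
proof -
  obtain P Q where *: "fps_of_poly D * F * fps_of_poly Q = fps_of_poly P" "poly Q z \<noteq> 0"
    using assms unfolding regular_at_def by blast
  have "F * fps_of_poly (D * Q) = fps_of_poly P" using * by (simp add: fps_of_poly_mult mult_ac)
  thus ?thesis using * assms(2) unfolding regular_at_def by (intro exI[of _ P] exI[of _ "D * Q"]) simp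
qed

text \<open>Cross-multiplying shows that any two fractions representing \<open>F\<close> agree near
  \<open>z\<close> off their zeros, and one of them has a finite limit there.\<close>

lemma not_pole_if_regular_at:
  assumes "regular_at z F"
  shows "\<not> rational_fps_pole F z"
proof
  assume "rational_fps_pole F z"
  then obtain P Q where PQ: "Q \<noteq> 0" "F * fps_of_poly Q = fps_of_poly P"
    and pole: "is_pole (\<lambda>w. poly P w / poly Q w) z"
    unfolding rational_fps_pole_def by blast
  obtain P' Q' where *: "F * fps_of_poly Q' = fps_of_poly P'" "poly Q' z \<noteq> 0"
    using assms unfolding regular_at_def by blast
  have "fps_of_poly (P * Q') = F * fps_of_poly Q * fps_of_poly Q'"
    by (simp add: PQ fps_of_poly_mult)
  also have "\<dots> = fps_of_poly (P' * Q)"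
    by (simp add: mult_ac * fps_of_poly_mult flip: *(1))
  finally have eq: "P * Q' = P' * Q" by (simp add: fps_of_poly_eq_iff)
  have "eventually (\<lambda>w. poly Q w \<noteq> 0 \<and> poly Q' w \<noteq> 0) (at z)"
  proof (rule eventually_conj)
    show "eventually (\<lambda>w. poly Q w \<noteq> 0) (at z)"
      using poly_roots_finite[OF PQ(1)] by (auto simp: eventually_at_topological intro!: exI[of _ "- ({w. poly Q w = 0} - {z})"] finite_imp_closed)
    have "((\<lambda>w. poly Q' w) \<longlongrightarrow> poly Q' z) (at z)" by (intro tendsto_intros)
    thus "eventually (\<lambda>w. poly Q' w \<noteq> 0) (at z)" using *(2) by (rule tendsto_imp_eventually_ne)
  qed
  hence "eventually (\<lambda>w. poly P w / poly Q w = poly P' w / poly Q' w) (at z)"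
  proof (rule eventually_mono)
    fix w assume "poly Q w \<noteq> 0 \<and> poly Q' w \<noteq> 0"
    moreover have "poly P w * poly Q' w = poly P' w * poly Q w"
      using arg_cong[OF eq, of "\<lambda>p. poly p w"] by simp
    ultimately show "poly P w / poly Q w = poly P' w / poly Q' w" by (simp add: field_simps)
  qed
  with pole have "is_pole (\<lambda>w. poly P' w / poly Q' w) z" by (rule is_pole_transform) simp
  moreover have "((\<lambda>w. poly P' w / poly Q' w) \<longlongrightarrow> poly P' z / poly Q' z) (at z)"
    by (intro tendsto_intros *)
  ultimately show False
    unfolding is_pole_def using not_tendsto_and_filterlim_at_infinity[of "at z"] by simp
qed

text \<open>For a denominator of least degree, a common zero with the numerator at \<open>z\<close>
  could be divided out. Regularity at \<open>w\<close> only supplies the rationality of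
  \<open>F\<close>.\<close>

lemma pole_if_not_regular_at:
  assumes "regular_at w F" "\<not> regular_at z F"
  shows "rational_fps_pole F z"
proof -
  define ok where "ok Q \<longleftrightarrow> Q \<noteq> 0 \<and> (\<exists>P. F * fps_of_poly Q = fps_of_poly P)" for Q
  obtain P0 Q0 where 1: "F * fps_of_poly Q0 = fps_of_poly P0" "poly Q0 w \<noteq> 0"
    using assms(1) unfolding regular_at_def by blast
  hence "Q0 \<noteq> 0" by (metis poly_0)
  with 1(1) have "ok Q0" unfolding ok_def by blast
  from ex_has_least_nat[of ok Q0 degree, OF this]
  obtain Q' where ok: "ok Q'" and min: "\<And>Q. ok Q \<Longrightarrow> degree Q' \<le> degree Q" by blast
  from ok obtain P' where F: "F * fps_of_poly Q' = fps_of_poly P'" and Q': "Q' \<noteq> 0"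
    unfolding ok_def by blast
  have 0: "poly Q' z = 0" using F assms(2) unfolding regular_at_def by blast
  have P'z: "poly P' z \<noteq> 0"
  proof
    assume "poly P' z = 0"
    then obtain P where P: "P' = [:-z, 1:] * P" unfolding poly_eq_0_iff_dvd by (rule dvdE)
    obtain Q where Q: "Q' = [:-z, 1:] * Q" using 0 unfolding poly_eq_0_iff_dvd by (rule dvdE)
    have "fps_of_poly [:-z, 1:] * (F * fps_of_poly Q) = fps_of_poly [:-z, 1:] * fps_of_poly P"
      using F unfolding P Q fps_of_poly_mult by (simp only: mult_ac)
    moreover have "fps_of_poly [:-z, 1:] \<noteq> 0" using fps_of_poly_eq_iff[of "[:-z, 1:]" 0] by simp
    ultimately have "F * fps_of_poly Q = fps_of_poly P" by simp
    moreover have "Q \<noteq> 0" using Q Q' by auto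
    ultimately have "ok Q" unfolding ok_def by blast
    moreover have "degree Q' = Suc (degree Q)" unfolding Q using \<open>Q \<noteq> 0\<close> by (subst degree_mult_eq) auto
    ultimately show False using min[of Q] by simp
  qed
  have "eventually (\<lambda>w. poly Q' w \<noteq> 0) (at z)"
    using poly_roots_finite[OF Q'] by (auto simp: eventually_at_topological intro!: exI[of _ "- ({w. poly Q' w = 0} - {z})"] finite_imp_closed)
  moreover have "((\<lambda>w. poly Q' w) \<longlongrightarrow> poly Q' z) (at z)" by (intro tendsto_intros)
  ultimately have "filterlim (\<lambda>w. poly Q' w) (at 0) (at z)" using 0 by (simp add: filterlim_at)
  hence "is_pole (\<lambda>w. poly P' w / poly Q' w) z"
    unfolding is_pole_def
    by (intro filterlim_divide_at_infinity[of _ "poly P' z"] tendsto_intros P'z)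
  thus ?thesis unfolding rational_fps_pole_def using Q' F by blast
qed

text \<open>Cramer's rule, moved from enumerated matrices to functions on \<open>S\<close>:
  \<open>D\<close> is the determinant and \<open>C\<close> the adjugate. Evaluation at
  \<open>z\<close> commutes with determinants, so a trivial kernel at \<open>z\<close> means that
  \<open>D\<close> does not vanish there.\<close>

lemma adjugate_over:
  fixes M :: "'i \<Rightarrow> 'i \<Rightarrow> complex poly"
  assumes fin: "finite S"
    and ker: "\<And>w s. (\<And>s. s \<in> S \<Longrightarrow> (\<Sum>t\<in>S. poly (M s t) z * w t) = 0) \<Longrightarrow> s \<in> S \<Longrightarrow> w s = 0"
  obtains D C where "poly D z \<noteq> 0"
    "\<And>s t. s \<in> S \<Longrightarrow> t \<in> S \<Longrightarrow> (\<Sum>u\<in>S. C s u * M u t) = (if s = t then D else 0)"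
proof -
  let ?n = "card S" and ?xs = "index_list S"
  define A where "A = indexed_mat S M"
  have car: "A \<in> carrier_mat ?n ?n" by (simp add: A_def indexed_mat_def)
  have h: "comm_ring_hom (\<lambda>p :: complex poly. poly p z)" by unfold_locales auto
  have map: "map_mat (\<lambda>p. poly p z) A = indexed_mat S (\<lambda>s t. poly (M s t) z)" (is "_ = ?B")
    by (auto simp: A_def indexed_mat_def)
  have B: "?B \<in> carrier_mat ?n ?n" by (simp add: indexed_mat_def)
  have "poly (det A) z = det ?B" unfolding map[symmetric] by (rule comm_ring_hom.hom_det[OF h, symmetric])
  moreover have "det ?B \<noteq> 0"
  proof
    assume "det ?B = 0"
    then obtain v where "v \<in> carrier_vec ?n" "v \<noteq> 0\<^sub>v ?n" "?B *\<^sub>v v = 0\<^sub>v ?n"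
      using det_0_iff_vec_prod_zero_field[OF B] by blast
    hence "eigenvalue ?B 0" using B
      by (auto simp: eigenvalue_def eigenvector_def intro!: exI[of _ v])
    thus False unfolding eigenvalue_indexed_mat_iff[OF fin] using ker by auto
  qed
  ultimately have D: "poly (det A) z \<noteq> 0" by simp
  note il = index_list[OF fin]
  have bij: "bij_betw ((!) ?xs) {0..<?n} S"
    using bij_betw_nth[OF il(2) _ il(1)[symmetric], of "{..<?n}"] il(3)
    by (simp add: atLeast0LessThan)
  define pos where "pos = the_inv_into {0..<?n} ((!) ?xs)"
  have pos: "pos (?xs ! i) = i" if "i < ?n" for i
    using bij that by (simp add: pos_def the_inv_into_f_f bij_betw_def)
  have pos': "pos s < ?n" "?xs ! pos s = s" if s: "s \<in> S" for s
  proof -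
    obtain i where "i < ?n" "s = ?xs ! i" using s il by (metis in_set_conv_nth)
    thus "pos s < ?n" "?xs ! pos s = s" using pos by auto
  qed
  define C where "C s u = adj_mat A $$ (pos s, pos u)" for s u
  show ?thesis
  proof (rule that[OF D, of C])
    fix s t assume st: "s \<in> S" "t \<in> S"
    have "(\<Sum>u\<in>S. C s u * M u t) = (\<Sum>j\<in>{0..<?n}. adj_mat A $$ (pos s, j) * A $$ (j, pos t))"
      unfolding sum.reindex_bij_betw[OF bij, symmetric]
      by (intro sum.cong) (use pos pos'[OF st(2)] in \<open>auto simp: C_def A_def indexed_mat_def\<close>)
    also have "\<dots> = (adj_mat A * A) $$ (pos s, pos t)"
      using adj_mat(1)[OF car] car pos'(1)[OF st(1)] pos'(1)[OF st(2)]
      by (auto simp: scalar_prod_def intro!: sum.cong)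
    also have "\<dots> = (if s = t then det A else 0)"
      unfolding adj_mat(3)[OF car] using pos'[OF st(1)] pos'[OF st(2)] by auto
    finally show "(\<Sum>u\<in>S. C s u * M u t) = (if s = t then det A else 0)" .
  qed
qed

text \<open>Multiplying the system by the adjugate of \<open>1 - W\<close> isolates
  \<open>D * F s\<close> as a polynomial combination of the regular series \<open>b u\<close>, and
  \<open>D\<close> can be divided out at \<open>z\<close>.\<close>

lemma regular_at_linear_system:
  fixes W :: "'i \<Rightarrow> 'i \<Rightarrow> complex poly"
  assumes fin: "finite S"
    and sys: "\<And>s. s \<in> S \<Longrightarrow> F s = b s + (\<Sum>t\<in>S. fps_of_poly (W s t) * F t)"
    and b: "\<And>s. s \<in> S \<Longrightarrow> regular_at z (b s)"
    and ker: "\<And>w s. (\<And>s. s \<in> S \<Longrightarrow> (\<Sum>t\<in>S. poly (W s t) z * w t) = w s) \<Longrightarrow> s \<in> S \<Longrightarrow> w s = 0"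
    and s: "s \<in> S"
  shows "regular_at z (F s)"
proof -
  define M where "M s t = of_bool (s = t) - W s t" for s t
  have delta: "(\<Sum>t\<in>S. of_bool (s = t) * f t) = f s" if "s \<in> S" for s and f :: "'i \<Rightarrow> 'b::comm_ring_1"
  proof -
    have "(\<Sum>t\<in>S. of_bool (s = t) * f t) = (\<Sum>t\<in>S. if s = t then f t else 0)"
      by (intro sum.cong) auto
    thus ?thesis using fin that by simp
  qed
  obtain D C where D: "poly D z \<noteq> 0"
    and C: "\<And>s t. s \<in> S \<Longrightarrow> t \<in> S \<Longrightarrow> (\<Sum>u\<in>S. C s u * M u t) = (if s = t then D else 0)"
  proof (rule adjugate_over[OF fin, of M z])
    fix w s assume w: "\<And>s. s \<in> S \<Longrightarrow> (\<Sum>t\<in>S. poly (M s t) z * w t) = 0" and s: "s \<in> S"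
    have *: "poly (M s t) z = of_bool (s = t) - poly (W s t) z" for s t
      by (simp add: M_def of_bool_def)
    show "w s = 0"
    proof (rule ker[OF _ s])
      fix s assume s: "s \<in> S"
      show "(\<Sum>t\<in>S. poly (W s t) z * w t) = w s"
        using w[OF s] delta[OF s, of w] by (simp add: * left_diff_distrib sum_subtractf)
    qed
  qed (rule that)
  have Mb: "(\<Sum>t\<in>S. fps_of_poly (M u t) * F t) = b u" if u: "u \<in> S" for u
  proof -
    have *: "fps_of_poly (M u t) = of_bool (u = t) - fps_of_poly (W u t)" for t
      by (simp add: M_def fps_of_poly_diff of_bool_def)
    show ?thesis using sys[OF u] delta[OF u, of F]
      by (simp add: * left_diff_distrib sum_subtractf algebra_simps)
  qed
  have "(\<Sum>u\<in>S. fps_of_poly (C s u) * b u) = (\<Sum>u\<in>S. \<Sum>t\<in>S. fps_of_poly (C s u * M u t) * F t)"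
    by (intro sum.cong refl) (simp add: Mb[symmetric] sum_distrib_left fps_of_poly_mult mult.assoc)
  also have "\<dots> = (\<Sum>t\<in>S. \<Sum>u\<in>S. fps_of_poly (C s u * M u t) * F t)" by (rule sum.swap)
  also have "\<dots> = (\<Sum>t\<in>S. fps_of_poly (\<Sum>u\<in>S. C s u * M u t) * F t)"
    by (simp add: fps_of_poly_sum sum_distrib_right)
  also have "\<dots> = (\<Sum>t\<in>S. if s = t then fps_of_poly D * F t else 0)"
    using s by (intro sum.cong refl) (simp add: C)
  also have "\<dots> = fps_of_poly D * F s" using fin s by simp
  finally have "fps_of_poly D * F s = (\<Sum>u\<in>S. fps_of_poly (C s u) * b u)" ..
  moreover have "regular_at z \<dots>" by (intro regular_at_sum regular_at_poly_mult b)
  ultimately show ?thesis using regular_at_cancel D by metis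
qed

lemma fps_of_poly_transfer:
  "fps_of_poly (transfer m a [:0, 1:] s t) = (transfer m a fps_X s t :: complex fps)"
  by (simp add: transfer_def fps_of_poly_sum fps_of_poly_mult fps_of_poly_power flip: of_nat_poly)
    (simp add: of_nat_poly fps_of_poly_const fps_of_nat)

lemma poly_transfer: "poly (transfer m a [:0, 1:] s t) z = transfer m a (z :: complex) s t"
  by (simp add: transfer_def poly_sum of_nat_poly)

text \<open>The vanishing at 0 reconciles truncated subtraction with multiplication by
  \<open>fps_X ^ k\<close>: for \<open>k > n\<close> both sides contribute 0.\<close>

lemma Abs_fps_linear_recurrence:
  fixes f :: "'i \<Rightarrow> nat \<Rightarrow> nat"
  assumes f0: "\<And>t. t \<in> S \<Longrightarrow> f t 0 = 0" and fs0: "h 0 = 0" and g0: "g 0 = 0"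
    and rec: "\<And>n. n \<ge> 1 \<Longrightarrow> h n = g n + (\<Sum>k=1..m. \<Sum>t\<in>S. a k s t * f t (n - k))"
  shows "(Abs_fps (\<lambda>n. of_nat (h n)) :: complex fps) =
    Abs_fps (\<lambda>n. of_nat (g n)) + (\<Sum>t\<in>S. transfer m a fps_X s t * Abs_fps (\<lambda>n. of_nat (f t n)))"
    (is "?L = ?R")
proof (rule fps_ext)
  fix n
  let ?F = "\<lambda>t. Abs_fps (\<lambda>n. of_nat (f t n)) :: complex fps"
  have "(\<Sum>t\<in>S. transfer m a fps_X s t * ?F t) $ n = (\<Sum>t\<in>S. \<Sum>k=1..m. (of_nat (a k s t) * (fps_X ^ k * ?F t)) $ n)"
    by (simp add: transfer_def fps_sum_nth sum_distrib_right mult.assoc)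
  also have "\<dots> = (\<Sum>t\<in>S. \<Sum>k=1..m. of_nat (a k s t * f t (n - k)))"
  proof (intro sum.cong refl)
    fix t k assume "t \<in> S" "k \<in> {1..m}"
    thus "(of_nat (a k s t) * (fps_X ^ k * ?F t)) $ n = of_nat (a k s t * f t (n - k))"
      using f0[of t] by (auto simp: fps_X_power_mult_nth fps_of_nat[symmetric])
  qed
  also have "\<dots> = (\<Sum>k=1..m. \<Sum>t\<in>S. of_nat (a k s t * f t (n - k)))" by (rule sum.swap)
  also have "\<dots> = of_nat (\<Sum>k=1..m. \<Sum>t\<in>S. a k s t * f t (n - k))" by simp
  finally have *: "(\<Sum>t\<in>S. transfer m a fps_X s t * ?F t) $ n = \<dots>" .
  show "?L $ n = ?R $ n"
  proof (cases "n = 0")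
    case True
    thus ?thesis using * f0 fs0 g0 by simp
  next
    case False
    thus ?thesis using * rec[of n] by simp
  qed
qed

lemma regular_at_transfer_mult:
  "regular_at z F \<Longrightarrow> regular_at z (transfer m a fps_X s t * F)"
  unfolding fps_of_poly_transfer[symmetric] by (rule regular_at_poly_mult)

lemma regular_at_recurrence:
  fixes f g :: "'i \<Rightarrow> nat \<Rightarrow> nat"
  assumes fin: "finite S"
    and f0: "\<And>s. s \<in> S \<Longrightarrow> f s 0 = 0" and g0: "\<And>s. s \<in> S \<Longrightarrow> g s 0 = 0"
    and rec: "\<And>s n. s \<in> S \<Longrightarrow> n \<ge> 1 \<Longrightarrow> f s n = g s n + (\<Sum>k=1..m. \<Sum>t\<in>S. a k s t * f t (n - k))"
    and g: "\<And>s. s \<in> S \<Longrightarrow> regular_at z (Abs_fps (\<lambda>n. of_nat (g s n)))"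
    and ker: "\<And>w s. (\<And>s. s \<in> S \<Longrightarrow> (\<Sum>t\<in>S. transfer m a z s t * w t) = w s) \<Longrightarrow> s \<in> S \<Longrightarrow> w s = 0"
    and s: "s \<in> S"
  shows "regular_at z (Abs_fps (\<lambda>n. of_nat (f s n)))"
proof (rule regular_at_linear_system[OF fin _ _ _ s, where F = "\<lambda>s. Abs_fps (\<lambda>n. complex_of_nat (f s n))"
      and b = "\<lambda>s. Abs_fps (\<lambda>n. complex_of_nat (g s n))" and W = "transfer m a [:0, 1:]"])
  fix s assume s: "s \<in> S"
  show "Abs_fps (\<lambda>n. complex_of_nat (f s n)) = Abs_fps (\<lambda>n. complex_of_nat (g s n)) +
      (\<Sum>t\<in>S. fps_of_poly (transfer m a [:0, 1:] s t) * Abs_fps (\<lambda>n. complex_of_nat (f t n)))"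
    unfolding fps_of_poly_transfer
    by (rule Abs_fps_linear_recurrence) (use s f0 g0 rec in auto)
next
  show "w s = 0" if "\<And>s. s \<in> S \<Longrightarrow> (\<Sum>t\<in>S. poly (transfer m a [:0, 1:] s t) z * w t) = w s" "s \<in> S"
    for w s using ker[of w s] that unfolding poly_transfer by blast
qed (rule g)


section \<open>Growth rate, radius of convergence and dominant singularity\<close>

lemma LIMSEQ_root_Suc: "(\<lambda>n. root n (real (Suc n))) \<longlonglongrightarrow> 1"
proof (rule tendsto_sandwich[of "\<lambda>_. 1" _ _ "\<lambda>n. root n (2 * real n)"])
  have "(\<lambda>n. root n 2 * root n (real n)) \<longlonglongrightarrow> 1 * 1"
    by (intro tendsto_mult LIMSEQ_root_const LIMSEQ_root) simp
  thus "(\<lambda>n. root n (2 * real n)) \<longlonglongrightarrow> 1" by (simp add: real_root_mult)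
  show "eventually (\<lambda>n. root n (real (Suc n)) \<le> root n (2 * real n)) sequentially"
    using eventually_gt_at_top[of 0] by eventually_elim (intro real_root_le_mono, auto)
  show "eventually (\<lambda>n. 1 \<le> root n (real (Suc n))) sequentially"
    using eventually_gt_at_top[of 0] by eventually_elim simp
qed simp

lemma root_limit:
  fixes f :: "nat \<Rightarrow> real"
  assumes r: "r > 0" and c: "c > 0" and lower: "\<And>n. n \<ge> 1 \<Longrightarrow> c / r ^ n \<le> f n"
    and upper: "poly_exp_bounded r f"
  shows "(\<lambda>n. root n (f n)) \<longlonglongrightarrow> inverse r"
proof -
  obtain d K where K0: "K \<ge> 0" and K': "\<And>e n. d \<le> e \<Longrightarrow> f n \<le> K * real (Suc n) ^ e / r ^ n"
    using poly_exp_boundedE[OF upper r] by metis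
  have K: "f n \<le> K * real (Suc n) ^ d / r ^ n" for n by (rule K') simp
  \<comment> \<open>\<open>root n K\<close> tends to 1 only for positive \<open>K\<close>; comparing
    both bounds at \<open>n = 1\<close> excludes \<open>K = 0\<close>.\<close>
  have "0 < c / r" using c r by simp
  also have "c / r \<le> K * real (Suc 1) ^ d / r ^ 1" using lower[of 1] K[of 1] by simp
  finally have Kpos: "K > 0" using r K0 by (cases "K = 0") auto
  show ?thesis
  proof (rule tendsto_sandwich)
    have "(\<lambda>n. root n c * inverse r) \<longlonglongrightarrow> 1 * inverse r"
      by (intro tendsto_mult LIMSEQ_root_const c tendsto_const)
    thus "(\<lambda>n. root n c * inverse r) \<longlonglongrightarrow> inverse r" by simp
    have "(\<lambda>n. root n K * root n (real (Suc n)) ^ d * inverse r) \<longlonglongrightarrow> 1 * 1 ^ d * inverse r"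
      by (intro tendsto_mult tendsto_power LIMSEQ_root_const LIMSEQ_root_Suc Kpos tendsto_const)
    thus "(\<lambda>n. root n K * root n (real (Suc n)) ^ d * inverse r) \<longlonglongrightarrow> inverse r" by simp
    have pw: "root n (x / r ^ n) = root n x * inverse r" if "n > 0" for x n
      using that r unfolding real_root_divide by (simp add: real_root_power_cancel divide_inverse)
    show "eventually (\<lambda>n. root n c * inverse r \<le> root n (f n)) sequentially"
      using eventually_gt_at_top[of 0]
    proof eventually_elim
      case (elim n)
      have "root n (c / r ^ n) \<le> root n (f n)" using elim by (intro real_root_le_mono lower) auto
      thus ?case using pw elim by simp
    qed
    show "eventually (\<lambda>n. root n (f n) \<le> root n K * root n (real (Suc n)) ^ d * inverse r) sequentially"
      using eventually_gt_at_top[of 0]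
    proof eventually_elim
      case (elim n)
      have "root n (f n) \<le> root n (K * real (Suc n) ^ d / r ^ n)"
        using elim by (intro real_root_le_mono K) auto
      also have "\<dots> = root n K * root n (real (Suc n)) ^ d * inverse r"
        using elim by (simp add: pw real_root_mult real_root_power)
      finally show ?case .
    qed
  qed
qed

lemma conv_radius_root_limit:
  fixes f :: "nat \<Rightarrow> 'a::banach"
  assumes "(\<lambda>n. root n (norm (f n))) \<longlonglongrightarrow> inverse r" "r > 0"
  shows "conv_radius f = ereal r"
proof -
  have "(\<lambda>n. ereal (root n (norm (f n)))) \<longlonglongrightarrow> ereal (inverse r)" using assms by simp
  hence "limsup (\<lambda>n. ereal (root n (norm (f n)))) = ereal (inverse r)"
    by (intro lim_imp_Limsup) auto
  thus ?thesis using assms by (simp add: conv_radius_def)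
qed

text \<open>
  As \<open>x\<close> increases to \<open>r\<close>, the sum at \<open>x\<close> is at least of order \<open>1 / (r - x)\<close>.
\<close>

lemma not_regular_at_radius:
  fixes f :: "nat \<Rightarrow> nat"
  assumes r: "r > 0" and c: "c > 0" and lower: "\<And>n. n \<ge> 1 \<Longrightarrow> c / r ^ n \<le> real (f n)"
    and rad: "fps_conv_radius (Abs_fps (\<lambda>n. complex_of_nat (f n))) = ereal r"
  shows "\<not> regular_at (of_real r) (Abs_fps (\<lambda>n. complex_of_nat (f n)))"
proof
  define F where "F = Abs_fps (\<lambda>n. complex_of_nat (f n))"
  assume "regular_at (of_real r) (Abs_fps (\<lambda>n. complex_of_nat (f n)))"
  then obtain P Q where PQ: "F * fps_of_poly Q = fps_of_poly P" "poly Q (of_real r) \<noteq> 0"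
    unfolding regular_at_def F_def by blast
  \<comment> \<open>Clearing the factor \<open>1 - x / r\<close> gives an inequality that survives
    the limit, where it would force the denominator to vanish at \<open>r\<close>.\<close>
  have ineq: "c * (x / r) * cmod (poly Q (of_real x)) \<le> (1 - x / r) * cmod (poly P (of_real x))"
    if x: "0 < x" "x < r" for x :: real
  proof -
    have xr: "ereal (norm (complex_of_real x)) < fps_conv_radius F" using x rad by (simp add: F_def)
    have ev: "eval_fps F (of_real x) * poly Q (of_real x) = poly P (of_real x)"
      using xr by (subst eval_fps_of_poly[symmetric], subst eval_fps_mult[symmetric])
        (simp_all add: PQ)
    have sm: "summable (\<lambda>n. norm (F $ n * of_real x ^ n))"
      using xr by (intro abs_summable_in_conv_radius) (simp add: fps_conv_radius_def)
    hence sf: "summable (\<lambda>n. real (f n) * x ^ n)"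
      using x by (simp add: F_def norm_mult norm_power)
    have "eval_fps F (of_real x) = (\<Sum>n. of_real (real (f n) * x ^ n))"
      by (simp add: eval_fps_def F_def)
    also have "\<dots> = of_real (\<Sum>n. real (f n) * x ^ n)" by (rule suminf_of_real[OF sf, symmetric])
    finally have Fx: "eval_fps F (of_real x) = of_real (\<Sum>n. real (f n) * x ^ n)" .
    have geo: "(\<lambda>n. c * (x / r) * (x / r) ^ n) sums (c * (x / r) * (1 / (1 - x / r)))"
      using x by (intro sums_mult geometric_sums) auto
    have "c * (x / r) * (1 / (1 - x / r)) = (\<Sum>n. c * (x / r) * (x / r) ^ n)"
      using geo by (simp add: sums_iff)
    also have "\<dots> \<le> (\<Sum>n. real (f (Suc n)) * x ^ Suc n)"
    proof (rule suminf_le)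
      fix n
      have "c / r ^ Suc n * x ^ Suc n \<le> real (f (Suc n)) * x ^ Suc n"
        using x lower[of "Suc n"] by (intro mult_right_mono) auto
      thus "c * (x / r) * (x / r) ^ n \<le> real (f (Suc n)) * x ^ Suc n"
        by (simp add: power_divide field_simps)
    next
      show "summable (\<lambda>n. real (f (Suc n)) * x ^ Suc n)"
        using summable_Suc_iff[of "\<lambda>n. real (f n) * x ^ n"] sf by blast
    qed (use geo in \<open>simp add: sums_iff\<close>)
    also have "\<dots> \<le> (\<Sum>n. real (f n) * x ^ n)"
      using suminf_split_head[OF sf] by simp
    finally have "c * (x / r) / (1 - x / r) \<le> (\<Sum>n. real (f n) * x ^ n)" by simp
    moreover have "1 - x / r > 0" using x by simp
    ultimately have "c * (x / r) \<le> (1 - x / r) * (\<Sum>n. real (f n) * x ^ n)"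
      by (simp only: pos_divide_le_eq mult.commute)
    also have "\<dots> \<le> (1 - x / r) * cmod (eval_fps F (of_real x))"
      using x unfolding Fx norm_of_real by (intro mult_left_mono) auto
    finally have "c * (x / r) * cmod (poly Q (of_real x)) \<le>
        (1 - x / r) * cmod (eval_fps F (of_real x)) * cmod (poly Q (of_real x))"
      by (rule mult_right_mono) simp
    thus ?thesis using ev by (simp add: mult.assoc norm_mult[symmetric])
  qed
  have "c * (r / r) * cmod (poly Q (of_real r)) \<le> (1 - r / r) * cmod (poly P (of_real r))"
  proof (rule tendsto_le[of "at_left r"])
    show "((\<lambda>x. c * (x / r) * cmod (poly Q (of_real x))) \<longlongrightarrow> c * (r / r) * cmod (poly Q (of_real r))) (at_left r)"
      "((\<lambda>x. (1 - x / r) * cmod (poly P (of_real x))) \<longlongrightarrow> (1 - r / r) * cmod (poly P (of_real r))) (at_left r)"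
      by (intro tendsto_intros; use r in simp)+
    show "eventually (\<lambda>x. c * (x / r) * cmod (poly Q (of_real x)) \<le> (1 - x / r) * cmod (poly P (of_real x))) (at_left r)"
      using eventually_at_left_real[OF r] by (rule eventually_mono) (use ineq in auto)
  qed simp
  moreover have "c * (r / r) * cmod (poly Q (of_real r)) > 0" using c r PQ(2) by simp
  ultimately show False using r by simp
qed

section \<open>Decomposition of 132-avoiding permutations at the maximum\<close>

lemma avoids_132_map_add: "avoids_132 (map ((+) d) xs) \<longleftrightarrow> avoids_132 xs"
proof -
  have "(i < j \<and> j < k \<and> k < length (map ((+) d) xs) \<and>
      map ((+) d) xs ! i < map ((+) d) xs ! k \<and> map ((+) d) xs ! k < map ((+) d) xs ! j) \<longleftrightarrow>
    (i < j \<and> j < k \<and> k < length xs \<and> xs ! i < xs ! k \<and> xs ! k < xs ! j)" for i j k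
    by (cases "i < j \<and> j < k \<and> k < length xs") auto
  thus ?thesis unfolding avoids_132_def by simp
qed

text \<open>The outer entries of a pattern increase from left to right, so neither is the maximum
  and they cannot lie on different sides of it; the whole pattern then lies in one block.\<close>

lemma avoids_132_append_Cons_max:
  assumes max: "\<And>x. x \<in> set A \<union> set B \<Longrightarrow> x < n"
    and AB: "\<And>a b. a \<in> set A \<Longrightarrow> b \<in> set B \<Longrightarrow> b < a"
  shows "avoids_132 (A @ n # B) \<longleftrightarrow> avoids_132 A \<and> avoids_132 B"
proof
  assume av: "avoids_132 (A @ n # B)"
  have "avoids_132 A" unfolding avoids_132_def
  proof (intro notI, elim exE)
    fix i j k assume *: "i < j \<and> j < k \<and> k < length A \<and> A ! i < A ! k \<and> A ! k < A ! j"
    show False using av unfolding avoids_132_def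
      by (rule notE) (intro exI[of _ i] exI[of _ j] exI[of _ k], use * in \<open>simp add: nth_append\<close>)
  qed
  moreover have "avoids_132 B" unfolding avoids_132_def
  proof (intro notI, elim exE)
    fix i j k assume *: "i < j \<and> j < k \<and> k < length B \<and> B ! i < B ! k \<and> B ! k < B ! j"
    let ?f = "\<lambda>i. Suc (length A + i)"
    show False using av unfolding avoids_132_def
      by (rule notE) (intro exI[of _ "?f i"] exI[of _ "?f j"] exI[of _ "?f k"],
        use * in \<open>simp add: nth_append\<close>)
  qed
  ultimately show "avoids_132 A \<and> avoids_132 B" ..
next
  assume av: "avoids_132 A \<and> avoids_132 B"
  let ?X = "A @ n # B"
  show "avoids_132 ?X" unfolding avoids_132_def
  proof (intro notI, elim exE conjE)
    fix i j k assume *: "i < j" "j < k" "k < length ?X" "?X ! i < ?X ! k" "?X ! k < ?X ! j"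
    have le: "?X ! l \<le> n" if "l < length ?X" for l
      using nth_mem[OF that] max by (auto intro: less_imp_le)
    have kA: "k \<noteq> length A" using *(5) le[of j] * by (auto simp: nth_append)
    have iA: "i \<noteq> length A" using *(4) le[of k] * by (auto simp: nth_append)
    consider "k < length A" | "i < length A" "k > length A" | "i > length A" using kA iA *(1,2) by linarith
    thus False
    proof cases
      case 1
      thus False using av * by (auto simp: avoids_132_def nth_append)
    next
      case 2
      have "?X ! k \<in> set B" using 2 * by (auto simp: nth_append nth_Cons' intro!: nth_mem)
      moreover have "?X ! i \<in> set A" using 2 by (simp add: nth_append)
      ultimately show False using AB *(4) by fastforce
    next
      case 3
      let ?f = "\<lambda>i. i - Suc (length A)"
      have nth: "?X ! l = B ! ?f l" if "l > length A" for l
        using that by (simp add: nth_append nth_Cons')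
      from av have "\<not> (\<exists>i j k. i < j \<and> j < k \<and> k < length B \<and> B ! i < B ! k \<and> B ! k < B ! j)"
        by (simp add: avoids_132_def)
      thus False
        by (rule notE) (intro exI[of _ "?f i"] exI[of _ "?f j"] exI[of _ "?f k"],
          use 3 * nth in auto)
    qed
  qed
qed

text \<open>Otherwise \<open>a\<close>, \<open>n\<close>, \<open>b\<close> would form the forbidden
  pattern.\<close>

lemma avoids_132_append_Cons_maxD:
  assumes av: "avoids_132 (A @ n # B)" and max: "b < n"
    and a: "a \<in> set A" and b: "b \<in> set B" and "a \<noteq> b"
  shows "b < a"
proof (rule ccontr)
  assume "\<not> b < a"
  hence ab: "a < b" using \<open>a \<noteq> b\<close> by simp
  obtain i where i: "i < length A" "A ! i = a" using a by (auto simp: in_set_conv_nth)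
  obtain k where k: "k < length B" "B ! k = b" using b by (auto simp: in_set_conv_nth)
  show False using av unfolding avoids_132_def
    by (rule notE) (intro exI[of _ i] exI[of _ "length A"] exI[of _ "Suc (length A + k)"],
      use i k ab max in \<open>simp add: nth_append\<close>)
qed

definition glue :: "nat list \<Rightarrow> nat list \<Rightarrow> nat list" where
  "glue A B = map ((+) (length B)) A @ Suc (length A + length B) # B"

lemma Av132_iff: "\<pi> \<in> Av132 n \<longleftrightarrow> set \<pi> = {1..n} \<and> distinct \<pi> \<and> avoids_132 \<pi>"
  by (auto simp: Av132_def permutations_of_set_def)

lemma length_Av132: "\<pi> \<in> Av132 n \<Longrightarrow> length \<pi> = n"
  using distinct_card[of \<pi>] by (auto simp: Av132_iff)

lemma finite_Av132: "finite (Av132 n)"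
  unfolding Av132_def by (rule finite_subset[of _ "permutations_of_set {1..n}"]) auto

lemma glue_in_Av132:
  assumes A: "A \<in> Av132 a" and B: "B \<in> Av132 b"
  shows "glue A B \<in> Av132 (Suc (a + b))"
proof -
  have len: "length A = a" "length B = b" using A B by (simp_all add: length_Av132)
  have AB: "set A = {1..a}" "distinct A" "avoids_132 A" "set B = {1..b}" "distinct B" "avoids_132 B"
    using A B by (auto simp: Av132_iff)
  have img: "(+) b ` {1..a} = {Suc b..a + b}" by (simp add: image_add_atLeastAtMost add.commute)
  have "avoids_132 (glue A B)" unfolding glue_def
    by (subst avoids_132_append_Cons_max) (use AB len in \<open>auto simp: avoids_132_map_add\<close>)
  moreover have "set (glue A B) = {1..Suc (a + b)}"
    using AB len img by (auto simp: glue_def)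
  moreover have "distinct (glue A B)"
    using AB len by (auto simp: glue_def distinct_map)
  ultimately show ?thesis by (simp add: Av132_iff)
qed

text \<open>The maximum occurs only once, which fixes the splitting point, and the length of the
  right block fixes the shift of the left one.\<close>

lemma glue_inj:
  assumes "A \<in> Av132 a" "B \<in> Av132 b" "A' \<in> Av132 a'" "B' \<in> Av132 b'"
    and eq: "glue A B = glue A' B'"
  shows "A = A' \<and> B = B'"
proof -
  let ?n = "Suc (length A + length B)"
  have "length (glue A B) = length (glue A' B')" by (simp add: eq)
  hence n: "length A' + length B' = length A + length B" by (simp add: glue_def)
  have 1: "map ((+) (length B)) A @ ?n # B = map ((+) (length B')) A' @ ?n # B'"
    using eq n by (simp add: glue_def)
  have 2: "?n \<notin> set (map ((+) (length B)) A)" "?n \<notin> set B"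
    using assms(1,2) length_Av132[OF assms(1)] length_Av132[OF assms(2)] by (auto simp: Av132_iff)
  from iffD1[OF append_Cons_eq_iff[OF 2] 1]
  have "map ((+) (length B)) A = map ((+) (length B')) A' \<and> B = B'" .
  thus ?thesis by (auto simp: inj_map_eq_map inj_def)
qed

lemma Av132_Suc_cases:
  assumes \<pi>: "\<pi> \<in> Av132 (Suc n)"
  obtains a A B where "a \<le> n" "A \<in> Av132 a" "B \<in> Av132 (n - a)" "\<pi> = glue A B"
proof -
  have s: "set \<pi> = {1..Suc n}" "distinct \<pi>" "avoids_132 \<pi>" using \<pi> by (auto simp: Av132_iff)
  hence "Suc n \<in> set \<pi>" by auto
  then obtain L B where LB: "\<pi> = L @ Suc n # B" by (auto simp: in_set_conv_decomp)
  have d: "distinct L" "distinct B" "set L \<inter> set B = {}" "Suc n \<notin> set L" "Suc n \<notin> set B"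
    using s(2) LB by auto
  have un: "set L \<union> set B = {1..n}"
  proof -
    have "set L \<union> set B = set \<pi> - {Suc n}" using d(4,5) unfolding LB by auto
    also have "\<dots> = {1..n}" unfolding s(1) by auto
    finally show ?thesis .
  qed
  have rg: "1 \<le> x \<and> x \<le> n" if "x \<in> set L \<or> x \<in> set B" for x
  proof -
    have "x \<in> set L \<union> set B" using that by simp
    thus ?thesis unfolding un by simp
  qed
  have gt: "b < a" if "a \<in> set L" "b \<in> set B" for a b
  proof (rule avoids_132_append_Cons_maxD[OF s(3)[unfolded LB] _ that])
    show "b < Suc n" using rg[of b] that by simp
    show "a \<noteq> b" using d that by auto
  qed
  define b where "b = length B"
  have cB: "card (set B) = b" using distinct_card[OF d(2)] by (simp add: b_def)
  have cL: "card (set L) = length L" by (rule distinct_card[OF d(1)])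
  have "card (set L \<union> set B) = length L + b"
    using cB cL d by (subst card_Un_disjoint) auto
  hence bn: "length L + b = n" by (simp add: un)
  \<comment> \<open>Values below \<open>Max (set B)\<close> cannot occur in \<open>L\<close>, all of
    whose entries exceed those of \<open>B\<close>; so \<open>set B\<close> is an initial
    interval.\<close>
  have B: "set B = {1..b}"
  proof (cases "set B = {}")
    case True thus ?thesis using b_def by auto
  next
    case False
    define M where "M = Max (set B)"
    have M: "M \<in> set B" "\<And>x. x \<in> set B \<Longrightarrow> x \<le> M" using False by (auto simp: M_def)
    have "set B = {1..M}"
    proof
      show "set B \<subseteq> {1..M}" using M(2) rg by force
      show "{1..M} \<subseteq> set B"
      proof
        fix x assume x: "x \<in> {1..M}"
        have "M \<le> n" using M(1) rg by blast
        hence "x \<in> set L \<union> set B" unfolding un using x by simp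
        moreover have "x \<notin> set L" using gt[OF _ M(1)] x by force
        ultimately show "x \<in> set B" by auto
      qed
    qed
    moreover from this cB have "M = b" by simp
    ultimately show ?thesis by simp
  qed
  have L: "set L = {Suc b..n}"
  proof -
    have "set L = {1..n} - {1..b}" unfolding un[symmetric] B[symmetric] using d(3) by auto
    also have "\<dots> = {Suc b..n}" by auto
    finally show ?thesis .
  qed
  define A where "A = map (\<lambda>x. x - b) L"
  have LA: "L = map ((+) b) A" unfolding A_def map_map
    by (rule map_idI[symmetric]) (use L in auto)
  have "(+) b ` set A = {Suc b..n}" using L LA by (metis set_map)
  also have "\<dots> = (+) b ` {1..length L}" using bn by (simp add: image_add_atLeastAtMost add.commute)
  finally have "(+) b ` set A = (+) b ` {1..length L}" .
  hence "set A = {1..length L}" by (subst (asm) inj_image_eq_iff) (auto simp: inj_def)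
  moreover have "distinct A" using d(1) unfolding LA by (simp add: distinct_map)
  moreover have av: "avoids_132 L \<and> avoids_132 B"
    using s(3) unfolding LB by (subst (asm) avoids_132_append_Cons_max) (use rg gt in \<open>auto simp: less_Suc_eq_le\<close>)
  ultimately have "A \<in> Av132 (length L)"
    by (simp add: Av132_iff LA avoids_132_map_add)
  moreover have "B \<in> Av132 (n - length L)"
    using B d(2) av bn by (auto simp: Av132_iff)
  moreover have "\<pi> = glue A B"
  proof -
    have "length A = length L" by (simp add: A_def)
    thus ?thesis unfolding glue_def b_def[symmetric] LA[symmetric] using LB bn by simp
  qed
  ultimately show ?thesis using that[of "length L" A B] bn by simp
qed

section \<open>Step bounds and counts refined by the two end entries\<close>

definition dist_le :: "nat \<Rightarrow> nat \<Rightarrow> nat \<Rightarrow> bool" where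
  "dist_le m x y \<longleftrightarrow> \<bar>int y - int x\<bar> \<le> int m"

lemma bounded_steps_successively: "bounded_steps m \<pi> \<longleftrightarrow> successively (dist_le m) \<pi>"
proof (induction \<pi> rule: induct_list012)
  case (3 x y zs)
  have "bounded_steps m (x # y # zs) \<longleftrightarrow> dist_le m x y \<and> bounded_steps m (y # zs)"
    unfolding bounded_steps_def dist_le_def by (auto simp: nth_Cons split: nat.splits)
  with 3 show ?case by simp
qed (auto simp: bounded_steps_def)

lemma bounded_steps_glue:
  "bounded_steps m (glue A B) \<longleftrightarrow> bounded_steps m A \<and> bounded_steps m B \<and>
     (A \<noteq> [] \<longrightarrow> dist_le m (last A) (Suc (length A))) \<and>
     (B \<noteq> [] \<longrightarrow> dist_le m (Suc (length A + length B)) (hd B))"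
proof -
  have "successively (\<lambda>x y. dist_le m (length B + x) (length B + y)) A \<longleftrightarrow> successively (dist_le m) A"
    by (intro successively_cong) (auto simp: dist_le_def)
  moreover have "dist_le m (last (map ((+) (length B)) A)) (Suc (length A + length B)) \<longleftrightarrow>
      dist_le m (last A) (Suc (length A))" if "A \<noteq> []"
    using that by (simp add: last_map dist_le_def algebra_simps)
  ultimately show ?thesis
    unfolding bounded_steps_successively glue_def successively_append_iff successively_Cons successively_map
    by (cases "A = []"; cases "B = []") (simp_all add: conj_ac)
qed

text \<open>Entries of \<open>{1..n}\<close> differ by at most \<open>n - 1\<close>. Applied to the
  short left block, this is why \<open>cnum\<close> carries no step condition.\<close>

lemma bounded_steps_short:
  assumes "\<pi> \<in> Av132 n" "n \<le> Suc m"
  shows "bounded_steps m \<pi>"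
  unfolding bounded_steps_def
proof (intro allI impI)
  fix i assume i: "Suc i < length \<pi>"
  have "\<pi> ! i \<in> set \<pi>" "\<pi> ! Suc i \<in> set \<pi>" using i by simp_all
  hence "\<pi> ! i \<in> {1..n}" "\<pi> ! Suc i \<in> {1..n}" using assms(1) by (auto simp: Av132_iff)
  thus "\<bar>int (\<pi> ! Suc i) - int (\<pi> ! i)\<bar> \<le> int m" using assms(2) by auto
qed

text \<open>Upper bounds instead of exact distances make each left length lead to a single new
  state. Excluding the empty word gives \<open>hd\<close> and \<open>last\<close> a meaning and
  makes the count vanish at 0.\<close>

definition corner_set :: "nat \<Rightarrow> enat \<times> enat \<Rightarrow> nat \<Rightarrow> nat list set" where
  "corner_set m s n = {\<pi> \<in> Av132 n. \<pi> \<noteq> [] \<and> bounded_steps m \<pi> \<and>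
     enat (n - hd \<pi>) \<le> fst s \<and> enat (n - last \<pi>) \<le> snd s}"

definition corner_count :: "nat \<Rightarrow> enat \<times> enat \<Rightarrow> nat \<Rightarrow> nat" where
  "corner_count m s n = card (corner_set m s n)"

lemma finite_corner_set: "finite (corner_set m s n)"
  unfolding corner_set_def using finite_Av132 by simp

lemma corner_count_0: "corner_count m s 0 = 0"
  by (simp add: corner_count_def corner_set_def Av132_iff)

lemma corner_count_mono:
  "fst s \<le> fst t \<Longrightarrow> snd s \<le> snd t \<Longrightarrow> corner_count m s n \<le> corner_count m t n"
  unfolding corner_count_def
  by (intro card_mono finite_corner_set) (auto simp: corner_set_def intro: order_trans)

lemma count132_eq_corner_count:
  assumes "n \<ge> 1"
  shows "count132 m n = corner_count m (\<infinity>, \<infinity>) n"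
proof -
  have "\<pi> \<noteq> []" if "\<pi> \<in> Av132 n" for \<pi> using length_Av132[OF that] assms by auto
  hence "{\<pi> \<in> Av132 n. bounded_steps m \<pi>} = corner_set m (\<infinity>, \<infinity>) n"
    by (auto simp: corner_set_def)
  thus ?thesis by (simp add: count132_def corner_count_def)
qed

lemma enat_add_le_iff: "enat (k + x) \<le> q \<longleftrightarrow> enat k \<le> q \<and> enat x \<le> q - enat k"
  by (cases q) auto

text \<open>The entry after the maximum is \<open>hd B \<le> b\<close>, a drop of at least
  \<open>Suc a\<close>, so \<open>B\<close> is left with the allowance \<open>m - Suc a\<close> at
  its start. The last entry is \<open>Suc a\<close> further from the overall maximum than from that
  of \<open>B\<close>. For \<open>a = 0\<close> the maximum comes first and \<open>p\<close> imposes
  nothing.\<close>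

lemma glue_in_corner_set_iff:
  assumes A: "A \<in> Av132 a" and B: "B \<in> Av132 b" and b: "b \<ge> 1"
  shows "glue A B \<in> corner_set m (p, q) (Suc (a + b)) \<longleftrightarrow>
    Suc a \<le> m \<and> enat (Suc a) \<le> q \<and> (a = 0 \<or> enat (Suc a - hd A) \<le> p) \<and>
    B \<in> corner_set m (enat (m - Suc a), q - enat (Suc a)) b"
proof -
  have len: "length A = a" "length B = b" using A B by (simp_all add: length_Av132)
  have Bne: "B \<noteq> []" using len b by auto
  have Ane: "A \<noteq> [] \<longleftrightarrow> a \<noteq> 0" using len by auto
  have rB: "hd B \<in> {1..b}" "last B \<in> {1..b}" using B Bne by (auto simp: Av132_iff dest: hd_in_set last_in_set)
  have rA: "hd A \<in> {1..a}" "last A \<in> {1..a}" if "A \<noteq> []"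
    using A that by (auto simp: Av132_iff dest: hd_in_set last_in_set)
  have 1: "dist_le m (Suc (a + b)) (hd B) \<longleftrightarrow> Suc a \<le> m \<and> b - hd B \<le> m - Suc a"
    using rB by (auto simp: dist_le_def)
  have 2: "bounded_steps m A \<and> (A \<noteq> [] \<longrightarrow> dist_le m (last A) (Suc a))" if "Suc a \<le> m"
    using bounded_steps_short[OF A] that rA by (auto simp: dist_le_def)
  have "Suc (a + b) - last B = Suc a + (b - last B)" using rB by auto
  hence 3: "enat (Suc (a + b) - last B) \<le> q \<longleftrightarrow> enat (Suc a) \<le> q \<and> enat (b - last B) \<le> q - enat (Suc a)"
    by (simp only: enat_add_le_iff)
  have hd: "hd (glue A B) = (if a = 0 then Suc (a + b) else b + hd A)"
    using len Ane by (auto simp: glue_def hd_append hd_map)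
  have 4: "enat (Suc (a + b) - hd (glue A B)) \<le> p \<longleftrightarrow> a = 0 \<or> enat (Suc a - hd A) \<le> p"
    by (simp add: hd zero_enat_def[symmetric])
  have last: "last (glue A B) = last B" using Bne by (simp add: glue_def)
  have "glue A B \<noteq> []" by (simp add: glue_def)
  thus ?thesis
    using glue_in_Av132[OF A B] B Bne 2
    unfolding corner_set_def mem_Collect_eq bounded_steps_glue len fst_conv snd_conv last 4 3
    by (auto simp: 1)
qed

text \<open>The maximum comes last, so \<open>q\<close> imposes nothing; the last step leaves the
  allowance \<open>m - 1\<close> at the end of \<open>A\<close>, and the first entry of
  \<open>A\<close> is one further from the new maximum. The case \<open>a = 0\<close> is the
  inhomogeneity \<open>x\<close>.\<close>

lemma glue_Nil_in_corner_set_iff: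
  assumes A: "A \<in> Av132 a" and m: "m \<ge> 1"
  shows "glue A [] \<in> corner_set m (p, q) (Suc a) \<longleftrightarrow>
    a = 0 \<or> 1 \<le> p \<and> A \<in> corner_set m (p - 1, enat (m - 1)) a"
proof (cases "a = 0")
  case True
  have "[] \<in> Av132 0" by (simp add: Av132_iff avoids_132_def)
  from glue_in_Av132[OF this this] have "[Suc 0] \<in> Av132 (Suc 0)" by (simp add: glue_def)
  moreover have "A = []" using A True length_Av132 by fastforce
  ultimately show ?thesis using True
    by (simp add: corner_set_def glue_def bounded_steps_def zero_enat_def[symmetric])
next
  case False
  have len: "length A = a" using A by (simp add: length_Av132)
  have Ane: "A \<noteq> []" using len False by auto
  have rA: "hd A \<in> {1..a}" "last A \<in> {1..a}"
    using A Ane by (auto simp: Av132_iff dest: hd_in_set last_in_set)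
  have N: "[] \<in> Av132 0" by (simp add: Av132_iff avoids_132_def)
  have g: "glue A [] = A @ [Suc a]" using len by (simp add: glue_def map_idI)
  have 1: "dist_le m (last A) (Suc a) \<longleftrightarrow> a - last A \<le> m - 1"
    using rA m by (auto simp: dist_le_def)
  have "Suc a - hd A = 1 + (a - hd A)" using rA by auto
  hence 2: "enat (Suc a - hd A) \<le> p \<longleftrightarrow> 1 \<le> p \<and> enat (a - hd A) \<le> p - 1"
    by (simp only: enat_add_le_iff one_enat_def)
  have b0: "bounded_steps m []" by (simp add: bounded_steps_def)
  show ?thesis
    using glue_in_Av132[OF A N] A Ane False bounded_steps_glue[of m A "[]"] 1 2
    by (auto simp: corner_set_def len g b0 zero_enat_def[symmetric])
qed

lemma corner_count_Suc:
  assumes m: "m \<ge> 1"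
  shows "corner_count m (p, q) (Suc n) =
    of_bool (n = 0) + of_bool (1 \<le> p) * corner_count m (p - 1, enat (m - 1)) n +
    (\<Sum>a<n. of_bool (Suc a \<le> m \<and> enat (Suc a) \<le> q) * cnum (Suc a) p *
       corner_count m (enat (m - Suc a), q - enat (Suc a)) (n - a))"
proof -
  define P where "P a = {x \<in> Av132 a \<times> Av132 (n - a). glue (fst x) (snd x) \<in> corner_set m (p, q) (Suc n)}" for a
  have finP: "finite (P a)" for a unfolding P_def using finite_Av132 by simp
  have "corner_set m (p, q) (Suc n) = (\<lambda>x. glue (fst x) (snd x)) ` (\<Union>a\<in>{..n}. P a)"
  proof (intro equalityI subsetI)
    fix \<pi> assume \<pi>: "\<pi> \<in> corner_set m (p, q) (Suc n)"
    hence "\<pi> \<in> Av132 (Suc n)" by (simp add: corner_set_def)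
    then obtain a A B where "a \<le> n" "A \<in> Av132 a" "B \<in> Av132 (n - a)" "\<pi> = glue A B"
      by (rule Av132_Suc_cases)
    thus "\<pi> \<in> (\<lambda>x. glue (fst x) (snd x)) ` (\<Union>a\<in>{..n}. P a)"
      using \<pi> by (auto simp: P_def intro!: image_eqI[of _ _ "(A, B)"] bexI[of _ a])
  qed (auto simp: P_def)
  moreover have "inj_on (\<lambda>x. glue (fst x) (snd x)) (\<Union>a\<in>{..n}. P a)"
  proof (rule inj_onI)
    fix x y assume "x \<in> (\<Union>a\<in>{..n}. P a)" "y \<in> (\<Union>a\<in>{..n}. P a)"
      and eq: "glue (fst x) (snd x) = glue (fst y) (snd y)"
    then obtain a b where "fst x \<in> Av132 a" "snd x \<in> Av132 (n - a)" "fst y \<in> Av132 b" "snd y \<in> Av132 (n - b)"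
      by (auto simp: P_def)
    from glue_inj[OF this eq] show "x = y" by (simp add: prod_eq_iff)
  qed
  ultimately have "corner_count m (p, q) (Suc n) = card (\<Union>a\<in>{..n}. P a)"
    by (simp add: corner_count_def card_image)
  also have "\<dots> = (\<Sum>a\<le>n. card (P a))"
  proof (rule card_UN_disjoint)
    show "\<forall>a\<in>{..n}. \<forall>b\<in>{..n}. a \<noteq> b \<longrightarrow> P a \<inter> P b = {}"
      by (auto simp: P_def dest: length_Av132)
  qed (use finP in auto)
  \<comment> \<open>In \<open>P n\<close> the right block is empty, which is governed by the other
    membership criterion.\<close>
  also have "\<dots> = card (P n) + (\<Sum>a<n. card (P a))"
    by (simp add: lessThan_Suc_atMost[symmetric])
  also have "(\<Sum>a<n. card (P a)) = (\<Sum>a<n. of_bool (Suc a \<le> m \<and> enat (Suc a) \<le> q) * cnum (Suc a) p *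
       corner_count m (enat (m - Suc a), q - enat (Suc a)) (n - a))"
  proof (rule sum.cong[OF refl])
    fix a assume "a \<in> {..<n}"
    hence a: "n - a \<ge> 1" "Suc (a + (n - a)) = Suc n" by auto
    \<comment> \<open>The left block has length \<open>a\<close>, while \<open>cnum k\<close> counts
      words of length \<open>k - 1\<close>; hence the index \<open>Suc a\<close>.\<close>
    define X where "X = {A \<in> Av132 a. a = 0 \<or> enat (Suc a - hd A) \<le> p}"
    have "card X = cnum (Suc a) p"
    proof (cases "a = 0")
      case True
      have "Av132 0 = {[]}" by (auto simp: Av132_iff avoids_132_def)
      thus ?thesis using True by (simp add: X_def cnum_def)
    qed (simp add: X_def cnum_def)
    moreover have "P a = (if Suc a \<le> m \<and> enat (Suc a) \<le> q
        then X \<times> corner_set m (enat (m - Suc a), q - enat (Suc a)) (n - a) else {})"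
    proof -
      have "x \<in> P a \<longleftrightarrow> fst x \<in> X \<and> Suc a \<le> m \<and> enat (Suc a) \<le> q \<and>
          snd x \<in> corner_set m (enat (m - Suc a), q - enat (Suc a)) (n - a)" for x
      proof (cases "fst x \<in> Av132 a \<and> snd x \<in> Av132 (n - a)")
        case True
        with glue_in_corner_set_iff[of "fst x" a "snd x" "n - a" m p q, unfolded a(2)] a(1) show ?thesis
          unfolding P_def X_def mem_Collect_eq mem_Times_iff by blast
      qed (auto simp: P_def X_def corner_set_def)
      note mem = this
      show ?thesis
      proof (cases "Suc a \<le> m \<and> enat (Suc a) \<le> q")
        case True
        show ?thesis unfolding if_P[OF True] by (rule Set.set_eqI) (use mem True in \<open>simp add: mem_Times_iff\<close>)
      qed (use mem in auto)
    qed
    ultimately show "card (P a) = of_bool (Suc a \<le> m \<and> enat (Suc a) \<le> q) * cnum (Suc a) p *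
        corner_count m (enat (m - Suc a), q - enat (Suc a)) (n - a)"
      by (simp add: card_cartesian_product corner_count_def)
  qed
  also have "card (P n) = of_bool (n = 0) + of_bool (1 \<le> p) * corner_count m (p - 1, enat (m - 1)) n"
  proof -
    have A0: "Av132 0 = {[]}" by (auto simp: Av132_iff avoids_132_def)
    have "P n = {A \<in> Av132 n. n = 0 \<or> 1 \<le> p \<and> A \<in> corner_set m (p - 1, enat (m - 1)) n} \<times> {[]}"
    proof -
      have "glue A [] \<in> corner_set m (p, q) (Suc n) \<longleftrightarrow>
          n = 0 \<or> 1 \<le> p \<and> A \<in> corner_set m (p - 1, enat (m - 1)) n" if "A \<in> Av132 n" for A
        by (rule glue_Nil_in_corner_set_iff[OF that m])
      thus ?thesis by (force simp only: P_def A0 diff_self_eq_0 mem_Times_iff set_eq_iff mem_Collect_eq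
        singleton_iff fst_conv snd_conv)
    qed
    also have "card \<dots> = card {A \<in> Av132 n. n = 0 \<or> 1 \<le> p \<and> A \<in> corner_set m (p - 1, enat (m - 1)) n}"
      by (simp add: card_cartesian_product)
    also have "\<dots> = of_bool (n = 0) + of_bool (1 \<le> p) * corner_count m (p - 1, enat (m - 1)) n"
    proof (cases "n = 0")
      case True thus ?thesis by (simp add: A0 corner_count_0)
    next
      case False
      have "{A \<in> Av132 n. A \<in> corner_set m (p - 1, enat (m - 1)) n} = corner_set m (p - 1, enat (m - 1)) n"
        by (auto simp: corner_set_def)
      thus ?thesis using False by (auto simp: corner_count_def)
    qed
    finally show ?thesis .
  qed
  finally show ?thesis by simp
qed

lemma corner_count_rec:
  assumes m: "m \<ge> 1" and n: "n \<ge> 1"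
  shows "corner_count m (p, q) n =
    of_bool (n = 1) + of_bool (1 \<le> p) * corner_count m (p - 1, enat (m - 1)) (n - 1) +
    (\<Sum>k=1..m. of_bool (enat k \<le> q) * cnum k p * corner_count m (enat (m - k), q - enat k) (n - k))"
proof -
  obtain n' where n': "n = Suc n'" using n by (cases n) auto
  let ?f = "\<lambda>k. of_bool (k \<le> m \<and> enat k \<le> q) * cnum k p * corner_count m (enat (m - k), q - enat k) (n - k)"
  have "(\<Sum>a<n'. of_bool (Suc a \<le> m \<and> enat (Suc a) \<le> q) * cnum (Suc a) p *
       corner_count m (enat (m - Suc a), q - enat (Suc a)) (n' - a)) = (\<Sum>a<n'. ?f (Suc a))"
    by (simp add: n')
  also have "\<dots> = (\<Sum>k\<in>{1..n'}. ?f k)"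
    by (rule sum.reindex_bij_witness[of _ "\<lambda>k. k - 1" Suc]) auto
  \<comment> \<open>Terms with \<open>k > n'\<close> vanish because \<open>n - k = 0\<close>, those
    with \<open>k > m\<close> because of the indicator; this trades the range depending on
    \<open>n\<close> for the fixed one.\<close>
  also have "\<dots> = (\<Sum>k\<in>{1..max n' m}. ?f k)"
    by (rule sum.mono_neutral_left) (auto simp: n' corner_count_0)
  also have "\<dots> = (\<Sum>k\<in>{1..m}. ?f k)"
    by (rule sum.mono_neutral_right) auto
  also have "\<dots> = (\<Sum>k=1..m. of_bool (enat k \<le> q) * cnum k p * corner_count m (enat (m - k), q - enat k) (n - k))"
    by (intro sum.cong) auto
  finally show ?thesis using corner_count_Suc[OF m, of p q n'] by (simp add: n')
qed

text \<open>The coefficient of \<open>x ^ k\<close> in the entries of the matrix, as a natural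
  number, so that it can be reused through \<open>transfer\<close> in every semiring.\<close>

definition wcoeff :: "nat \<Rightarrow> nat \<Rightarrow> enat \<times> enat \<Rightarrow> enat \<times> enat \<Rightarrow> nat" where
  "wcoeff m k s t = cnum k (fst s) * of_bool (enat k \<le> snd s \<and> t = (enat (m - k), snd s - enat k))
     + of_bool (k = 1 \<and> 1 \<le> fst s \<and> t = (fst s - 1, enat (m - 1)))"

text \<open>\<open>T\<close> may be any finite set containing the successors of \<open>s\<close>, so
  that the recursion can be restricted to a layer and those beneath it.\<close>

lemma corner_count_system:
  assumes m: "m \<ge> 1" and n: "n \<ge> 1" and T: "finite T"
    and closed: "\<And>k. 1 \<le> k \<Longrightarrow> k \<le> m \<Longrightarrow> enat k \<le> snd s \<Longrightarrow> (enat (m - k), snd s - enat k) \<in> T"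
      "1 \<le> fst s \<Longrightarrow> (fst s - 1, enat (m - 1)) \<in> T"
  shows "corner_count m s n = of_bool (n = 1) + (\<Sum>k=1..m. \<Sum>t\<in>T. wcoeff m k s t * corner_count m t (n - k))"
proof -
  obtain p q where s: "s = (p, q)" by (cases s)
  let ?C = "corner_count m"
  define t2 where "t2 = (p - 1, enat (m - 1))"
  have *: "(\<Sum>t\<in>T. wcoeff m k s t * ?C t (n - k)) =
      of_bool (enat k \<le> q) * cnum k p * ?C (enat (m - k), q - enat k) (n - k) +
      (if k = 1 then of_bool (1 \<le> p) * ?C t2 (n - 1) else 0)"
    if k: "k \<in> {1..m}" for k
  proof -
    define t1 where "t1 = (enat (m - k), q - enat k)"
    have "wcoeff m k s t * ?C t (n - k) =
        (if t = t1 then of_bool (enat k \<le> q) * cnum k p * ?C t (n - k) else 0) +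
        (if t = t2 then of_bool (k = 1 \<and> 1 \<le> p) * ?C t (n - k) else 0)" for t
      unfolding wcoeff_def s fst_conv snd_conv t1_def[symmetric] t2_def[symmetric]
      by (cases "t = t1"; cases "t = t2") (simp_all add: distrib_right)
    hence "(\<Sum>t\<in>T. wcoeff m k s t * ?C t (n - k)) =
        (if t1 \<in> T then of_bool (enat k \<le> q) * cnum k p * ?C t1 (n - k) else 0) +
        (if t2 \<in> T then of_bool (k = 1 \<and> 1 \<le> p) * ?C t2 (n - k) else 0)"
      by (simp only: sum.distrib sum.delta'[OF T] sum.delta[OF T])
    moreover have "enat k \<le> q \<Longrightarrow> t1 \<in> T" using closed(1)[of k] k by (simp add: s t1_def)
    moreover have "1 \<le> p \<Longrightarrow> t2 \<in> T" using closed(2) by (simp add: s t2_def)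
    ultimately show ?thesis unfolding t1_def[symmetric]
      by (cases "enat k \<le> q"; cases "1 \<le> p"; cases "k = 1") simp_all
  qed
  have "(\<Sum>k=1..m. \<Sum>t\<in>T. wcoeff m k s t * ?C t (n - k)) =
      (\<Sum>k=1..m. of_bool (enat k \<le> q) * cnum k p * ?C (enat (m - k), q - enat k) (n - k) +
        (if k = 1 then of_bool (1 \<le> p) * ?C t2 (n - 1) else 0))"
    by (rule sum.cong[OF refl *])
  also have "\<dots> = (\<Sum>k=1..m. of_bool (enat k \<le> q) * cnum k p * ?C (enat (m - k), q - enat k) (n - k)) +
      of_bool (1 \<le> p) * ?C t2 (n - 1)"
    unfolding sum.distrib using m by simp
  finally have "(\<Sum>k=1..m. \<Sum>t\<in>T. wcoeff m k s t * ?C t (n - k)) =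
      (\<Sum>k=1..m. of_bool (enat k \<le> q) * cnum k p * ?C (enat (m - k), q - enat k) (n - k)) +
      of_bool (1 \<le> p) * ?C t2 (n - 1)" .
  thus ?thesis using corner_count_rec[OF m n, of p q] by (simp add: s t2_def)
qed

lemma cnum_pos:
  assumes "k \<ge> 1" "k = 1 \<or> 1 \<le> p"
  shows "cnum k p > 0"
proof (cases "k = 1")
  case False
  hence p: "1 \<le> p" and k: "k \<ge> 2" using assms by auto
  \<comment> \<open>The decreasing word starts with \<open>k - 1\<close>, as close to
    \<open>k\<close> as possible, so \<open>p \<ge> 1\<close> suffices.\<close>
  let ?\<sigma> = "rev [1..<k]"
  have "?\<sigma> \<in> Av132 (k - 1)"
    using k by (auto simp: Av132_iff avoids_132_def rev_nth)
  moreover have "hd ?\<sigma> = k - 1" using k by (simp add: hd_rev)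
  hence "enat (k - hd ?\<sigma>) \<le> p" using k p by (simp add: one_enat_def)
  ultimately have "{\<sigma> \<in> Av132 (k - 1). enat (k - hd \<sigma>) \<le> p} \<noteq> {}" by blast
  moreover have "finite {\<sigma> \<in> Av132 (k - 1). enat (k - hd \<sigma>) \<le> p}" using finite_Av132 by simp
  ultimately show ?thesis using False by (simp add: cnum_def card_gt_0_iff)
qed (simp add: cnum_def)

section \<open>The classes U and V\<close>

lemma transfer_wcoeff:
  assumes "m \<ge> 1"
  shows "transfer m (wcoeff m) x s t =
    (\<Sum>k=1..m. of_nat (cnum k (fst s)) * of_bool (enat k \<le> snd s \<and> t = (enat (m - k), snd s - enat k)) * x ^ k)
    + x * of_bool (1 \<le> fst s \<and> t = (fst s - 1, enat (m - 1)))"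
proof -
  let ?B = "1 \<le> fst s \<and> t = (fst s - 1, enat (m - 1))"
  have "transfer m (wcoeff m) x s t =
    (\<Sum>k=1..m. of_nat (cnum k (fst s)) * of_bool (enat k \<le> snd s \<and> t = (enat (m - k), snd s - enat k)) * x ^ k)
    + (\<Sum>k=1..m. of_bool (k = 1 \<and> ?B) * x ^ k)"
    by (simp add: transfer_def wcoeff_def distrib_right sum.distrib)
  also have "(\<Sum>k=1..m. of_bool (k = 1 \<and> ?B) * x ^ k) = (\<Sum>k=1..m. if k = 1 then of_bool ?B * x else 0)"
    by (intro sum.cong) auto
  also have "\<dots> = x * of_bool ?B" using assms by (simp add: mult.commute)
  finally show ?thesis .
qed

lemma Wentry_eq_transfer: "m \<ge> 1 \<Longrightarrow> Wentry m x s t = transfer m (wcoeff m) x s t"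
  by (simp add: transfer_wcoeff Wentry_def split_beta mult_ac prod_eq_iff)

text \<open>Only \<open>k = 1\<close> has first target coordinate \<open>m - 1\<close>, and
  \<open>ne\<close> keeps the descending edge away. The phase arguments need the exact weight
  \<open>x\<close>; for irreducibility nonvanishing is enough.\<close>

lemma transfer_wcoeff_ascend:
  assumes m: "m \<ge> 1" and q: "1 \<le> q" and ne: "q - 1 \<noteq> enat (m - 1)"
  shows "transfer m (wcoeff m) x (p, q) (enat (m - 1), q - 1) = x"
proof -
  have "(\<Sum>k=1..m. of_nat (cnum k p) *
      of_bool (enat k \<le> q \<and> (enat (m - 1), q - 1) = (enat (m - k), q - enat k)) * x ^ k) =
      (\<Sum>k=1..m. if k = 1 then x else 0)"
  proof (intro sum.cong refl)
    fix k assume k: "k \<in> {1..m}"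
    hence "enat (m - 1) = enat (m - k) \<longleftrightarrow> k = 1" by auto
    thus "of_nat (cnum k p) *
      of_bool (enat k \<le> q \<and> (enat (m - 1), q - 1) = (enat (m - k), q - enat k)) * x ^ k =
      (if k = 1 then x else 0)"
      using q by (cases "k = 1") (auto simp: cnum_def one_enat_def)
  qed
  thus ?thesis using m ne by (simp add: transfer_wcoeff)
qed

lemma transfer_wcoeff_descend:
  assumes m: "m \<ge> 1" and p: "1 \<le> p" and q: "q < m"
  shows "transfer m (wcoeff m) x (p, enat q) (p - 1, enat (m - 1)) = x"
proof -
  have "(\<Sum>k=1..m. of_nat (cnum k p) *
      of_bool (enat k \<le> enat q \<and> (p - 1, enat (m - 1)) = (enat (m - k), enat q - enat k)) * x ^ k) = 0"
    using q by (intro sum.neutral) auto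
  thus ?thesis using m p by (simp add: transfer_wcoeff)
qed

lemma wcoeff_ascend:
  assumes "1 \<le> k" "enat k \<le> q" "k = 1 \<or> 1 \<le> p"
  shows "wcoeff m k (p, q) (enat (m - k), q - enat k) \<noteq> 0"
  using cnum_pos[OF assms(1,3)] assms(2) by (simp add: wcoeff_def)

lemma wcoeff_descend: "1 \<le> p \<Longrightarrow> wcoeff m 1 (p, q) (p - 1, enat (m - 1)) \<noteq> 0"
  by (simp add: wcoeff_def)

lemma finite_Uset: "finite (Uset m)" and finite_Vset: "finite (Vset m)"
proof -
  have "finite (Bset m)" by (simp add: Bset_def)
  hence fin: "finite (Bset m \<times> Bset m)" by simp
  show "finite (Uset m)" by (rule finite_subset[OF Uset_subset fin])
  show "finite (Vset m)" by (rule finite_subset[OF Vset_subset fin])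
qed

lemma Vset_iff:
  "(enat p, enat q) \<in> Vset m \<longleftrightarrow> p < m \<and> q < p \<or> p + 2 \<le> m \<and> q = m - 1"
  by (auto simp: Vset_def)

text \<open>The edge has length exactly 1, which is more than \<open>row_nonzero\<close>: following
  such edges makes the counts positive for every \<open>n \<ge> 1\<close>.\<close>

lemma Uset_step:
  assumes "m \<ge> 1" "s \<in> Uset m"
  shows "\<exists>t\<in>Uset m. wcoeff m 1 s t \<noteq> 0"
proof
  show "(enat (m - 1), \<infinity>) \<in> Uset m" using assms by (auto simp: Uset_def)
  obtain p where "s = (enat p, \<infinity>)" using assms by (auto simp: Uset_def)
  thus "wcoeff m 1 s (enat (m - 1), \<infinity>) \<noteq> 0"
    using wcoeff_ascend[of 1 \<infinity> "enat p" m] by simp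
qed

lemma Vset_step:
  assumes "m \<ge> 1" "s \<in> Vset m"
  shows "\<exists>t\<in>Vset m. wcoeff m 1 s t \<noteq> 0"
proof -
  obtain p q where s: "s = (enat p, enat q)" using assms(2) by (auto simp: Vset_def)
  show ?thesis
  proof (cases "q = 0")
    case True
    hence "p \<ge> 1" "p < m" using assms(2) by (auto simp: s Vset_iff)
    hence "(enat p - 1, enat (m - 1)) \<in> Vset m" "wcoeff m 1 s (enat p - 1, enat (m - 1)) \<noteq> 0"
      using wcoeff_descend[of "enat p" m "enat q"] by (auto simp: s Vset_iff one_enat_def)
    thus ?thesis by blast
  next
    case False
    hence "(enat (m - 1), enat q - enat 1) \<in> Vset m"
      using assms(2) by (auto simp: s Vset_iff)
    moreover have "wcoeff m 1 s (enat (m - 1), enat q - enat 1) \<noteq> 0"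
      unfolding s by (rule wcoeff_ascend) (use False in auto)
    ultimately show ?thesis by blast
  qed
qed

text \<open>Every state leads to \<open>(m - 1, \<infinity>)\<close> with \<open>k = 1\<close>, and
  from there \<open>k = m - p\<close> leads to \<open>(p, \<infinity>)\<close>; the latter edge
  requires \<open>1 \<le> m - 1\<close>.\<close>

lemma irreducible_system_Uset:
  assumes m: "m \<ge> 2"
  shows "irreducible_system m (wcoeff m) (Uset m)"
proof
  show "finite (Uset m)" by (rule finite_Uset)
  have "(enat 0, \<infinity>) \<in> Uset m" using m by (simp add: Uset_def)
  thus "Uset m \<noteq> {}" by blast
  show "1 \<le> m" using m by simp
  show "\<exists>t\<in>Uset m. \<exists>k\<in>{1..m}. wcoeff m k s t \<noteq> 0" if "s \<in> Uset m" for s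
    using Uset_step[of m s] m that by fastforce
  show "irreducible_on (Uset m) (\<lambda>s t. \<exists>k\<in>{1..m}. wcoeff m k s t \<noteq> 0)"
    unfolding irreducible_on_def
  proof (intro allI impI)
    fix T assume T: "T \<subseteq> Uset m" "T \<noteq> {}"
      and cl: "\<forall>s\<in>T. \<forall>t\<in>Uset m. (\<exists>k\<in>{1..m}. wcoeff m k s t \<noteq> 0) \<longrightarrow> t \<in> T"
    have step: "(enat (m - k), \<infinity>) \<in> T" if "(enat p, \<infinity>) \<in> T" "1 \<le> k" "k \<le> m" "k = 1 \<or> 1 \<le> p" for p k
    proof -
      have "(enat (m - k), \<infinity>) \<in> Uset m" using that by (auto simp: Uset_def)
      moreover have "wcoeff m k (enat p, \<infinity>) (enat (m - k), \<infinity>) \<noteq> 0"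
        using wcoeff_ascend[of k \<infinity> "enat p" m] that by (simp add: one_enat_def)
      ultimately show ?thesis using cl that by fastforce
    qed
    obtain p where "(enat p, \<infinity>) \<in> T" using T by (fastforce simp: Uset_def)
    from step[OF this, of 1] have top: "(enat (m - 1), \<infinity>) \<in> T" using m by simp
    show "T = Uset m"
    proof (intro equalityI T(1) subsetI)
      fix s assume "s \<in> Uset m"
      then obtain p where p: "p < m" "s = (enat p, \<infinity>)" by (auto simp: Uset_def)
      have "(enat (m - (m - p)), \<infinity>) \<in> T" by (rule step[OF top]) (use p m in auto)
      thus "s \<in> T" using p by simp
    qed
  qed
qed

text \<open>
  From any state one descends to \<open>(0, m - 1)\<close>, then visits \<open>(m - 1, m - 2)\<close> and all \<open>(p, m - 1)\<close>;
  a state \<open>(p, q)\<close> with \<open>p - q = d\<close> is reached from \<open>(m - 2, m - 1)\<close> if \<open>d = 1\<close>,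
  and from \<open>(m - d + 1, m - d)\<close> if \<open>d \<ge> 2\<close>.
\<close>

lemma irreducible_system_Vset:
  assumes m: "m \<ge> 2"
  shows "irreducible_system m (wcoeff m) (Vset m)"
proof
  show "finite (Vset m)" by (rule finite_Vset)
  have "(enat 0, enat (m - 1)) \<in> Vset m" using m by (simp only: Vset_iff) simp
  thus "Vset m \<noteq> {}" by blast
  show "1 \<le> m" using m by simp
  show "\<exists>t\<in>Vset m. \<exists>k\<in>{1..m}. wcoeff m k s t \<noteq> 0" if "s \<in> Vset m" for s
    using Vset_step[of m s] m that by fastforce
  show "irreducible_on (Vset m) (\<lambda>s t. \<exists>k\<in>{1..m}. wcoeff m k s t \<noteq> 0)"
    unfolding irreducible_on_def
  proof (intro allI impI)
    fix T assume T: "T \<subseteq> Vset m" "T \<noteq> {}"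
      and cl: "\<forall>s\<in>T. \<forall>t\<in>Vset m. (\<exists>k\<in>{1..m}. wcoeff m k s t \<noteq> 0) \<longrightarrow> t \<in> T"
    have ascend: "(enat (m - k), enat (q - k)) \<in> T"
      if "(enat p, enat q) \<in> T" "1 \<le> k" "k \<le> q" "k = 1 \<or> 1 \<le> p" for p q k
    proof -
      have q: "q < m" using that(1) T(1) m by (auto simp: Vset_iff dest!: subsetD)
      hence "(enat (m - k), enat (q - k)) \<in> Vset m" using that by (auto simp: Vset_iff)
      moreover have "wcoeff m k (enat p, enat q) (enat (m - k), enat (q - k)) \<noteq> 0"
        using wcoeff_ascend[of k "enat q" "enat p" m] that by (simp add: one_enat_def)
      moreover have "k \<in> {1..m}" using that q by simp
      ultimately show ?thesis using cl that(1) by blast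
    qed
    have descend: "(enat p, enat (m - 1)) \<in> T" if "(enat (Suc p), enat q) \<in> T" for p q
    proof -
      have "Suc p < m" using that T(1) m by (auto simp: Vset_iff dest!: subsetD)
      hence "(enat p, enat (m - 1)) \<in> Vset m" by (auto simp: Vset_iff)
      moreover have "wcoeff m 1 (enat (Suc p), enat q) (enat p, enat (m - 1)) \<noteq> 0"
        using wcoeff_descend[of "enat (Suc p)" m "enat q"] by (simp add: one_enat_def)
      ultimately show ?thesis using cl that m by fastforce
    qed
    have descend': "(enat p', enat (m - 1)) \<in> T" if "(enat p, enat q) \<in> T" "p' < p" for p p' q
      using that
    proof (induction p arbitrary: q)
      case (Suc p)
      from descend[OF Suc.prems(1)] have "(enat p, enat (m - 1)) \<in> T" .
      with Suc.IH[OF this] Suc.prems(2) show ?case by (cases "p' = p") auto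
    qed simp
    obtain p q where pq: "(enat p, enat q) \<in> T" using T by (fastforce simp: Vset_def)
    have "(enat 0, enat (m - 1)) \<in> T"
    proof (cases "p = 0")
      case True
      hence "q = m - 1" using pq T(1) by (auto simp: Vset_iff dest!: subsetD)
      thus ?thesis using pq True by simp
    next
      case False thus ?thesis by (intro descend'[OF pq]) simp
    qed
    from ascend[OF this, of 1] have 1: "(enat (m - 1), enat (m - 2)) \<in> T"
      using m by (simp add: numeral_2_eq_2)
    hence row: "(enat p, enat (m - 1)) \<in> T" if "p + 2 \<le> m" for p
      using descend'[OF 1, of p] that by simp
    have diag: "(enat (Suc q), enat q) \<in> T" if "Suc q < m" for q
    proof (cases "Suc q = m - 1")
      case True thus ?thesis using 1 by (metis diff_Suc_1 diff_Suc_Suc numeral_2_eq_2 Suc_diff_Suc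
        One_nat_def diff_diff_left plus_1_eq_Suc)
    next
      case False
      hence q: "q + 3 \<le> m" using that by simp
      have "(enat (m - (m - Suc q)), enat (m - 1 - (m - Suc q))) \<in> T"
        by (rule ascend[OF row[of "m - 2"]]) (use q in auto)
      thus ?thesis using q by simp
    qed
    show "T = Vset m"
    proof (intro equalityI T(1) subsetI)
      fix s assume s: "s \<in> Vset m"
      then obtain p q where pq: "s = (enat p, enat q)" by (auto simp: Vset_def)
      consider "p + 2 \<le> m" "q = m - 1" | "p < m" "p = Suc q" | "p < m" "p \<ge> q + 2"
        using s unfolding pq Vset_iff by linarith
      thus "s \<in> T"
      proof cases
        case 1 thus ?thesis using row pq by simp
      next
        case 2 thus ?thesis using diag pq by simp
      next
        case 3
        define d where "d = p - q"
        have "(enat (Suc (m - d)), enat (m - d)) \<in> T" using 3 by (intro diag) (auto simp: d_def)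
        hence "(enat (m - (m - p)), enat (m - d - (m - p))) \<in> T"
          by (rule ascend) (use 3 in \<open>auto simp: d_def\<close>)
        moreover have "m - (m - p) = p" "m - d - (m - p) = q" using 3 by (auto simp: d_def)
        ultimately show ?thesis using pq by simp
      qed
    qed
  qed
qed

lemma r_crit_eq_crit:
  assumes "irreducible_system m (wcoeff m) C"
  shows "r_crit m C = irreducible_system.crit m (wcoeff m) C"
proof -
  interpret irreducible_system m "wcoeff m" C by fact
  have "Wmat m C x = indexed_mat C (transfer m (wcoeff m) x)" for x
    unfolding Wmat_def by (rule arg_cong[of _ _ "indexed_mat C"]) (intro ext Wentry_eq_transfer m_pos)
  thus ?thesis by (simp add: r_crit_def crit_def spr_def)
qed

section \<open>Passing from the classes to the whole system\<close>

definition succ_closed :: "nat \<Rightarrow> enat \<times> enat \<Rightarrow> (enat \<times> enat) set \<Rightarrow> bool" where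
  "succ_closed m s T \<longleftrightarrow>
     (\<forall>k. 1 \<le> k \<and> k \<le> m \<and> enat k \<le> snd s \<longrightarrow> (enat (m - k), snd s - enat k) \<in> T) \<and>
     (1 \<le> fst s \<longrightarrow> (fst s - 1, enat (m - 1)) \<in> T)"

lemma corner_count_closed:
  assumes "m \<ge> 1" "n \<ge> 1" "finite T" "succ_closed m s T"
  shows "corner_count m s n = of_bool (n = 1) + (\<Sum>k=1..m. \<Sum>t\<in>T. wcoeff m k s t * corner_count m t (n - k))"
  using assms by (intro corner_count_system) (auto simp: succ_closed_def)

lemma corner_count_split:
  assumes "m \<ge> 1" "n \<ge> 1" "finite S" "finite T" "S \<inter> T = {}" "succ_closed m s (S \<union> T)"
  shows "corner_count m s n =
    (of_bool (n = 1) + (\<Sum>k=1..m. \<Sum>t\<in>T. wcoeff m k s t * corner_count m t (n - k))) +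
    (\<Sum>k=1..m. \<Sum>t\<in>S. wcoeff m k s t * corner_count m t (n - k))"
  using corner_count_closed[of m n "S \<union> T" s] assms
  by (simp add: sum.union_disjoint sum.distrib)

text \<open>A path of edges of length 1 inside \<open>S\<close> leads down to \<open>n = 1\<close>,
  where the inhomogeneity contributes 1.\<close>

lemma corner_count_ge_1:
  assumes m: "m \<ge> 1" and fin: "finite T" and sub: "S \<subseteq> T"
    and closed: "\<And>s. s \<in> S \<Longrightarrow> succ_closed m s T"
    and step: "\<And>s. s \<in> S \<Longrightarrow> \<exists>t\<in>S. wcoeff m 1 s t \<noteq> 0"
    and "s \<in> S" "n \<ge> 1"
  shows "corner_count m s n \<ge> 1"
  using assms(6,7)
proof (induction n arbitrary: s)
  case (Suc n)
  note rec = corner_count_closed[OF m Suc.prems(2) fin closed[OF Suc.prems(1)]]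
  show ?case
  proof (cases "n = 0")
    case True thus ?thesis using rec by simp
  next
    case False
    obtain t where t: "t \<in> S" "wcoeff m 1 s t \<noteq> 0" using step[OF Suc.prems(1)] by blast
    have "1 * 1 \<le> wcoeff m 1 s t * corner_count m t (Suc n - 1)"
      using t Suc.IH[OF t(1)] False by (intro mult_le_mono) auto
    also have "\<dots> \<le> (\<Sum>t\<in>T. wcoeff m 1 s t * corner_count m t (Suc n - 1))"
      using t sub fin by (intro member_le_sum) auto
    also have "\<dots> \<le> (\<Sum>k=1..m. \<Sum>t\<in>T. wcoeff m k s t * corner_count m t (Suc n - k))"
      using m by (intro member_le_sum[of 1 "{1..m}"]) auto
    finally show ?thesis using rec by simp
  qed
qed simp

text \<open>Contributions from outside \<open>S\<close> are nonnegative and may be dropped. By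
  monotonicity in the bounds \<open>(p, q)\<close>, any state is dominated by
  \<open>(\<infinity>, \<infinity>)\<close>, so no path from there to \<open>S\<close> has to be
  exhibited.\<close>

lemma count132_lower_bound:
  assumes sys: "irreducible_system m (wcoeff m) S" and fin: "finite T" and sub: "S \<subseteq> T"
    and closed: "\<And>s. s \<in> S \<Longrightarrow> succ_closed m s T"
    and step: "\<And>s. s \<in> S \<Longrightarrow> \<exists>t\<in>S. wcoeff m 1 s t \<noteq> 0"
  shows "\<exists>c>0. \<forall>n\<ge>1. c / r_crit m S ^ n \<le> real (count132 m n)"
proof -
  interpret irreducible_system m "wcoeff m" S by fact
  obtain s where s: "s \<in> S" using nonempty by blast
  obtain c where c: "c > 0" "\<And>n. n \<ge> 1 \<Longrightarrow> c / crit ^ n \<le> real (corner_count m s n)"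
  proof (rule growth_lower_bound[OF _ _ s, of "\<lambda>s n. real (corner_count m s n)"])
    show "1 \<le> real (corner_count m s n)" if "s \<in> S" "1 \<le> n" for s n
      using corner_count_ge_1[OF m_pos fin sub closed step that] by simp
    show "(\<Sum>k=1..m. \<Sum>t\<in>S. real (wcoeff m k s t) * real (corner_count m t (n - k)))
        \<le> real (corner_count m s n)" if "s \<in> S" "m < n" for s n
    proof -
      have "(\<Sum>k=1..m. \<Sum>t\<in>S. wcoeff m k s t * corner_count m t (n - k))
          \<le> (\<Sum>k=1..m. \<Sum>t\<in>T. wcoeff m k s t * corner_count m t (n - k))"
        using fin sub by (intro sum_mono sum_mono2) auto
      also have "\<dots> \<le> corner_count m s n"
        using corner_count_closed[OF m_pos _ fin closed[OF that(1)], of n] that(2) by simp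
      finally show ?thesis
        unfolding of_nat_mult[symmetric] of_nat_sum[symmetric] of_nat_le_iff .
    qed
  qed (rule that)
  have "c / r_crit m S ^ n \<le> real (count132 m n)" if "n \<ge> 1" for n
  proof -
    have "corner_count m s n \<le> count132 m n"
      unfolding count132_eq_corner_count[OF that] by (rule corner_count_mono) auto
    thus ?thesis using c(2)[OF that] unfolding r_crit_eq_crit[OF sys] by linarith
  qed
  with c(1) show ?thesis by blast
qed

text \<open>The passage from one layer to the next: the states of \<open>T\<close>, already bounded,
  enter the system on \<open>S\<close> as an inhomogeneity.\<close>

lemma poly_exp_bounded_corner_count:
  assumes m: "m \<ge> 1" and x: "0 < x" "x \<le> 1"
    and fin: "finite S" "finite T" "S \<inter> T = {}"
    and closed: "\<And>s. s \<in> S \<Longrightarrow> succ_closed m s (S \<union> T)"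
    and v: "\<And>s. s \<in> S \<Longrightarrow> v s > 0"
      "\<And>s. s \<in> S \<Longrightarrow> (\<Sum>t\<in>S. transfer m (wcoeff m) x s t * v t) \<le> v s"
    and T: "\<And>t. t \<in> T \<Longrightarrow> poly_exp_bounded x (\<lambda>n. real (corner_count m t n))"
    and s: "s \<in> S"
  shows "poly_exp_bounded x (\<lambda>n. real (corner_count m s n))"
proof (rule poly_exp_bounded_system[OF fin(1) x v _ _ _ s,
      where F = "\<lambda>s n. real (corner_count m s n)"
        and G = "\<lambda>s n. of_bool (n = 1) + (\<Sum>k=1..m. \<Sum>t\<in>T. real (wcoeff m k s t) * real (corner_count m t (n - k)))"])
  show "poly_exp_bounded x (\<lambda>n. of_bool (n = 1) +
      (\<Sum>k=1..m. \<Sum>t\<in>T. real (wcoeff m k s t) * real (corner_count m t (n - k))))" for s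
    using x T by (intro poly_exp_bounded_add poly_exp_bounded_sum poly_exp_bounded_mult_left
        poly_exp_bounded_shift[where F = "\<lambda>n. real (corner_count m _ n)"] poly_exp_bounded_delta) auto
  fix s n assume "s \<in> S" "(n :: nat) \<ge> 1"
  from corner_count_split[OF m this(2) fin closed[OF this(1)]]
  show "real (corner_count m s n) \<le> of_bool (n = 1) +
      (\<Sum>k=1..m. \<Sum>t\<in>T. real (wcoeff m k s t) * real (corner_count m t (n - k))) +
      (\<Sum>k=1..m. \<Sum>t\<in>S. real (wcoeff m k s t) * real (corner_count m t (n - k)))" by simp
qed (simp_all add: corner_count_0)

lemma regular_at_corner_count:
  assumes m: "m \<ge> 1"
    and fin: "finite S" "finite T" "S \<inter> T = {}"
    and closed: "\<And>s. s \<in> S \<Longrightarrow> succ_closed m s (S \<union> T)"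
    and ker: "\<And>w s. (\<And>s. s \<in> S \<Longrightarrow> (\<Sum>t\<in>S. transfer m (wcoeff m) z s t * w t) = w s) \<Longrightarrow> s \<in> S \<Longrightarrow> w s = 0"
    and T: "\<And>t. t \<in> T \<Longrightarrow> regular_at z (Abs_fps (\<lambda>n. of_nat (corner_count m t n)))"
    and s: "s \<in> S"
  shows "regular_at z (Abs_fps (\<lambda>n. of_nat (corner_count m s n)))"
proof -
  define g where "g s n = of_bool (n = 1) + (\<Sum>k=1..m. \<Sum>t\<in>T. wcoeff m k s t * corner_count m t (n - k))" for s n
  have g0: "g s 0 = 0" for s by (simp add: g_def corner_count_0)
  have g: "regular_at z (Abs_fps (\<lambda>n. of_nat (g s n)))" for s
  proof -
    have "(Abs_fps (\<lambda>n. of_nat (g s n)) :: complex fps) = Abs_fps (\<lambda>n. of_nat (of_bool (n = 1))) +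
        (\<Sum>t\<in>T. transfer m (wcoeff m) fps_X s t * Abs_fps (\<lambda>n. of_nat (corner_count m t n)))"
    proof (rule Abs_fps_linear_recurrence)
      show "g s n = of_bool (n = 1) + (\<Sum>k=1..m. \<Sum>t\<in>T. wcoeff m k s t * corner_count m t (n - k))" for n
        by (simp only: g_def)
    qed (simp_all add: g0 corner_count_0)
    moreover have "Abs_fps (\<lambda>n. of_nat (of_bool (n = 1))) = (fps_X :: complex fps)"
      by (rule fps_ext) (simp add: fps_X_def)
    ultimately show ?thesis
      using T by (auto intro!: regular_at_add regular_at_fps_X regular_at_sum regular_at_transfer_mult)
  qed
  show ?thesis
  proof (rule regular_at_recurrence[OF fin(1) _ _ _ _ _ s, where f = "corner_count m" and g = g and a = "wcoeff m"])
    show "w s = 0" if "\<And>s. s \<in> S \<Longrightarrow> (\<Sum>t\<in>S. transfer m (wcoeff m) z s t * w t) = w s" "s \<in> S"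
      for w s using ker[of w s] that by blast
    show "corner_count m s n = g s n + (\<Sum>k=1..m. \<Sum>t\<in>S. wcoeff m k s t * corner_count m t (n - k))"
      if "s \<in> S" "1 \<le> n" for s n
      unfolding g_def by (rule corner_count_split[OF m that(2) fin closed[OF that(1)]])
  qed (simp_all add: corner_count_0 g0 g)
qed

text \<open>An ascent gives \<open>(m - k, q - k)\<close> with \<open>q - k < m - k\<close>, a
  descent \<open>(p - 1, m - 1)\<close> with \<open>p - 1 \<le> m - 2\<close>: exactly the two kinds
  of states that make up \<open>Vset\<close>.\<close>

lemma succ_closed_Vset:
  assumes "m \<ge> 1" "s \<in> Vset m"
  shows "succ_closed m s (Vset m)"
proof -
  obtain p q where s: "s = (enat p, enat q)" using assms(2) by (auto simp: Vset_def)
  have "p < m" "q < m" using assms by (auto simp: s Vset_iff)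
  thus ?thesis by (auto simp: succ_closed_def s Vset_iff one_enat_def)
qed

lemma succ_closed_Uset:
  assumes "m \<ge> 1" "s \<in> Uset m"
  shows "succ_closed m s (Uset m \<union> Vset m)"
proof -
  obtain p where s: "s = (enat p, \<infinity>)" and p: "p < m" using assms(2) by (auto simp: Uset_def)
  have "(enat (m - k), \<infinity>) \<in> Uset m" if "1 \<le> k" "k \<le> m" for k using that by (auto simp: Uset_def)
  moreover have "(enat (p - 1), enat (m - 1)) \<in> Vset m" if "1 \<le> p" using that p by (auto simp: Vset_iff)
  ultimately show ?thesis by (auto simp: succ_closed_def s one_enat_def)
qed

text \<open>As \<open>\<infinity> - 1 = \<infinity>\<close>, the descent from
  \<open>(\<infinity>, m - 1)\<close> is a loop; it has weight \<open>x\<close> and accounts for a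
  factor \<open>1 - x\<close> in the denominator.\<close>

lemma succ_closed_Eset:
  assumes "m \<ge> 1"
  shows "succ_closed m (\<infinity>, enat (m - 1)) ({(\<infinity>, enat (m - 1))} \<union> Vset m)"
  using assms by (auto simp: succ_closed_def Vset_iff)

lemma succ_closed_top:
  "succ_closed m (\<infinity>, \<infinity>) ({(\<infinity>, \<infinity>)} \<union> ({(\<infinity>, enat (m - 1))} \<union> Uset m))"
  by (auto simp: succ_closed_def Uset_def)

lemma transfer_Eset: "m \<ge> 1 \<Longrightarrow> transfer m (wcoeff m) x (\<infinity>, enat (m - 1)) (\<infinity>, enat (m - 1)) = x"
  using transfer_wcoeff_descend[of m \<infinity> "m - 1" x] by simp

lemma transfer_top: "m \<ge> 1 \<Longrightarrow> transfer m (wcoeff m) x (\<infinity>, \<infinity>) (\<infinity>, \<infinity>) = 0"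
  by (simp add: transfer_wcoeff)

lemma disjoint_layers:
  "Uset m \<inter> Vset m = {}" "{(\<infinity>, enat (m - 1))} \<inter> Vset m = {}"
  "{(\<infinity>, \<infinity>)} \<inter> ({(\<infinity>, enat (m - 1))} \<union> Uset m) = {}"
  by (auto simp: Uset_def Vset_def)

text \<open>Assuming subinvariant vectors instead of irreducible systems also covers
  \<open>m = 1\<close>, where \<open>Vset\<close> is empty.\<close>

lemma count132_upper_bound:
  assumes m: "m \<ge> 1" and x: "0 < x" "x \<le> 1"
    and vU: "\<And>s. s \<in> Uset m \<Longrightarrow> vU s > 0"
      "\<And>s. s \<in> Uset m \<Longrightarrow> (\<Sum>t\<in>Uset m. transfer m (wcoeff m) x s t * vU t) \<le> vU s"
    and vV: "\<And>s. s \<in> Vset m \<Longrightarrow> vV s > 0"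
      "\<And>s. s \<in> Vset m \<Longrightarrow> (\<Sum>t\<in>Vset m. transfer m (wcoeff m) x s t * vV t) \<le> vV s"
  shows "poly_exp_bounded x (\<lambda>n. real (count132 m n))"
proof -
  note bounded = poly_exp_bounded_corner_count[OF m x]
  have V: "poly_exp_bounded x (\<lambda>n. real (corner_count m t n))" if "t \<in> Vset m" for t
    using succ_closed_Vset[OF m] by (intro bounded[OF finite_Vset _ _ _ vV _ that, where T = "{}"]) auto
  have U: "poly_exp_bounded x (\<lambda>n. real (corner_count m t n))" if "t \<in> Uset m" for t
    by (rule bounded[OF finite_Uset finite_Vset disjoint_layers(1) succ_closed_Uset[OF m] vU V that])
  \<comment> \<open>The layer is a single loop of weight \<open>x \<le> 1\<close>, so the constant
    vector is subinvariant.\<close>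
  have E: "poly_exp_bounded x (\<lambda>n. real (corner_count m (\<infinity>, enat (m - 1)) n))"
    using x succ_closed_Eset[OF m] transfer_Eset[OF m, of x]
    by (intro bounded[OF _ finite_Vset disjoint_layers(2) _ _ _ V, where v = "\<lambda>_. 1"]) auto
  have "poly_exp_bounded x (\<lambda>n. real (corner_count m (\<infinity>, \<infinity>) n))"
  proof (rule bounded[OF _ _ disjoint_layers(3), where v = "\<lambda>_. 1"])
    show "poly_exp_bounded x (\<lambda>n. real (corner_count m t n))"
      if "t \<in> {(\<infinity>, enat (m - 1))} \<union> Uset m" for t
      using that U[of t] E by blast
    show "succ_closed m s ({(\<infinity>, \<infinity>)} \<union> ({(\<infinity>, enat (m - 1))} \<union> Uset m))" if "s \<in> {(\<infinity>, \<infinity>)}" for s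
      using that succ_closed_top by blast
  qed (use transfer_top[OF m, of x] finite_Uset in simp_all)
  moreover have "poly_exp_bounded x (\<lambda>n. 1)"
    unfolding poly_exp_bounded_def using x by (intro exI[of _ 0] exI[of _ 1]) (auto simp: power_le_one)
  ultimately have "poly_exp_bounded x (\<lambda>n. real (corner_count m (\<infinity>, \<infinity>) n) + 1)"
    by (rule poly_exp_bounded_add) (rule x)
  thus ?thesis
  proof (rule poly_exp_bounded_mono)
    show "real (count132 m n) \<le> real (corner_count m (\<infinity>, \<infinity>) n) + 1" for n
      using count132_eq_corner_count[of n m] count132_0[of m] by (cases "n = 0") auto
  qed
qed

text \<open>Regularity is passed up through the layers. \<open>z \<noteq> 1\<close> is the kernel
  condition for the loop at \<open>(\<infinity>, m - 1)\<close>, and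
  \<open>(\<infinity>, \<infinity>)\<close> has no loop at all.\<close>

lemma regular_at_gf132:
  assumes m: "m \<ge> 1" and z: "z \<noteq> 1"
    and kerU: "\<And>w s. (\<And>s. s \<in> Uset m \<Longrightarrow> (\<Sum>t\<in>Uset m. transfer m (wcoeff m) z s t * w t) = w s) \<Longrightarrow> s \<in> Uset m \<Longrightarrow> w s = 0"
    and kerV: "\<And>w s. (\<And>s. s \<in> Vset m \<Longrightarrow> (\<Sum>t\<in>Vset m. transfer m (wcoeff m) z s t * w t) = w s) \<Longrightarrow> s \<in> Vset m \<Longrightarrow> w s = 0"
  shows "regular_at z (gf132 m)"
proof -
  note regular = regular_at_corner_count[OF m]
  let ?F = "\<lambda>s. Abs_fps (\<lambda>n. complex_of_nat (corner_count m s n))"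
  have V: "regular_at z (?F t)" if "t \<in> Vset m" for t
  proof (rule regular[where S = "Vset m" and T = "{}"])
    show "w s = 0" if "\<And>s. s \<in> Vset m \<Longrightarrow> (\<Sum>t\<in>Vset m. transfer m (wcoeff m) z s t * w t) = w s"
      "s \<in> Vset m" for w s using kerV[of w s] that by blast
  qed (use finite_Vset succ_closed_Vset[OF m] that in auto)
  have U: "regular_at z (?F t)" if "t \<in> Uset m" for t
  proof (rule regular[OF finite_Uset finite_Vset disjoint_layers(1) succ_closed_Uset[OF m] _ V that])
    show "w s = 0" if "\<And>s. s \<in> Uset m \<Longrightarrow> (\<Sum>t\<in>Uset m. transfer m (wcoeff m) z s t * w t) = w s"
      "s \<in> Uset m" for w s using kerU[of w s] that by blast
  qed
  have E: "regular_at z (?F (\<infinity>, enat (m - 1)))"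
    by (rule regular[OF _ finite_Vset disjoint_layers(2) _ _ V])
      (use z succ_closed_Eset[OF m] transfer_Eset[OF m, of z] in auto)
  have top: "regular_at z (?F (\<infinity>, \<infinity>))"
  proof (rule regular[OF _ _ disjoint_layers(3)])
    show "regular_at z (?F t)" if "t \<in> {(\<infinity>, enat (m - 1))} \<union> Uset m" for t
      using that U[of t] E by blast
    show "succ_closed m s ({(\<infinity>, \<infinity>)} \<union> ({(\<infinity>, enat (m - 1))} \<union> Uset m))" if "s \<in> {(\<infinity>, \<infinity>)}" for s
      using that succ_closed_top by blast
    show "w s = 0" if "\<And>s. s \<in> {(\<infinity>, \<infinity>)} \<Longrightarrow> (\<Sum>t\<in>{(\<infinity>, \<infinity>)}. transfer m (wcoeff m) z s t * w t) = w s"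
      "s \<in> {(\<infinity>, \<infinity>)}" for w s
      using that(1)[of "(\<infinity>, \<infinity>)"] that(2) transfer_top[OF m, of z] by simp
  qed (use finite_Uset in simp_all)
  have "gf132 m = fps_of_poly 1 + ?F (\<infinity>, \<infinity>)"
  proof (rule fps_ext)
    fix n show "gf132 m $ n = (fps_of_poly 1 + ?F (\<infinity>, \<infinity>)) $ n"
      using count132_eq_corner_count[of n m] count132_0[of m]
      by (cases "n = 0") (simp_all add: gf132_def corner_count_0)
  qed
  thus ?thesis by (simp only: regular_at_add[OF regular_at_poly top])
qed

section \<open>Critical radii and aperiodicity of the two classes\<close>

lemma transfer_Uset_loop:
  "m \<ge> 1 \<Longrightarrow> transfer m (wcoeff m) x (enat (m - 1), \<infinity>) (enat (m - 1), \<infinity>) = x"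
  using transfer_wcoeff_ascend[of m \<infinity> x "enat (m - 1)"] by simp

text \<open>At \<open>x = 1\<close> the loop at \<open>(m - 1, \<infinity>)\<close> already uses up
  the eigenvalue 1, and the edge to \<open>(m - 2, \<infinity>)\<close> comes on top of it.\<close>

lemma r_crit_Uset_less_1:
  assumes m: "m \<ge> 2"
  shows "r_crit m (Uset m) < 1"
proof (rule ccontr)
  interpret irreducible_system m "wcoeff m" "Uset m" by (rule irreducible_system_Uset[OF m])
  assume "\<not> r_crit m (Uset m) < 1"
  hence c1: "crit = 1" using crit(2) r_crit_eq_crit[OF irreducible_system_axioms] by simp
  obtain v where v: "\<And>s. s \<in> Uset m \<Longrightarrow> v s > (0 :: real)"
    "\<And>s. s \<in> Uset m \<Longrightarrow> (\<Sum>t\<in>Uset m. transfer m (wcoeff m) 1 s t * v t) = v s"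
    using crit_vector unfolding c1 by blast
  let ?s = "(enat (m - 1), \<infinity> :: enat)" and ?t = "(enat (m - 2), \<infinity> :: enat)"
  have st: "?s \<in> Uset m" "?t \<in> Uset m" using m by (auto simp: Uset_def)
  have "wcoeff m 2 ?s ?t \<noteq> 0"
    using wcoeff_ascend[of 2 \<infinity> "enat (m - 1)" m] m by (simp add: one_enat_def)
  hence "transfer m (wcoeff m) (1 :: real) ?s ?t \<noteq> 0"
    using m transfer_eq_0_iff[of 1 m "wcoeff m" ?s ?t] by auto
  hence pos: "transfer m (wcoeff m) (1 :: real) ?s ?t > 0"
    using transfer_nonneg[of 1 m "wcoeff m" ?s ?t] by simp
  have "v ?s < transfer m (wcoeff m) 1 ?s ?s * v ?s + transfer m (wcoeff m) 1 ?s ?t * v ?t"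
    using pos v(1)[OF st(2)] transfer_Uset_loop[of m "1 :: real"] m by simp
  also have "\<dots> = (\<Sum>t\<in>{?s, ?t}. transfer m (wcoeff m) 1 ?s t * v t)" using m by simp
  also have "\<dots> \<le> (\<Sum>t\<in>Uset m. transfer m (wcoeff m) 1 ?s t * v t)"
    using st v(1) by (intro sum_mono2 finite_Uset mult_nonneg_nonneg transfer_nonneg) (auto intro: less_imp_le)
  also have "\<dots> = v ?s" by (rule v(2)[OF st(1)])
  finally show False by simp
qed

text \<open>\<open>Vset 2\<close> consists of two states that point to each other with weight
  \<open>x\<close>, so the critical radius satisfies \<open>crit * crit = 1\<close>.\<close>

lemma r_crit_Vset_2: "r_crit 2 (Vset 2) = 1"
proof -
  interpret irreducible_system 2 "wcoeff 2" "Vset 2" by (rule irreducible_system_Vset) simp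
  let ?s = "(enat 0, enat 1)" and ?t = "(enat 1, enat 0)"
  have V: "Vset 2 = {?s, ?t}"
  proof -
    have "(p < 2 \<and> q < p \<or> p + 2 \<le> 2 \<and> q = 2 - 1) \<longleftrightarrow> (p = 0 \<and> q = 1 \<or> p = 1 \<and> q = 0)" for p q :: nat
      by auto
    hence iff: "(enat p, enat q) \<in> Vset 2 \<longleftrightarrow> (enat p, enat q) \<in> {?s, ?t}" for p q
      unfolding Vset_iff by simp
    have "\<exists>p q. s = (enat p, enat q)" if "s \<in> Vset 2 \<or> s \<in> {?s, ?t}" for s
      using that unfolding Vset_def by blast
    thus ?thesis using iff by blast
  qed
  obtain v where v: "\<And>s. s \<in> Vset 2 \<Longrightarrow> v s > (0 :: real)"
    "\<And>s. s \<in> Vset 2 \<Longrightarrow> (\<Sum>t\<in>Vset 2. transfer 2 (wcoeff 2) crit s t * v t) = v s"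
    using crit_vector by blast
  have two: "{Suc 0..2} = {1, 2}" by auto
  have "transfer 2 (wcoeff 2) crit ?s ?s = 0" "transfer 2 (wcoeff 2) crit ?s ?t = crit"
    "transfer 2 (wcoeff 2) crit ?t ?s = crit" "transfer 2 (wcoeff 2) crit ?t ?t = 0"
    by (simp_all add: transfer_wcoeff two one_enat_def zero_enat_def cnum_def)
  with v(2)[of ?s] v(2)[of ?t] have "crit * v ?t = v ?s" "crit * v ?s = v ?t"
    by (simp_all add: V)
  hence "crit * (crit * v ?s) = v ?s" by simp
  moreover have "v ?s > 0" using v(1) V by simp
  ultimately have "crit * crit = 1" by simp
  hence "crit = 1" using crit by (metis abs_of_pos real_sqrt_abs2 real_sqrt_one)
  thus ?thesis using r_crit_eq_crit[OF irreducible_system_axioms] by simp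
qed

text \<open>The loop of weight \<open>x\<close> at \<open>(m - 1, \<infinity>)\<close> turns the
  phase relation into \<open>z = crit\<close>.\<close>

lemma no_fixed_vector_Uset:
  assumes m: "m \<ge> 2" and z: "cmod z \<le> r_crit m (Uset m)" "z \<noteq> of_real (cmod z)"
    and ev: "\<And>s. s \<in> Uset m \<Longrightarrow> (\<Sum>t\<in>Uset m. transfer m (wcoeff m) z s t * w t) = w s"
    and s: "s \<in> Uset m"
  shows "w s = 0"
proof (rule ccontr)
  interpret irreducible_system m "wcoeff m" "Uset m" by (rule irreducible_system_Uset[OF m])
  assume "w s \<noteq> 0"
  hence nz: "\<exists>s\<in>Uset m. w s \<noteq> 0" using s by blast
  have z': "cmod z \<le> crit" using z(1) r_crit_eq_crit[OF irreducible_system_axioms] by simp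
  obtain u where u: "\<And>s. s \<in> Uset m \<Longrightarrow> u s \<noteq> 0"
    "\<And>s t. s \<in> Uset m \<Longrightarrow> t \<in> Uset m \<Longrightarrow>
      transfer m (wcoeff m) z s t * u t = of_real (transfer m (wcoeff m) crit s t) * u s"
    using fixed_vector_phases[OF z' ev nz] by blast
  have "(enat (m - 1), \<infinity>) \<in> Uset m" using m by (auto simp: Uset_def)
  with u(1)[OF this] u(2)[OF this this] have "z = of_real crit"
    using transfer_Uset_loop[of m z] transfer_Uset_loop[of m crit] m by simp
  thus False using z(2) crit(1) by simp
qed

text \<open>
  The edges from \<open>(1, m - 1)\<close> to \<open>(0, m - 1)\<close> and from both of these to \<open>(m - 1, m - 2)\<close> all have
  weight \<open>x\<close>, which gives two cycles of lengths differing by one. They exist for \<open>m \<ge> 3\<close>; for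
  \<open>m = 2\<close> the system on \<^const>\<open>Vset\<close> has period 2, but a larger critical radius than that on \<^const>\<open>Uset\<close>.
\<close>

lemma no_fixed_vector_Vset:
  assumes m: "m \<ge> 2" and z: "cmod z \<le> rho m" "z \<noteq> of_real (cmod z)"
    and ev: "\<And>s. s \<in> Vset m \<Longrightarrow> (\<Sum>t\<in>Vset m. transfer m (wcoeff m) z s t * w t) = w s"
    and s: "s \<in> Vset m"
  shows "w s = 0"
proof -
  interpret irreducible_system m "wcoeff m" "Vset m" by (rule irreducible_system_Vset[OF m])
  have z': "cmod z \<le> crit" using z(1) r_crit_eq_crit[OF irreducible_system_axioms] by (simp add: rho_def)
  show ?thesis
  proof (cases "m = 2")
    case True
    have "cmod z \<le> r_crit m (Uset m)" using z(1) by (simp add: rho_def)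
    also have "\<dots> < 1" by (rule r_crit_Uset_less_1[OF m])
    also have "1 = crit" using r_crit_Vset_2 r_crit_eq_crit[OF irreducible_system_axioms] True by simp
    finally show ?thesis by (rule no_fixed_vector_inside[OF _ ev s])
  next
    case False
    hence m3: "m \<ge> 3" using m by simp
    show ?thesis
    proof (rule ccontr)
      assume "w s \<noteq> 0"
      hence nz: "\<exists>s\<in>Vset m. w s \<noteq> 0" using s by blast
      obtain u where u: "\<And>s. s \<in> Vset m \<Longrightarrow> u s \<noteq> 0"
        "\<And>s t. s \<in> Vset m \<Longrightarrow> t \<in> Vset m \<Longrightarrow>
          transfer m (wcoeff m) z s t * u t = of_real (transfer m (wcoeff m) crit s t) * u s"
        using fixed_vector_phases[OF z' ev nz] by blast
      let ?s0 = "(enat 0, enat (m - 1))" and ?s1 = "(enat 1, enat (m - 1))"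
        and ?t = "(enat (m - 1), enat (m - 2))"
      have V: "?s0 \<in> Vset m" "?s1 \<in> Vset m" "?t \<in> Vset m"
        using m3 by (simp_all only: Vset_iff) simp_all
      have 10: "transfer m (wcoeff m) x ?s1 ?s0 = x" for x :: "'b::comm_semiring_1"
        using transfer_wcoeff_descend[of m "enat 1" "m - 1" x] m3 by (simp add: one_enat_def)
      have ne: "enat (m - 2) \<noteq> enat (m - 1)" using m3 by simp
      have t: "enat (m - 1) - 1 = enat (m - 2)" using m3 by (simp add: one_enat_def numeral_2_eq_2)
      have pt: "transfer m (wcoeff m) x (p, enat (m - 1)) ?t = x" for p and x :: "'b::comm_semiring_1"
        using transfer_wcoeff_ascend[of m "enat (m - 1)" x p, unfolded t] m3 ne by (simp add: one_enat_def)
      have "z * u ?s0 = of_real crit * u ?s1" using u(2)[OF V(2,1)] unfolding 10 .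
      moreover have "z * u ?t = of_real crit * u ?s1" using u(2)[OF V(2,3)] unfolding pt .
      moreover have "z * u ?t = of_real crit * u ?s0" using u(2)[OF V(1,3)] unfolding pt .
      ultimately have "z * u ?s0 = of_real crit * u ?s0" by simp
      hence "z = of_real crit" using u(1)[OF V(1)] by simp
      thus False using z(2) crit(1) by simp
    qed
  qed
qed

lemma rho_pos: "m \<ge> 2 \<Longrightarrow> 0 < rho m" and rho_le_1: "m \<ge> 2 \<Longrightarrow> rho m \<le> 1"
  by (simp_all add: rho_def r_crit_eq_crit min_le_iff_disj irreducible_system.crit
    irreducible_system_Uset irreducible_system_Vset)

text \<open>The class with the smaller critical radius gives the lower bound; for the upper bound,
  both classes have subinvariant vectors at \<open>rho m\<close>.\<close>

lemma count132_bounds: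
  assumes m: "m \<ge> 2"
  shows "\<exists>c>0. \<forall>n\<ge>1. c / rho m ^ n \<le> real (count132 m n)"
    and "poly_exp_bounded (rho m) (\<lambda>n. real (count132 m n))"
proof -
  interpret U: irreducible_system m "wcoeff m" "Uset m" by (rule irreducible_system_Uset[OF m])
  interpret V: irreducible_system m "wcoeff m" "Vset m" by (rule irreducible_system_Vset[OF m])
  have m1: "m \<ge> 1" using m by simp
  note crit_eq = r_crit_eq_crit[OF U.irreducible_system_axioms] r_crit_eq_crit[OF V.irreducible_system_axioms]
  have U: "\<exists>c>0. \<forall>n\<ge>1. c / r_crit m (Uset m) ^ n \<le> real (count132 m n)"
    by (rule count132_lower_bound[of m "Uset m" "Uset m \<union> Vset m"])
      (use finite_Uset finite_Vset succ_closed_Uset[OF m1] Uset_step[OF m1] U.irreducible_system_axioms in auto)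
  have V: "\<exists>c>0. \<forall>n\<ge>1. c / r_crit m (Vset m) ^ n \<le> real (count132 m n)"
    by (rule count132_lower_bound[of m "Vset m" "Vset m"])
      (use finite_Vset succ_closed_Vset[OF m1] Vset_step[OF m1] V.irreducible_system_axioms in auto)
  show "\<exists>c>0. \<forall>n\<ge>1. c / rho m ^ n \<le> real (count132 m n)"
    using U V unfolding rho_def by (cases "r_crit m (Uset m) \<le> r_crit m (Vset m)") (simp_all add: min_def)
  have r: "0 \<le> rho m" "rho m \<le> U.crit" "rho m \<le> V.crit"
    using rho_pos[OF m] by (auto simp: rho_def crit_eq)
  obtain vU where vU: "\<And>s. s \<in> Uset m \<Longrightarrow> vU s > 0"
    "\<And>s. s \<in> Uset m \<Longrightarrow> (\<Sum>t\<in>Uset m. transfer m (wcoeff m) (rho m) s t * vU t) \<le> vU s"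
    using U.subinvariant_vector[OF r(1,2)] by blast
  obtain vV where vV: "\<And>s. s \<in> Vset m \<Longrightarrow> vV s > 0"
    "\<And>s. s \<in> Vset m \<Longrightarrow> (\<Sum>t\<in>Vset m. transfer m (wcoeff m) (rho m) s t * vV t) \<le> vV s"
    using V.subinvariant_vector[OF r(1,3)] by blast
  show "poly_exp_bounded (rho m) (\<lambda>n. real (count132 m n))"
    by (rule count132_upper_bound[OF m1 rho_pos[OF m] rho_le_1[OF m] vU vV])
qed

text \<open>For \<open>m = 1\<close> the class \<open>Uset 1\<close> is a single loop of weight
  \<open>x\<close> and \<open>Vset 1\<close> is empty, so the counts are at least 1 and grow at most
  polynomially.\<close>

lemma root_count132_1: "(\<lambda>n. root n (real (count132 1 n))) \<longlonglongrightarrow> 1"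
proof -
  have U: "Uset (Suc 0) = {(enat 0, \<infinity>)}" by (auto simp: Uset_def)
  have V: "Vset (Suc 0) = {}" by (auto simp: Vset_def)
  have lower: "1 / 1 ^ n \<le> real (count132 1 n)" if n: "n \<ge> 1" for n
  proof -
    have "1 \<le> corner_count 1 (enat (1 - 1), \<infinity>) n"
      by (rule corner_count_ge_1[of 1 "Uset 1 \<union> Vset 1" "Uset 1"])
        (use finite_Uset finite_Vset succ_closed_Uset[of 1] Uset_step[of 1] n in \<open>auto simp: U\<close>)
    also have "\<dots> \<le> count132 1 n"
      unfolding count132_eq_corner_count[OF n] by (rule corner_count_mono) auto
    finally show ?thesis by simp
  qed
  have "poly_exp_bounded 1 (\<lambda>n. real (count132 1 n))"
    by (rule count132_upper_bound[where vU = "\<lambda>_. 1" and vV = "\<lambda>_. 1"])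
      (use transfer_Uset_loop[of 1 "1 :: real"] in \<open>simp_all add: U V\<close>)
  from root_limit[OF _ _ lower this] show ?thesis by simp
qed

theorem theorem4p12:
  shows "((\<lambda>n. root n (real (count132 1 n))) \<longlonglongrightarrow> 1) \<and>
    (\<forall>m\<ge>2.
       ((\<lambda>n. root n (real (count132 m n))) \<longlonglongrightarrow> alpha m) \<and>
       fps_conv_radius (gf132 m) = ereal (rho m) \<and>
       alpha m = inverse (rho m) \<and>
       (\<forall>z. cmod z = rho m \<longrightarrow> (rational_fps_pole (gf132 m) z \<longleftrightarrow> z = of_real (rho m))))"
proof (intro conjI allI impI)
  show "(\<lambda>n. root n (real (count132 1 n))) \<longlonglongrightarrow> 1" by (rule root_count132_1)
  fix m :: nat assume m: "m \<ge> 2"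
  interpret U: irreducible_system m "wcoeff m" "Uset m" by (rule irreducible_system_Uset[OF m])
  interpret V: irreducible_system m "wcoeff m" "Vset m" by (rule irreducible_system_Vset[OF m])
  have m1: "m \<ge> 1" using m by simp
  note crit_eq = r_crit_eq_crit[OF U.irreducible_system_axioms] r_crit_eq_crit[OF V.irreducible_system_axioms]
  show alpha: "alpha m = inverse (rho m)"
    using U.crit(1) V.crit(1)
    by (auto simp: alpha_def rho_def lambda_U_def lambda_V_def crit_eq min_def max_def)
  obtain c where c: "c > 0" "\<And>n. n \<ge> 1 \<Longrightarrow> c / rho m ^ n \<le> real (count132 m n)"
    using count132_bounds(1)[OF m] by blast
  have lim: "(\<lambda>n. root n (real (count132 m n))) \<longlonglongrightarrow> inverse (rho m)"
    by (rule root_limit[OF rho_pos[OF m] c count132_bounds(2)[OF m]])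
  thus "(\<lambda>n. root n (real (count132 m n))) \<longlonglongrightarrow> alpha m" by (simp add: alpha)
  show rad: "fps_conv_radius (gf132 m) = ereal (rho m)"
    unfolding fps_conv_radius_def
    by (rule conv_radius_root_limit) (use lim rho_pos[OF m] in \<open>simp_all add: gf132_def\<close>)
  have sing: "\<not> regular_at (of_real (rho m)) (gf132 m)"
    unfolding gf132_def
    by (rule not_regular_at_radius[OF rho_pos[OF m] c]) (use rad in \<open>simp_all add: gf132_def\<close>)
  \<comment> \<open>Regularity at 0 serves to establish that the series is rational, whereupon the
    failure of regularity at \<open>rho m\<close> becomes a pole.\<close>
  have "regular_at 0 (gf132 m)"
  proof (rule regular_at_gf132[OF m1])
    show "w s = 0" if "\<And>s. s \<in> Uset m \<Longrightarrow> (\<Sum>t\<in>Uset m. transfer m (wcoeff m) 0 s t * w t) = w s"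
      "s \<in> Uset m" for s and w :: "enat \<times> enat \<Rightarrow> complex" by (rule U.no_fixed_vector_inside[OF _ that]) (use U.crit(1) in simp)
    show "w s = 0" if "\<And>s. s \<in> Vset m \<Longrightarrow> (\<Sum>t\<in>Vset m. transfer m (wcoeff m) 0 s t * w t) = w s"
      "s \<in> Vset m" for s and w :: "enat \<times> enat \<Rightarrow> complex" by (rule V.no_fixed_vector_inside[OF _ that]) (use V.crit(1) in simp)
  qed simp
  from pole_if_not_regular_at[OF this sing]
  have pole: "rational_fps_pole (gf132 m) (of_real (rho m))" .
  fix z assume z: "cmod z = rho m"
  show "rational_fps_pole (gf132 m) z \<longleftrightarrow> z = of_real (rho m)"
  proof (cases "z = of_real (rho m)")
    case True thus ?thesis using pole by simp
  next
    case False
    hence ne: "z \<noteq> of_real (cmod z)" using z by simp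
    have zU: "cmod z \<le> r_crit m (Uset m)" and zV: "cmod z \<le> rho m" using z by (simp_all add: rho_def)
    have "regular_at z (gf132 m)"
    proof (rule regular_at_gf132[OF m1])
      show "z \<noteq> 1" using ne by auto
      show "w s = 0" if "\<And>s. s \<in> Uset m \<Longrightarrow> (\<Sum>t\<in>Uset m. transfer m (wcoeff m) z s t * w t) = w s"
        "s \<in> Uset m" for s and w :: "enat \<times> enat \<Rightarrow> complex" by (rule no_fixed_vector_Uset[OF m zU ne that])
      show "w s = 0" if "\<And>s. s \<in> Vset m \<Longrightarrow> (\<Sum>t\<in>Vset m. transfer m (wcoeff m) z s t * w t) = w s"
        "s \<in> Vset m" for s and w :: "enat \<times> enat \<Rightarrow> complex" by (rule no_fixed_vector_Vset[OF m zV ne that])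
    qed
    thus ?thesis using not_pole_if_regular_at False by blast
  qed
qed

end
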